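(* Let $\mathcal{F}$ be a collection of finitely many bounded Borel subsets of $\mathbb{R}^d$ such that - each $F\in\mathcal{F}$ is contained in a $k_F$-dimensional affine subspace $V_F\subset\mathbb{R}^d$ and $\mathcal{H}^{k_F}(F)>0$, and - for any $F,F'\in\mathcal{F}$ with $k_F>k_{F'}$, we have $V_{F'}+\tau\not\subset V_F$ for every $\tau\in\mathbb{R}^d$. Then the measure $$\sum_{F\in\mathcal{F}}\mathcal{H}^{k_F}\big|_F$$ admits a Fourier frame.
   Context: $\mathcal{H}^{k}$ denotes $k$-dimensional Hausdorff measure on $\mathbb{R}^d$ (normalized to agree with Lebesgue measure on $k$-dimensional affine subspaces), and $\mathcal{H}^k|_F$ its restriction to $F$. A finite positive Borel measure $\mu$ on $\mathbb{R}^d$ admits a Fourier frame if there exist a countable set $\Lambda\subset\mathbb{R}^d$ and constants $0<A\le B<\infty$ such that $A\int|f|^2d\mu\le\sum_{\lambda\in\Lambda}|\int f(x)e^{-2\pi i\lambda\cdot x}d\mu(x)|^2\le B\int|f|^2d\mu$ for all $f\in L^2(\mu)$. *)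

theory Defs
  imports "HOL-Analysis.Analysis"
begin

section \<open>Hausdorff measure of integer dimension\<close>

text \<open>
  The constant \<open>unit_ball_vol k / 2 ^ k\<close> is the volume of a ball of diameter one in dimension
  \<open>k\<close>. It is the factor for which the \<open>k\<close>-dimensional Hausdorff measure agrees with Lebesgue measure
  on \<open>k\<close>-dimensional affine subspaces (by the isodiametric inequality). The empty set has to be
  treated separately because \<open>0 ^ 0 = 1\<close>; nonempty sets have weight 1 for \<open>k = 0\<close>, so that
  dimension 0 gives the counting measure.
\<close>

definition hausdorff_weight :: "nat \<Rightarrow> 'a::metric_space set \<Rightarrow> ennreal" where
  "hausdorff_weight k U =
     (if U = {} then 0 else ennreal (unit_ball_vol (real k) * (diameter U / 2) ^ k))"

text \<open>Boundedness is required explicitly because \<^const>\<open>diameter\<close> is unspecified on unbounded sets.\<close>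

definition fine_covers :: "real \<Rightarrow> 'a::metric_space set \<Rightarrow> (nat \<Rightarrow> 'a set) set" where
  "fine_covers \<delta> A = {U. (\<forall>i. bounded (U i) \<and> diameter (U i) \<le> \<delta>) \<and> A \<subseteq> (\<Union>i. U i)}"

definition hausdorff_premeasure :: "nat \<Rightarrow> real \<Rightarrow> 'a::metric_space set \<Rightarrow> ennreal" where
  "hausdorff_premeasure k \<delta> A = (INF U\<in>fine_covers \<delta> A. \<Sum>i. hausdorff_weight k (U i))"

definition hausdorff_outer :: "nat \<Rightarrow> 'a::metric_space set \<Rightarrow> ennreal" where
  "hausdorff_outer k A = (SUP \<delta>\<in>{0<..}. hausdorff_premeasure k \<delta> A)"

definition hausdorff_measure :: "nat \<Rightarrow> 'a::metric_space measure" where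
  "hausdorff_measure k = measure_of UNIV (sets borel) (hausdorff_outer k)"

text \<open>
  \<^const>\<open>measure_of\<close> yields the zero measure if its argument is not countably additive. The following
  lemmas show that this does not happen: the Hausdorff outer measure is a metric outer measure,
  so by Caratheodory's criterion it is countably additive on the Borel sets.
\<close>

lemma space_hausdorff_measure [simp]: "space (hausdorff_measure k) = UNIV"
  by (simp add: hausdorff_measure_def)

lemma sets_hausdorff_measure [simp, measurable_cong]: "sets (hausdorff_measure k) = sets borel"
  unfolding hausdorff_measure_def
  by (metis sets.sigma_sets_eq sets_measure_of space_borel top_greatest Pow_UNIV)

lemma hausdorff_weight_empty [simp]: "hausdorff_weight k {} = 0"
  by (simp add: hausdorff_weight_def)

lemma hausdorff_weight_mono:
  assumes "U \<subseteq> V" "bounded V"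
  shows "hausdorff_weight k U \<le> hausdorff_weight k V"
  using assms
  by (auto simp: hausdorff_weight_def intro!: ennreal_leI mult_left_mono power_mono
      divide_right_mono diameter_subset divide_nonneg_nonneg diameter_ge_0 bounded_subset[OF assms(2)])

lemma hausdorff_premeasure_empty:
  assumes "0 < \<delta>"
  shows "hausdorff_premeasure k \<delta> ({} :: 'a::metric_space set) = 0"
proof -
  have "(\<lambda>i. {}) \<in> fine_covers \<delta> ({} :: 'a set)"
    using assms by (simp add: fine_covers_def)
  then have "hausdorff_premeasure k \<delta> ({} :: 'a set) \<le> (\<Sum>i::nat. hausdorff_weight k ({} :: 'a set))"
    unfolding hausdorff_premeasure_def by (rule INF_lower)
  then show ?thesis by simp
qed

lemma hausdorff_premeasure_mono: "A \<subseteq> B \<Longrightarrow> hausdorff_premeasure k \<delta> A \<le> hausdorff_premeasure k \<delta> B"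
  unfolding hausdorff_premeasure_def fine_covers_def by (rule INF_superset_mono) auto

lemma hausdorff_premeasure_antimono:
  "\<delta> \<le> \<epsilon> \<Longrightarrow> hausdorff_premeasure k \<epsilon> A \<le> hausdorff_premeasure k \<delta> A"
  unfolding hausdorff_premeasure_def fine_covers_def
  by (rule INF_superset_mono) (auto intro: order_trans)

lemma hausdorff_premeasure_UN:
  fixes A :: "nat \<Rightarrow> 'a::metric_space set"
  shows "hausdorff_premeasure k \<delta> (\<Union>n. A n) \<le> (\<Sum>n. hausdorff_premeasure k \<delta> (A n))"
proof (rule ennreal_le_epsilon)
  fix e :: real assume e: "0 < e" and fin: "(\<Sum>n. hausdorff_premeasure k \<delta> (A n)) < top"
  have "\<exists>U\<in>fine_covers \<delta> (A n).
      (\<Sum>i. hausdorff_weight k (U i)) < hausdorff_premeasure k \<delta> (A n) + ennreal (e * (1/2)^Suc n)" for n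
  proof -
    have "hausdorff_premeasure k \<delta> (A n) < top"
      using fin ennreal_suminf_lessD by blast
    moreover have "0 < ennreal (e * (1/2)^Suc n)"
      using e by simp
    ultimately have "hausdorff_premeasure k \<delta> (A n)
        < hausdorff_premeasure k \<delta> (A n) + ennreal (e * (1/2)^Suc n)"
      by (metis add.right_neutral ennreal_add_left_cancel_less infinity_ennreal_def less_top)
    then show ?thesis
      unfolding hausdorff_premeasure_def[of k \<delta> "A n"] INF_less_iff .
  qed
  then obtain U where U: "\<And>n. U n \<in> fine_covers \<delta> (A n)"
    and less: "\<And>n. (\<Sum>i. hausdorff_weight k (U n i))
                  < hausdorff_premeasure k \<delta> (A n) + ennreal (e * (1/2)^Suc n)"
    by metis
  define V where "V = (\<lambda>j. case prod_decode j of (n, i) \<Rightarrow> U n i)"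
  have "V \<in> fine_covers \<delta> (\<Union>n. A n)"
  proof -
    have "x \<in> (\<Union>j. V j)" if xn: "x \<in> A n" for x n
    proof -
      obtain i where "x \<in> U n i"
        using U[of n] xn unfolding fine_covers_def by blast
      then have "x \<in> V (prod_encode (n, i))"
        by (simp add: V_def)
      then show ?thesis by blast
    qed
    with U show ?thesis
      by (auto simp: fine_covers_def V_def split: prod.split)
  qed
  then have "hausdorff_premeasure k \<delta> (\<Union>n. A n) \<le> (\<Sum>j. hausdorff_weight k (V j))"
    unfolding hausdorff_premeasure_def by (rule INF_lower)
  also have "\<dots> = (\<Sum>n. \<Sum>i. hausdorff_weight k (U n i))"
    using suminf_ennreal_2dimen[of "\<lambda>n. \<Sum>i. hausdorff_weight k (U n i)"
        "\<lambda>(n, i). hausdorff_weight k (U n i)"]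
    by (simp add: V_def case_prod_unfold)
  also have "\<dots> \<le> (\<Sum>n. hausdorff_premeasure k \<delta> (A n) + ennreal (e * (1/2)^Suc n))"
    by (intro suminf_le less_imp_le[OF less]) auto
  also have "\<dots> = (\<Sum>n. hausdorff_premeasure k \<delta> (A n)) + (\<Sum>n. ennreal (e * (1/2)^Suc n))"
    by (intro suminf_add[symmetric]) auto
  also have "(\<Sum>n. ennreal (e * (1/2)^Suc n)) = ennreal e"
  proof -
    have "(\<lambda>n. e * (1/2)^Suc n) sums (e * 1)"
      by (intro sums_mult power_half_series)
    then show ?thesis
      using e by (intro suminf_ennreal_eq) auto
  qed
  finally show "hausdorff_premeasure k \<delta> (\<Union>n. A n) \<le> (\<Sum>n. hausdorff_premeasure k \<delta> (A n)) + ennreal e" .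
qed

lemma hausdorff_outer_empty [simp]: "hausdorff_outer k {} = 0"
  by (simp add: hausdorff_outer_def hausdorff_premeasure_empty)

lemma hausdorff_outer_mono: "A \<subseteq> B \<Longrightarrow> hausdorff_outer k A \<le> hausdorff_outer k B"
  unfolding hausdorff_outer_def by (intro SUP_mono') (rule hausdorff_premeasure_mono)

lemma hausdorff_outer_UN: "hausdorff_outer k (\<Union>n. A n) \<le> (\<Sum>n. hausdorff_outer k (A (n::nat)))"
  unfolding hausdorff_outer_def[of k "\<Union>n. A n"]
proof (rule SUP_least)
  fix \<delta> :: real assume "\<delta> \<in> {0<..}"
  then have "(\<Sum>n. hausdorff_premeasure k \<delta> (A n)) \<le> (\<Sum>n. hausdorff_outer k (A n))"
    by (intro suminf_le) (auto simp: hausdorff_outer_def intro: SUP_upper)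
  then show "hausdorff_premeasure k \<delta> (\<Union>n. A n) \<le> (\<Sum>n. hausdorff_outer k (A n))"
    using hausdorff_premeasure_UN order_trans by blast
qed

lemma outer_measure_space_hausdorff_outer: "outer_measure_space UNIV (hausdorff_outer k)"
  by (auto simp: outer_measure_space_def positive_def increasing_def countably_subadditive_def
      hausdorff_outer_mono hausdorff_outer_UN)

lemma hausdorff_outer_Un: "hausdorff_outer k (A \<union> B) \<le> hausdorff_outer k A + hausdorff_outer k B"
proof -
  interpret sigma_algebra UNIV "UNIV :: 'a set set"
    using sigma_algebra_Pow[of "UNIV :: 'a set"] by simp
  show ?thesis
    using countably_subadditive_subadditive[of "hausdorff_outer k"]
      outer_measure_space_hausdorff_outer[of k]
    unfolding outer_measure_space_def subadditive_def
    by (metis (no_types, lifting) Diff_disjoint Diff_subset Un_Diff_cancel UNIV_I add_left_mono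
        hausdorff_outer_mono order_trans)
qed

lemma hausdorff_premeasure_separated:
  assumes d: "\<And>a b. a \<in> A \<Longrightarrow> b \<in> B \<Longrightarrow> d \<le> dist a b" and "\<delta> < d"
  shows "hausdorff_premeasure k \<delta> A + hausdorff_premeasure k \<delta> B \<le> hausdorff_premeasure k \<delta> (A \<union> B)"
  unfolding hausdorff_premeasure_def[of k \<delta> "A \<union> B"]
proof (rule INF_greatest)
  fix U assume U: "U \<in> fine_covers \<delta> (A \<union> B)"
  have sub: "(\<lambda>i. U i \<inter> C) \<in> fine_covers \<delta> C" if "C \<subseteq> A \<union> B" for C
  proof -
    have "bounded (U i \<inter> C)" "diameter (U i \<inter> C) \<le> \<delta>" for i
    proof -
      have "bounded (U i)" "diameter (U i) \<le> \<delta>"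
        using U by (auto simp: fine_covers_def)
      then show "bounded (U i \<inter> C)" "diameter (U i \<inter> C) \<le> \<delta>"
        using diameter_subset[of "U i \<inter> C" "U i"] by (auto intro: bounded_subset)
    qed
    moreover have "C \<subseteq> (\<Union>i. U i \<inter> C)"
      using U that unfolding fine_covers_def by blast
    ultimately show ?thesis
      by (simp add: fine_covers_def)
  qed
  have "hausdorff_premeasure k \<delta> A + hausdorff_premeasure k \<delta> B
      \<le> (\<Sum>i. hausdorff_weight k (U i \<inter> A)) + (\<Sum>i. hausdorff_weight k (U i \<inter> B))"
    unfolding hausdorff_premeasure_def by (intro add_mono INF_lower sub) auto
  also have "\<dots> = (\<Sum>i. hausdorff_weight k (U i \<inter> A) + hausdorff_weight k (U i \<inter> B))"
    by (rule suminf_add) auto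
  also have "\<dots> \<le> (\<Sum>i. hausdorff_weight k (U i))"
  proof (intro suminf_le)
    fix i
    have bd: "bounded (U i)" "diameter (U i) \<le> \<delta>"
      using U by (auto simp: fine_covers_def)
    have "U i \<inter> A = {} \<or> U i \<inter> B = {}"
      using d diameter_bounded_bound[OF bd(1)] bd(2) \<open>\<delta> < d\<close> by fastforce
    then show "hausdorff_weight k (U i \<inter> A) + hausdorff_weight k (U i \<inter> B) \<le> hausdorff_weight k (U i)"
      using hausdorff_weight_mono[OF _ bd(1), of _ k] by auto
  qed auto
  finally show "hausdorff_premeasure k \<delta> A + hausdorff_premeasure k \<delta> B
      \<le> (\<Sum>i. hausdorff_weight k (U i))" .
qed

lemma hausdorff_outer_separated:
  assumes d: "\<And>a b. a \<in> A \<Longrightarrow> b \<in> B \<Longrightarrow> d \<le> dist a b" and "0 < d"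
  shows "hausdorff_outer k A + hausdorff_outer k B \<le> hausdorff_outer k (A \<union> B)"
proof -
  have *: "hausdorff_premeasure k \<delta> A + hausdorff_premeasure k \<epsilon> B \<le> hausdorff_outer k (A \<union> B)"
    if "0 < \<delta>" "0 < \<epsilon>" for \<delta> \<epsilon>
  proof -
    define \<eta> where "\<eta> = min (min \<delta> \<epsilon>) (d / 2)"
    have \<eta>: "0 < \<eta>" "\<eta> \<le> \<delta>" "\<eta> \<le> \<epsilon>" "\<eta> < d"
      using that \<open>0 < d\<close> by (auto simp: \<eta>_def)
    have "hausdorff_premeasure k \<delta> A + hausdorff_premeasure k \<epsilon> B
        \<le> hausdorff_premeasure k \<eta> A + hausdorff_premeasure k \<eta> B"
      using \<eta> by (intro add_mono hausdorff_premeasure_antimono)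
    also have "\<dots> \<le> hausdorff_premeasure k \<eta> (A \<union> B)"
      using d \<eta> by (intro hausdorff_premeasure_separated) auto
    also have "\<dots> \<le> hausdorff_outer k (A \<union> B)"
      using \<eta> by (auto simp: hausdorff_outer_def intro: SUP_upper)
    finally show ?thesis .
  qed
  have ne: "{0::real<..} \<noteq> {}" by simp
  have "hausdorff_premeasure k \<delta> A + hausdorff_outer k B \<le> hausdorff_outer k (A \<union> B)"
    if "0 < \<delta>" for \<delta>
    unfolding hausdorff_outer_def[of k B] ennreal_SUP_add_right[OF ne]
    by (intro SUP_least) (simp add: * that)
  then show ?thesis
    unfolding hausdorff_outer_def[of k A] ennreal_SUP_add_left[OF ne, symmetric]
    by (intro SUP_least) simp
qed

lemma closed_in_lambda_system:
  fixes C :: "'a::metric_space set"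
  assumes "closed C"
  shows "hausdorff_outer k (E \<inter> C) + hausdorff_outer k (E - C) = hausdorff_outer k E"
proof (rule antisym)
  let ?H = "hausdorff_outer k :: 'a set \<Rightarrow> ennreal"
  show "?H E \<le> ?H (E \<inter> C) + ?H (E - C)"
    using hausdorff_outer_Un[of k "E \<inter> C" "E - C"] by (simp add: Int_Diff_Un)
  show "?H (E \<inter> C) + ?H (E - C) \<le> ?H E"
  proof (cases "?H E = top")
    case False
    define D where "D = (\<lambda>n. {x\<in>E. \<forall>y\<in>C. 1 / real (Suc n) \<le> dist x y})"
    define R where "R = (\<lambda>n. D (Suc n) - D n)"
    have D_mono: "D m \<subseteq> D n" if "m \<le> n" for m n
    proof -
      have "1 / real (Suc n) \<le> 1 / real (Suc m)"
        using that by (simp add: frac_le)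
      then show ?thesis
        unfolding D_def by fastforce
    qed
    have D_sub: "D n \<subseteq> E" "R n \<subseteq> E" for n
      by (auto simp: D_def R_def)
    have tail: "E - C \<subseteq> D n \<union> (\<Union>i. R (i + n))" for n
    proof
      fix x assume x: "x \<in> E - C"
      then obtain e where e: "e > 0" "\<And>y. dist y x < e \<Longrightarrow> y \<in> - C"
        using \<open>closed C\<close> unfolding closed_def open_dist by (metis ComplI DiffD2)
      obtain m where "1 / real (Suc m) < e"
        using nat_approx_posE[OF e(1)] by blast
      then have "x \<in> D m"
        using x e(2) unfolding D_def
        by (smt (verit, best) ComplD DiffD1 dist_commute mem_Collect_eq)
      then have xm: "x \<in> D (m + n)"
        using D_mono[of m "m + n"] by auto
      have "x \<in> D (j + n) \<Longrightarrow> x \<in> D n \<union> (\<Union>i. R (i + n))" for j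
        by (induction j) (auto simp: R_def)
      with xm show "x \<in> D n \<union> (\<Union>i. R (i + n))" by blast
    qed
    have sepC: "?H (E \<inter> C) + ?H (D n) \<le> ?H E" for n
    proof -
      have "?H (E \<inter> C) + ?H (D n) \<le> ?H (E \<inter> C \<union> D n)"
        by (rule hausdorff_outer_separated[where d = "1 / real (Suc n)"])
           (auto simp: D_def dist_commute)
      also have "\<dots> \<le> ?H E"
        using D_sub by (intro hausdorff_outer_mono) auto
      finally show ?thesis .
    qed
    have sepR: "?H (D j) + ?H (R (Suc j)) \<le> ?H (D j \<union> R (Suc j))" for j
    proof (rule hausdorff_outer_separated)
      show "0 < 1 / real (Suc j) - 1 / real (Suc (Suc j))"
        by (simp add: frac_less2)
      fix x z assume x: "x \<in> D j" and z: "z \<in> R (Suc j)"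
      then obtain y where y: "y \<in> C" "dist z y < 1 / real (Suc (Suc j))"
        by (force simp: R_def D_def)
      moreover have "1 / real (Suc j) \<le> dist x y"
        using x y by (auto simp: D_def)
      ultimately show "1 / real (Suc j) - 1 / real (Suc (Suc j)) \<le> dist x z"
        using dist_triangle[of x y z] by linarith
    qed
    have step: "(\<Sum>i<N. ?H (R (Suc (2 * i + p)))) \<le> ?H (D (2 * N + p))" for N p
    proof (induction N)
      case (Suc N)
      have "(\<Sum>i<Suc N. ?H (R (Suc (2 * i + p)))) \<le> ?H (D (2 * N + p)) + ?H (R (Suc (2 * N + p)))"
        using Suc by (auto intro: add_right_mono)
      also have "\<dots> \<le> ?H (D (2 * N + p) \<union> R (Suc (2 * N + p)))"
        by (rule sepR)
      also have "\<dots> \<le> ?H (D (2 * Suc N + p))"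
        using D_mono[of "2 * N + p" "2 * Suc N + p"]
        by (intro hausdorff_outer_mono) (auto simp: R_def)
      finally show ?case .
    qed simp
    define a where "a = (\<lambda>i. ?H (R (Suc i)))"
    have "(\<Sum>i<n. a i) \<le> ?H E + ?H E" for n
    proof -
      have "(\<Sum>i<n. a i) \<le> (\<Sum>i<2 * n. a i)"
        by (intro sum_mono2) auto
      also have "\<dots> = (\<Sum>i<n. a (2 * i)) + (\<Sum>i<n. a (Suc (2 * i)))"
        by (induction n) (auto simp: ac_simps)
      also have "\<dots> \<le> ?H E + ?H E"
        using order_trans[OF step[of 0 n] hausdorff_outer_mono[OF D_sub(1)]]
          order_trans[OF step[of 1 n] hausdorff_outer_mono[OF D_sub(1)]]
        by (intro add_mono) (auto simp: a_def)
      finally show ?thesis .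
    qed
    then have "suminf a \<le> ?H E + ?H E"
      by (intro suminf_le_const) auto
    then have fin: "suminf a \<noteq> top"
      using False by (metis ennreal_add_eq_top neq_top_trans)
    have le: "?H (E \<inter> C) + ?H (E - C) + (\<Sum>i<n. a i) \<le> ?H E + suminf a" for n
    proof -
      have "?H (E - C) \<le> ?H (D (Suc n) \<union> (\<Union>i. R (i + Suc n)))"
        by (intro hausdorff_outer_mono tail)
      also have "\<dots> \<le> ?H (D (Suc n)) + (\<Sum>i. a (i + n))"
        using hausdorff_outer_UN[of k "\<lambda>i. R (i + Suc n)"]
        by (intro order_trans[OF hausdorff_outer_Un] add_left_mono) (simp add: a_def)
      finally have "?H (E \<inter> C) + ?H (E - C) + (\<Sum>i<n. a i)
          \<le> (?H (E \<inter> C) + ?H (D (Suc n))) + ((\<Sum>i. a (i + n)) + (\<Sum>i<n. a i))"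
        by (simp add: add.assoc add_left_mono add_right_mono)
      also have "(\<Sum>i. a (i + n)) + (\<Sum>i<n. a i) = suminf a"
        by (simp add: suminf_offset[of a n])
      finally show ?thesis
        using sepC[of "Suc n"] by (meson add_right_mono order_trans)
    qed
    have "?H (E \<inter> C) + ?H (E - C) + suminf a \<le> ?H E + suminf a"
      unfolding suminf_eq_SUP[of a]
      by (subst ennreal_SUP_add_right) (use le in \<open>auto intro!: SUP_least simp: suminf_eq_SUP[of a]\<close>)
    then show ?thesis
      using fin by (simp add: ennreal_add_left_cancel_le add.commute[of _ "suminf a"])
  qed simp
qed

lemma emeasure_hausdorff_measure:
  fixes A :: "'a::metric_space set"
  assumes "A \<in> sets borel"
  shows "emeasure (hausdorff_measure k) A = hausdorff_outer k A"
proof -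
  interpret sigma_algebra UNIV "UNIV :: 'a set set"
    using sigma_algebra_Pow[of "UNIV :: 'a set"] by simp
  let ?L = "lambda_system UNIV UNIV (hausdorff_outer k :: 'a set \<Rightarrow> ennreal)"
  have L: "measure_space UNIV ?L (hausdorff_outer k)"
    by (rule caratheodory_lemma[OF outer_measure_space_hausdorff_outer])
  then interpret L: sigma_algebra UNIV ?L
    by (simp add: measure_space_def)
  have "{C :: 'a set. closed C} \<subseteq> ?L"
    by (auto simp: lambda_system_eq closed_in_lambda_system)
  then have "sets borel \<subseteq> ?L"
    unfolding borel_eq_closed by (simp add: L.sigma_sets_subset)
  then have "measure_space UNIV (sets borel) (hausdorff_outer k :: 'a set \<Rightarrow> ennreal)"
    using measure_down[OF L] sets.sigma_algebra_axioms[of borel] by auto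
  then show ?thesis
    using assms emeasure_measure_of[OF hausdorff_measure_def[of k], of A]
    by (auto simp: measure_space_def)
qed

section \<open>Finite sums of Borel measures\<close>

definition borel_measure_sum :: "('i \<Rightarrow> 'a::topological_space measure) \<Rightarrow> 'i set \<Rightarrow> 'a measure" where
  "borel_measure_sum M I = measure_of UNIV (sets borel) (\<lambda>A. \<Sum>i\<in>I. emeasure (M i) A)"

lemma sets_borel_measure_sum [simp, measurable_cong]: "sets (borel_measure_sum M I) = sets borel"
  unfolding borel_measure_sum_def
  by (metis sets.sigma_sets_eq sets_measure_of space_borel top_greatest Pow_UNIV)

lemma emeasure_borel_measure_sum:
  assumes "\<And>i. i \<in> I \<Longrightarrow> sets (M i) = sets borel" "A \<in> sets borel"
  shows "emeasure (borel_measure_sum M I) A = (\<Sum>i\<in>I. emeasure (M i) A)"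
proof (rule emeasure_measure_of[OF borel_measure_sum_def])
  show "countably_additive (sets (borel_measure_sum M I)) (\<lambda>A. \<Sum>i\<in>I. emeasure (M i) A)"
    using assms(1) by (auto simp: countably_additive_def suminf_sum suminf_emeasure)
qed (use assms in \<open>auto simp: positive_def\<close>)

section \<open>Fourier frames\<close>

definition square_integrable :: "'a measure \<Rightarrow> ('a \<Rightarrow> complex) \<Rightarrow> bool" where
  "square_integrable M f \<longleftrightarrow> f \<in> borel_measurable M \<and> integrable M (\<lambda>x. (cmod (f x))\<^sup>2)"

definition fourier_coefficient ::
    "'a::euclidean_space measure \<Rightarrow> ('a \<Rightarrow> complex) \<Rightarrow> 'a \<Rightarrow> complex" where
  "fourier_coefficient M f l = (\<integral>x. f x * cis (- (2 * pi * (l \<bullet> x))) \<partial>M)"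

text \<open>
  The notion concerns finite Borel measures only. On these a square integrable function is
  integrable, so the Bochner integrals defining the coefficients are meaningful. As \<^const>\<open>infsum\<close>
  returns 0 on divergent sums, convergence is stated separately.
\<close>

definition admits_fourier_frame :: "'a::euclidean_space measure \<Rightarrow> bool" where
  "admits_fourier_frame M \<longleftrightarrow>
     sets M = sets borel \<and> finite_measure M \<and>
     (\<exists>L A B. countable L \<and> 0 < A \<and> A \<le> B \<and>
       (\<forall>f. square_integrable M f \<longrightarrow>
          (\<lambda>l. (cmod (fourier_coefficient M f l))\<^sup>2) summable_on L \<and>
          A * (\<integral>x. (cmod (f x))\<^sup>2 \<partial>M) \<le> (\<Sum>\<^sub>\<infinity>l\<in>L. (cmod (fourier_coefficient M f l))\<^sup>2) \<and>
          (\<Sum>\<^sub>\<infinity>l\<in>L. (cmod (fourier_coefficient M f l))\<^sup>2) \<le> B * (\<integral>x. (cmod (f x))\<^sup>2 \<partial>M)))"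

end

theory Submission
  imports Defs
begin

text \<open>
  Group the planes \<open>V F\<close> by their direction \<open>W\<close>. On a single plane a rescaled integer lattice in \<open>W\<close>
  gives a frame, which needs no more of Hausdorff measure than translation invariance and local
  finiteness. Finitely many parallel planes are separated by finitely many shifts along a vector
  \<open>v\<close> orthogonal to \<open>W\<close>.

  To combine directions, use \<open>n\<close> copies of the frame frequencies of one direction, the copies and
  their elements shifted along \<open>v\<close> by rapidly varying amounts. For the measures on planes parallel to
  \<open>W\<close> such a shift is only a change of phase, so the lower frame bound is of order \<open>n\<close>. No other
  direction \<open>W'\<close> is contained in \<open>W\<close>, so \<open>v\<close> can be chosen with nonzero projection to every \<open>W'\<close>;
  then the shifts make the Gram matrix of the characters on the planes parallel to \<open>W'\<close> almost
  diagonal (Wiener's lemma), and their Bessel bound does not depend on \<open>n\<close>. For large \<open>n\<close> the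
  interaction between different directions is negligible.
\<close>

section \<open>Characters and Bessel bounds\<close>

text \<open>Frames of the summands do not simply add up: the coefficients of the sum measure mix all
  directions, and the cross terms may cancel the main ones. The remedy is an order of quantifiers,
  \<open>\<exists>C. \<forall>A'\<close> in \<open>oversampled_frame\<close>: the Bessel bound on
  the foreign directions is fixed before the lower bound on the own direction is requested, while
  the own upper bound may grow. This order is possible because the number \<open>R\<close> of shifts
  inside one copy depends on the parallel planes alone, and Gram entries between different copies
  can be made summable however many copies there are.

  The dimension hypothesis yields more than it says. If one direction is contained in another of no
  larger dimension, the two are equal; so any two distinct directions are incomparable, and every
  direction can be treated in the same way against all others.

  Sets in a common plane may overlap. Their measures are merged into one density with values in
  \<open>{0}\<close> or between 1 and the number of sets, which is comparable to an indicator
  function.\<close>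

definition character :: "'a::euclidean_space \<Rightarrow> 'a \<Rightarrow> complex" where
  "character l x = cis (2 * pi * (l \<bullet> x))"

abbreviation sqnorm :: "'a measure \<Rightarrow> ('a \<Rightarrow> complex) \<Rightarrow> real" where
  "sqnorm M f \<equiv> \<integral>x. (cmod (f x))\<^sup>2 \<partial>M"

abbreviation transform :: "'a::euclidean_space measure \<Rightarrow> 'a \<Rightarrow> complex" where
  "transform M \<equiv> fourier_coefficient M (\<lambda>_. 1)"

abbreviation coeff_sq :: "'a::euclidean_space measure \<Rightarrow> ('a \<Rightarrow> complex) \<Rightarrow> 'a \<Rightarrow> real" where
  "coeff_sq M f l \<equiv> (cmod (fourier_coefficient M f l))\<^sup>2"

lemma norm_character [simp]: "cmod (character l x) = 1"
  by (simp add: character_def)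

lemma character_0 [simp]: "character 0 x = 1"
  by (simp add: character_def)

lemma character_add: "character (l + m) x = character l x * character m x"
  by (simp add: character_def cis_mult inner_add_left distrib_left)

lemma character_add_right: "character l (x + y) = character l x * character l y"
  by (simp add: character_def cis_mult inner_add_right distrib_left)

lemma character_minus: "character (- l) x = cnj (character l x)"
  by (simp add: character_def cis_cnj)

lemma character_diff: "character (l - m) x = character l x * cnj (character m x)"
  using character_add[of l "- m" x] by (simp add: character_minus)

lemma character_mult_cnj [simp]: "character l x * cnj (character l x) = 1"
  using character_diff[of l l x] by simp

lemma character_measurable [measurable]: "character l \<in> borel_measurable borel"
  unfolding character_def[abs_def] cis_conv_exp by measurable

lemma cnj_character_measurable [measurable]: "(\<lambda>x. cnj (character l x)) \<in> borel_measurable borel"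
  using character_measurable[of "- l"] by (simp add: character_minus[abs_def])

lemma of_real_norm_square: "complex_of_real ((cmod z)\<^sup>2) = z * cnj z"
  by (metis complex_norm_square of_real_power)

lemma fourier_coefficient_character:
  "fourier_coefficient M f l = (\<integral>x. f x * cnj (character l x) \<partial>M)"
  by (simp add: fourier_coefficient_def character_def cis_cnj)

locale finite_euclidean_measure = finite_measure M
  for M :: "'a::euclidean_space measure" +
  assumes sets_eq_borel [simp, measurable_cong]: "sets M = sets borel"
begin

lemma borel_measurable_eq: "borel_measurable M = borel_measurable borel"
  by (rule measurable_cong_sets) auto

lemma integrable_bounded:
  fixes g :: "'a \<Rightarrow> complex"
  assumes "g \<in> borel_measurable borel" "\<And>x. cmod (g x) \<le> c"
  shows "integrable M g"
  by (rule integrable_const_bound[of _ c]) (use assms in \<open>auto simp: borel_measurable_eq\<close>)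

lemma square_integrable_integrable:
  assumes "square_integrable M f"
  shows "integrable M f"
proof (rule Bochner_Integration.integrable_bound)
  show "integrable M (\<lambda>x. 1 + (cmod (f x))\<^sup>2)" "f \<in> borel_measurable M"
    using assms by (auto simp: square_integrable_def)
  have "t \<le> 1 + t\<^sup>2" for t :: real
    using zero_le_power2[of "t - 1/2"] by (simp add: power2_diff power2_eq_square field_simps)
  then show "AE x in M. norm (f x) \<le> norm (1 + (cmod (f x))\<^sup>2)"
    by auto
qed

lemma integrable_mult_bounded:
  fixes f g :: "'a \<Rightarrow> complex"
  assumes "integrable M f" "g \<in> borel_measurable borel" "\<And>x. cmod (g x) \<le> 1"
  shows "integrable M (\<lambda>x. f x * g x)"
proof (rule Bochner_Integration.integrable_bound[OF assms(1)])
  show "(\<lambda>x. f x * g x) \<in> borel_measurable M"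
    using assms by (auto simp: borel_measurable_eq)
  show "AE x in M. norm (f x * g x) \<le> norm (f x)"
    using assms(3) by (auto simp: norm_mult mult_left_le)
qed

lemma square_integrable_bounded:
  assumes "g \<in> borel_measurable borel" "\<And>x. cmod (g x) \<le> c"
  shows "square_integrable M g"
proof -
  have "integrable M (\<lambda>x. (cmod (g x))\<^sup>2)"
    by (rule integrable_const_bound[of _ "c\<^sup>2"])
       (use assms in \<open>auto simp: borel_measurable_eq power_mono\<close>)
  then show ?thesis
    using assms by (simp add: square_integrable_def borel_measurable_eq)
qed

lemma fourier_coefficient_1: "transform M 0 = measure M (space M)"
  by (simp add: fourier_coefficient_character scaleR_conv_of_real)

lemma norm_fourier_coefficient_1: "cmod (transform M l) \<le> measure M (space M)"
proof -
  have "cmod (transform M l) \<le> (\<integral>x. cmod (1 * cnj (character l x)) \<partial>M)"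
    unfolding fourier_coefficient_character by (rule integral_norm_bound)
  then show ?thesis by simp
qed

lemma fourier_coefficient_1_minus:
  "transform M (- l) = cnj (transform M l)"
  by (simp add: fourier_coefficient_character character_minus flip: integral_cnj)

lemma norm_fourier_coefficient_1_commute:
  "cmod (transform M (l - m)) = cmod (transform M (m - l))"
  using fourier_coefficient_1_minus[of "m - l"] by (metis complex_mod_cnj minus_diff_eq)

text \<open>Used in two ways: nonnegativity of the left side gives the Bessel bound in
  \<open>bessel_gram\<close>, and smallness of the left side gives the lower bound in
  \<open>lower_bound\<close>. The equation is complex because the two linear sums are only jointly
  real.\<close>

lemma integral_norm_diff_trig:
  fixes a :: "'i \<Rightarrow> complex" and l :: "'i \<Rightarrow> 'a"
  assumes f: "square_integrable M f" and "finite T"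
  defines "g \<equiv> \<lambda>x. \<Sum>i\<in>T. a i * character (l i) x"
  shows "complex_of_real (\<integral>x. (cmod (f x - g x))\<^sup>2 \<partial>M) =
      sqnorm M f
      - (\<Sum>i\<in>T. cnj (a i) * fourier_coefficient M f (l i))
      - (\<Sum>i\<in>T. a i * cnj (fourier_coefficient M f (l i)))
      + (\<Sum>i\<in>T. \<Sum>j\<in>T. a i * cnj (a j) * transform M (l j - l i))"
proof -
  have intf: "integrable M f"
    by (rule square_integrable_integrable[OF f])
  have f2: "integrable M (\<lambda>x. complex_of_real ((cmod (f x))\<^sup>2))"
    using f unfolding square_integrable_def by (simp del: of_real_power)
  have i1: "integrable M (\<lambda>x. cnj (a i) * (f x * cnj (character (l i) x)))" for i
    by (intro integrable_mult_right integrable_mult_bounded intf) auto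
  have i2: "integrable M (\<lambda>x. a i * cnj (f x * cnj (character (l i) x)))" for i
    by (intro integrable_mult_right integrable_cnj integrable_mult_bounded intf) auto
  have i3: "integrable M (\<lambda>x. (a i * cnj (a j)) * (1 * cnj (character (l j - l i) x)))" for i j
    by (intro integrable_mult_right integrable_bounded[where c = 1]) auto
  have pt: "complex_of_real ((cmod (f x - g x))\<^sup>2) = complex_of_real ((cmod (f x))\<^sup>2)
      - (\<Sum>i\<in>T. cnj (a i) * (f x * cnj (character (l i) x)))
      - (\<Sum>i\<in>T. a i * cnj (f x * cnj (character (l i) x)))
      + (\<Sum>i\<in>T. \<Sum>j\<in>T. (a i * cnj (a j)) * (1 * cnj (character (l j - l i) x)))" for x
  proof -
    have "complex_of_real ((cmod (f x - g x))\<^sup>2) = f x * cnj (f x) - f x * cnj (g x) - g x * cnj (f x) + g x * cnj (g x)"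
      unfolding of_real_norm_square by (simp add: algebra_simps)
    moreover have "f x * cnj (g x) = (\<Sum>i\<in>T. cnj (a i) * (f x * cnj (character (l i) x)))"
      by (simp add: g_def sum_distrib_left ac_simps)
    moreover have "g x * cnj (f x) = (\<Sum>i\<in>T. a i * cnj (f x * cnj (character (l i) x)))"
      by (simp add: g_def sum_distrib_left ac_simps)
    moreover have "g x * cnj (g x) = (\<Sum>i\<in>T. \<Sum>j\<in>T. (a i * cnj (a j)) * (1 * cnj (character (l j - l i) x)))"
      by (simp add: g_def sum_product character_diff ac_simps)
    ultimately show ?thesis
      unfolding of_real_norm_square by simp
  qed
  define F0 where "F0 = (\<lambda>x. complex_of_real ((cmod (f x))\<^sup>2))"
  define F1 where "F1 = (\<lambda>i x. cnj (a i) * (f x * cnj (character (l i) x)))"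
  define F2 where "F2 = (\<lambda>i x. a i * cnj (f x * cnj (character (l i) x)))"
  define F3 where "F3 = (\<lambda>i j x. (a i * cnj (a j)) * (1 * cnj (character (l j - l i) x)))"
  have F: "integrable M F0" "integrable M (F1 i)" "integrable M (F2 i)" "integrable M (F3 i j)" for i j
    using f2 i1 i2 i3 unfolding F0_def F1_def F2_def F3_def by blast+
  have "complex_of_real (\<integral>x. (cmod (f x - g x))\<^sup>2 \<partial>M) = (\<integral>x. complex_of_real ((cmod (f x - g x))\<^sup>2) \<partial>M)"
    by (rule integral_complex_of_real[symmetric])
  also have "\<dots> = (\<integral>x. F0 x - (\<Sum>i\<in>T. F1 i x) - (\<Sum>i\<in>T. F2 i x) + (\<Sum>i\<in>T. \<Sum>j\<in>T. F3 i j x) \<partial>M)"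
    unfolding pt F0_def F1_def F2_def F3_def ..
  also have "\<dots> = integral\<^sup>L M F0 - (\<Sum>i\<in>T. integral\<^sup>L M (F1 i)) - (\<Sum>i\<in>T. integral\<^sup>L M (F2 i))
      + (\<Sum>i\<in>T. \<Sum>j\<in>T. integral\<^sup>L M (F3 i j))"
    using F by simp
  also have "integral\<^sup>L M F0 = complex_of_real (sqnorm M f)"
    unfolding F0_def by (rule integral_complex_of_real)
  also have "(\<lambda>i. integral\<^sup>L M (F1 i)) = (\<lambda>i. cnj (a i) * fourier_coefficient M f (l i))"
    unfolding F1_def fourier_coefficient_character by (rule ext, rule integral_mult_right_zero)
  also have "(\<lambda>i. integral\<^sup>L M (F2 i)) = (\<lambda>i. a i * cnj (fourier_coefficient M f (l i)))"
    unfolding F2_def fourier_coefficient_character by (rule ext) (simp only: integral_mult_right_zero Bochner_Integration.integral_cnj)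
  also have "(\<lambda>i j. integral\<^sup>L M (F3 i j)) = (\<lambda>i j. a i * cnj (a j) * transform M (l j - l i))"
    unfolding F3_def fourier_coefficient_character by (intro ext, rule integral_mult_right_zero)
  finally show ?thesis .
qed

end

text \<open>
  Frame bounds are stated through finite partial sums. A finite sum in the lower bound is no
  restriction, since the constant may be decreased slightly.
\<close>

definition bessel ::
    "'a::euclidean_space measure \<Rightarrow> 'i set \<Rightarrow> ('i \<Rightarrow> 'a) \<Rightarrow> real \<Rightarrow> bool" where
  "bessel M X l C \<longleftrightarrow> (\<forall>f T. square_integrable M f \<longrightarrow> finite T \<longrightarrow> T \<subseteq> X \<longrightarrow>
     (\<Sum>i\<in>T. coeff_sq M f (l i)) \<le> C * sqnorm M f)"

definition lower_frame ::
    "'a::euclidean_space measure \<Rightarrow> 'i set \<Rightarrow> ('i \<Rightarrow> 'a) \<Rightarrow> real \<Rightarrow> bool" where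
  "lower_frame M X l A \<longleftrightarrow> (\<forall>f. square_integrable M f \<longrightarrow> (\<exists>T. finite T \<and> T \<subseteq> X \<and>
     A * sqnorm M f \<le> (\<Sum>i\<in>T. coeff_sq M f (l i))))"

lemma besselD:
  assumes "bessel M X l C" "square_integrable M f" "finite T" "T \<subseteq> X"
  shows "(\<Sum>i\<in>T. coeff_sq M f (l i)) \<le> C * sqnorm M f"
  using assms unfolding bessel_def by blast

lemma lower_frameE:
  assumes "lower_frame M X l A" "square_integrable M f"
  obtains T where "finite T" "T \<subseteq> X"
    "A * sqnorm M f \<le> (\<Sum>i\<in>T. coeff_sq M f (l i))"
  using assms unfolding lower_frame_def by blast

lemma bessel_mono:
  assumes "bessel M X l C" "C \<le> D"
  shows "bessel M X l D"
  unfolding bessel_def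
proof (intro allI impI)
  fix f T assume *: "square_integrable M f" "finite T" "T \<subseteq> X"
  have "(\<Sum>i\<in>T. coeff_sq M f (l i)) \<le> C * sqnorm M f"
    by (rule besselD[OF assms(1) *])
  also have "\<dots> \<le> D * sqnorm M f"
    by (intro mult_right_mono assms) auto
  finally show "(\<Sum>i\<in>T. coeff_sq M f (l i)) \<le> D * sqnorm M f" .
qed

lemma bessel_subset: "bessel M X l C \<Longrightarrow> Y \<subseteq> X \<Longrightarrow> bessel M Y l C"
  unfolding bessel_def by (meson order_trans)

lemma bessel_reindex:
  assumes "bessel M X l C" "inj_on h Y" "h ` Y \<subseteq> X"
  shows "bessel M Y (\<lambda>i. l (h i)) C"
  unfolding bessel_def
proof (intro allI impI)
  fix f T assume *: "square_integrable M f" "finite T" "T \<subseteq> Y"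
  have "inj_on h T" using assms(2) *(3) inj_on_subset by blast
  then have "(\<Sum>i\<in>T. coeff_sq M f (l (h i)))
      = (\<Sum>i\<in>h ` T. coeff_sq M f (l i))"
    by (simp add: sum.reindex)
  also have "\<dots> \<le> C * sqnorm M f"
    using * assms(3) by (intro besselD[OF assms(1)]) auto
  finally show "(\<Sum>i\<in>T. coeff_sq M f (l (h i))) \<le> C * sqnorm M f" .
qed

lemma lower_frame_mono:
  assumes "lower_frame M X l A" "A' \<le> A"
  shows "lower_frame M X l A'"
  unfolding lower_frame_def
proof (intro allI impI)
  fix f assume f: "square_integrable M f"
  obtain T where "finite T" "T \<subseteq> X"
    "A * sqnorm M f \<le> (\<Sum>i\<in>T. coeff_sq M f (l i))"
    by (rule lower_frameE[OF assms(1) f])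
  moreover have "A' * sqnorm M f \<le> A * sqnorm M f"
    by (intro mult_right_mono assms) auto
  ultimately show "\<exists>T. finite T \<and> T \<subseteq> X \<and>
     A' * sqnorm M f \<le> (\<Sum>i\<in>T. coeff_sq M f (l i))"
    by (meson order_trans)
qed

text \<open>Schur's test for the Gram matrix of the family of characters.\<close>

lemma (in finite_euclidean_measure) bessel_gram:
  assumes C: "0 < C"
    and row: "\<And>i T. i \<in> X \<Longrightarrow> finite T \<Longrightarrow> T \<subseteq> X \<Longrightarrow>
      (\<Sum>j\<in>T. cmod (transform M (l i - l j))) \<le> C"
  shows "bessel M X l C"
  unfolding bessel_def
proof (intro allI impI)
  fix f T assume f: "square_integrable M f" and T: "finite T" "T \<subseteq> X"
  define c where "c = (\<lambda>i. fourier_coefficient M f (l i))"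
  define G where "G = (\<lambda>i j. transform M (l j - l i))"
  define S where "S = (\<Sum>i\<in>T. (cmod (c i))\<^sup>2)"
  define n where "n = sqnorm M f"
  \<comment> \<open>With the coefficients \<open>t * c i\<close> the squared distance is at most
    \<open>n - 2 * t * S + t * t * C * S\<close>. The value \<open>t = 1 / C\<close> minimises this
    and leaves \<open>n - S / C\<close>.\<close>
  define b where "b = (\<lambda>i. c i / C)"
  have cc: "c i * cnj (c i) = (cmod (c i))\<^sup>2" for i
    by (metis complex_norm_square)
  have eq: "complex_of_real (\<integral>x. (cmod (f x - (\<Sum>i\<in>T. b i * character (l i) x)))\<^sup>2 \<partial>M) =
      n - (\<Sum>i\<in>T. cnj (b i) * c i) - (\<Sum>i\<in>T. b i * cnj (c i)) + (\<Sum>i\<in>T. \<Sum>j\<in>T. b i * cnj (b j) * G i j)"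
    using integral_norm_diff_trig[OF f T(1), of b l] by (simp add: c_def G_def n_def)
  have s1: "(\<Sum>i\<in>T. cnj (b i) * c i) = complex_of_real (S / C)"
    using cc by (simp add: b_def S_def sum_divide_distrib mult.commute)
  have s2: "(\<Sum>i\<in>T. b i * cnj (c i)) = complex_of_real (S / C)"
    using cc by (simp add: b_def S_def sum_divide_distrib)
  have s3: "cmod (\<Sum>i\<in>T. \<Sum>j\<in>T. b i * cnj (b j) * G i j) \<le> S / C"
  proof -
    have sym: "cmod (G i j) = cmod (G j i)" for i j
      by (simp add: G_def norm_fourier_coefficient_1_commute)
    have row': "(\<Sum>j\<in>T. cmod (G j i)) \<le> C" if "i \<in> T" for i
      using row[of i T] T that by (auto simp: G_def)
    have "cmod (\<Sum>i\<in>T. \<Sum>j\<in>T. b i * cnj (b j) * G i j) \<le> (\<Sum>i\<in>T. \<Sum>j\<in>T. cmod (b i) * cmod (b j) * cmod (G i j))"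
      by (intro sum_norm_le) (simp add: norm_mult)
    \<comment> \<open>The arithmetic-geometric inequality separates the two indices. By the symmetry
      of \<open>cmod (G i j)\<close> both halves are then row sums of the Gram matrix.\<close>
    also have "\<dots> \<le> (\<Sum>i\<in>T. \<Sum>j\<in>T. ((cmod (b i))\<^sup>2 + (cmod (b j))\<^sup>2) / 2 * cmod (G i j))"
    proof (intro sum_mono mult_right_mono)
      fix i j show "cmod (b i) * cmod (b j) \<le> ((cmod (b i))\<^sup>2 + (cmod (b j))\<^sup>2) / 2"
        using sum_squares_bound[of "cmod (b i)" "cmod (b j)"] by simp
    qed auto
    also have "\<dots> = (\<Sum>i\<in>T. \<Sum>j\<in>T. (cmod (b i))\<^sup>2 / 2 * cmod (G j i) + (cmod (b j))\<^sup>2 / 2 * cmod (G i j))"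
      by (intro sum.cong refl, subst (2) sym) (simp only: add_divide_distrib distrib_right)
    also have "\<dots> = (\<Sum>i\<in>T. \<Sum>j\<in>T. (cmod (b i))\<^sup>2 / 2 * cmod (G j i)) + (\<Sum>i\<in>T. \<Sum>j\<in>T. (cmod (b j))\<^sup>2 / 2 * cmod (G i j))"
      by (simp only: sum.distrib)
    also have "(\<Sum>i\<in>T. \<Sum>j\<in>T. (cmod (b j))\<^sup>2 / 2 * cmod (G i j)) = (\<Sum>i\<in>T. \<Sum>j\<in>T. (cmod (b i))\<^sup>2 / 2 * cmod (G j i))"
      by (rule sum.swap)
    also have "(\<Sum>i\<in>T. \<Sum>j\<in>T. (cmod (b i))\<^sup>2 / 2 * cmod (G j i)) + (\<Sum>i\<in>T. \<Sum>j\<in>T. (cmod (b i))\<^sup>2 / 2 * cmod (G j i))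
        = (\<Sum>i\<in>T. (cmod (b i))\<^sup>2 * (\<Sum>j\<in>T. cmod (G j i)))"
      by (simp add: sum_distrib_right mult.commute flip: sum.distrib)
    also have "\<dots> \<le> (\<Sum>i\<in>T. (cmod (b i))\<^sup>2 * C)"
      by (intro sum_mono mult_left_mono row') auto
    also have "\<dots> = S / C"
      using C by (simp add: b_def S_def norm_divide power_divide power2_eq_square sum_divide_distrib field_simps)
    finally show ?thesis .
  qed
  have "0 \<le> (\<integral>x. (cmod (f x - (\<Sum>i\<in>T. b i * character (l i) x)))\<^sup>2 \<partial>M)"
    by simp
  also have "\<dots> = Re (complex_of_real (\<integral>x. (cmod (f x - (\<Sum>i\<in>T. b i * character (l i) x)))\<^sup>2 \<partial>M))"
    by simp
  also have "\<dots> = n - S / C - S / C + Re (\<Sum>i\<in>T. \<Sum>j\<in>T. b i * cnj (b j) * G i j)"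
    unfolding eq s1 s2 by (simp del: Re_sum)
  also have "\<dots> \<le> n - S / C"
    using s3 abs_Re_le_cmod[of "\<Sum>i\<in>T. \<Sum>j\<in>T. b i * cnj (b j) * G i j"] by linarith
  finally show "(\<Sum>i\<in>T. coeff_sq M f (l i)) \<le> C * sqnorm M f"
    using C by (simp add: S_def n_def c_def field_simps)
qed

section \<open>Wiener's lemma and almost orthogonal shifts\<close>

text \<open>The partial sums of a geometric series with ratio on the unit circle and different from
  1 stay bounded, so dividing by \<open>N\<close> sends them to 0. The ratio is 1 exactly when
  \<open>s\<close> is an integer.\<close>

lemma cis_cesaro:
  assumes "s \<notin> \<int>"
  shows "(\<lambda>N. (\<Sum>n<N. cis (2 * pi * (real n * s))) / of_nat N) \<longlonglongrightarrow> 0"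
proof (rule Lim_null_comparison)
  define w where "w = cis (2 * pi * s)"
  have w: "w \<noteq> 1"
  proof
    assume "w = 1"
    then have "cos (2 * pi * s) = 1"
      by (auto simp: w_def complex_eq_iff)
    then obtain k :: int where "2 * pi * s = real_of_int k * 2 * pi"
      using cos_one_2pi_int by auto
    then have "s = of_int k" by simp
    with assms show False by simp
  qed
  have p: "cis (2 * pi * (real n * s)) = w ^ n" for n
    by (simp add: w_def Complex.DeMoivre ac_simps)
  have "cmod (\<Sum>n<N. w ^ n) \<le> 2 / cmod (1 - w)" for N
  proof -
    have "(\<Sum>n<N. w ^ n) = (1 - w ^ N) / (1 - w)"
      using w sum_gp_strict[of w N] by simp
    moreover have "cmod (1 - w ^ N) \<le> 2"
      using norm_triangle_ineq4[of 1 "w ^ N"] by (simp add: w_def norm_power)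
    ultimately show ?thesis
      using w by (simp add: norm_divide divide_right_mono)
  qed
  then have "cmod ((\<Sum>n<N. w ^ n) / of_nat N) \<le> 2 / cmod (1 - w) / real N" for N
    unfolding norm_divide norm_of_nat by (intro divide_right_mono) auto
  then show "\<forall>\<^sub>F N in sequentially. norm ((\<Sum>n<N. cis (2 * pi * (real n * s))) / of_nat N)
      \<le> 2 / cmod (1 - w) / real N"
    unfolding p by simp
  show "(\<lambda>N. 2 / cmod (1 - w) / real N) \<longlonglongrightarrow> 0"
    by (rule lim_const_over_n)
qed

text \<open>The average is the double integral of the kernel \<open>D N x y\<close>, which tends to
  0 unless \<open>v \<bullet> (x - y)\<close> is an integer. For each \<open>x\<close> this
  exceptional set of \<open>y\<close> is a countable union of null hyperplanes. Dominated
  convergence is applied first in \<open>y\<close>, then in \<open>x\<close>; the sums are finite,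
  so linearity replaces Fubini.\<close>

lemma (in finite_euclidean_measure) wiener:
  assumes null: "\<And>c. emeasure M {x. v \<bullet> x = c} = 0"
  shows "(\<lambda>N. (\<Sum>n<N. coeff_sq M (\<lambda>_. 1) (a + real n *\<^sub>R v)) / real N) \<longlonglongrightarrow> 0"
proof -
  define l where "l = (\<lambda>n. a + real n *\<^sub>R v)"
  define c where "c = (\<lambda>n. transform M (l n))"
  define D where "D = (\<lambda>N x y. (\<Sum>n<N. cnj (character (l n) y) * character (l n) x) / of_nat N)"
  define h where "h = (\<lambda>N x. (\<Sum>n<N. c n * character (l n) x) / of_nat N)"
  have int_char: "integrable M (character m)" "integrable M (\<lambda>y. cnj (character m y))" for m
    by (rule integrable_bounded[where c = 1]; simp)+
  have hD: "h N x = (\<integral>y. D N x y \<partial>M)" for N x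
    unfolding h_def D_def c_def fourier_coefficient_character
    by (simp add: int_char)
  have D_le: "cmod (D N x y) \<le> 1" for N x y
  proof -
    have "cmod (\<Sum>n<N. cnj (character (l n) y) * character (l n) x) \<le> (\<Sum>n<N. 1)"
      by (rule sum_norm_le) (simp add: norm_mult)
    then show ?thesis
      by (cases "N = 0") (auto simp: D_def norm_divide)
  qed
  have D_meas: "D N x \<in> borel_measurable M" for N x
    unfolding D_def by (simp add: borel_measurable_eq)
  have null_Z: "AE y in M. v \<bullet> (x - y) \<notin> \<int>" for x
  proof -
    have "AE y in M. \<forall>k::int. v \<bullet> y \<noteq> v \<bullet> x - of_int k"
      unfolding AE_all_countable
    proof
      fix k :: int
      have "{y \<in> space M. \<not> v \<bullet> y \<noteq> v \<bullet> x - of_int k} \<subseteq> {y. v \<bullet> y = v \<bullet> x - of_int k}" by auto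
      moreover have "{y. v \<bullet> y = v \<bullet> x - of_int k} \<in> null_sets M"
        using null by (auto simp: null_sets_def intro!: borel_closed closed_hyperplane)
      ultimately show "AE y in M. v \<bullet> y \<noteq> v \<bullet> x - of_int k"
        by (rule AE_I'[rotated])
    qed
    then show ?thesis
      by eventually_elim (auto simp: Ints_def inner_diff_right algebra_simps)
  qed
  have D_lim: "AE y in M. (\<lambda>N. D N x y) \<longlonglongrightarrow> 0" for x
    using null_Z[of x]
  proof eventually_elim
    case (elim y)
    have "D N x y = character a (x - y) * ((\<Sum>n<N. cis (2 * pi * (real n * (v \<bullet> (x - y))))) / of_nat N)" for N
    proof -
      have "cnj (character (l n) y) * character (l n) x
          = character a (x - y) * cis (2 * pi * (real n * (v \<bullet> (x - y))))" for n
        by (simp add: l_def character_def cis_cnj cis_mult inner_simps algebra_simps)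
      then show ?thesis
        by (simp add: D_def sum_distrib_left)
    qed
    then show ?case
      using tendsto_mult_right_zero[OF cis_cesaro[OF elim]] by simp
  qed
  have h_lim: "(\<lambda>N. h N x) \<longlonglongrightarrow> 0" for x
  proof -
    have "(\<lambda>N. \<integral>y. D N x y \<partial>M) \<longlonglongrightarrow> (\<integral>y. 0 \<partial>M)"
      by (rule integral_dominated_convergence[where w = "\<lambda>_. 1"]) (use D_lim D_meas D_le in auto)
    then show ?thesis by (simp add: hD)
  qed
  have h_le: "cmod (h N x) \<le> measure M (space M)" for N x
  proof -
    have "cmod (h N x) \<le> (\<integral>y. cmod (D N x y) \<partial>M)"
      unfolding hD by (rule integral_norm_bound)
    also have "\<dots> \<le> (\<integral>y. 1 \<partial>M)"
      by (rule integral_mono_AE') (use D_le in auto)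
    finally show ?thesis by simp
  qed
  \<comment> \<open>The conjugate is taken because \<open>transform\<close> integrates conjugated
    characters: integrating \<open>cnj (h N x)\<close> produces
    \<open>cnj (c n) * c n\<close>.\<close>
  have h_meas: "(\<lambda>x. cnj (h N x)) \<in> borel_measurable M" for N
    unfolding h_def complex_cnj_divide cnj_sum complex_cnj_mult by (simp add: borel_measurable_eq)
  have "(\<lambda>N. \<integral>x. cnj (h N x) \<partial>M) \<longlonglongrightarrow> (\<integral>x. 0 \<partial>M)"
  proof (rule integral_dominated_convergence[where w = "\<lambda>_. measure M (space M)"])
    show "AE x in M. (\<lambda>N. cnj (h N x)) \<longlonglongrightarrow> 0"
      using tendsto_cnj[OF h_lim] by simp
  qed (use h_meas h_le in auto)
  moreover have "(\<integral>x. cnj (h N x) \<partial>M) = complex_of_real ((\<Sum>n<N. (cmod (c n))\<^sup>2) / real N)" for N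
  proof -
    have "(\<integral>x. cnj (h N x) \<partial>M) = (\<Sum>n<N. cnj (c n) * (\<integral>x. cnj (character (l n) x) \<partial>M)) / of_nat N"
      unfolding h_def by (simp add: int_char)
    also have "\<dots> = (\<Sum>n<N. cnj (c n) * c n) / of_nat N"
      by (simp add: c_def fourier_coefficient_character)
    also have "\<dots> = (\<Sum>n<N. complex_of_real ((cmod (c n))\<^sup>2)) / of_nat N"
      by (simp only: complex_norm_square mult.commute)
    finally show ?thesis by simp
  qed
  ultimately have "(\<lambda>N. complex_of_real ((\<Sum>n<N. (cmod (c n))\<^sup>2) / real N)) \<longlonglongrightarrow> complex_of_real 0"
    by simp
  then show ?thesis
    unfolding tendsto_of_real_iff by (simp add: c_def l_def)
qed

text \<open>One \<open>n\<close> has to serve all \<open>k\<close> at once. The averages from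
  Wiener's lemma are summed over \<open>K\<close>; if every \<open>n\<close> failed for some
  \<open>k\<close>, the sum would be at least \<open>\<epsilon>\<^sup>2\<close> for every
  \<open>N\<close>.\<close>

lemma exists_decaying_shift:
  assumes "finite K"
    and "\<And>k. k \<in> K \<Longrightarrow> finite_euclidean_measure (\<mu> k)"
    and "\<And>k c. k \<in> K \<Longrightarrow> emeasure (\<mu> k) {x. v \<bullet> x = c} = 0"
    and "0 < \<epsilon>"
  shows "\<exists>n::nat. \<forall>k\<in>K. cmod (transform (\<mu> k) (a k + real n *\<^sub>R v)) \<le> \<epsilon>"
proof (rule ccontr)
  define c where "c = (\<lambda>k n. coeff_sq (\<mu> k) (\<lambda>_. 1) (a k + real n *\<^sub>R v))"
  assume "\<not> ?thesis"
  then have big: "\<exists>k\<in>K. \<epsilon>\<^sup>2 \<le> c k n" for n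
    unfolding c_def using \<open>0 < \<epsilon>\<close> by (metis less_imp_le linorder_not_le power_mono)
  have "(\<lambda>N. \<Sum>k\<in>K. (\<Sum>n<N. c k n) / real N) \<longlonglongrightarrow> (\<Sum>k\<in>K. 0)"
    unfolding c_def
    by (intro tendsto_sum finite_euclidean_measure.wiener assms)
  then have "\<forall>\<^sub>F N in sequentially. (\<Sum>k\<in>K. (\<Sum>n<N. c k n) / real N) < \<epsilon>\<^sup>2"
    using \<open>0 < \<epsilon>\<close> by (intro order_tendstoD) auto
  then obtain N where N: "N > 0" "(\<Sum>k\<in>K. (\<Sum>n<N. c k n) / real N) < \<epsilon>\<^sup>2"
    using eventually_conj[OF eventually_gt_at_top[of 0]] eventually_happens'[OF sequentially_bot] by blast
  have "\<epsilon>\<^sup>2 \<le> (\<Sum>k\<in>K. c k n)" for n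
  proof -
    obtain k where "k \<in> K" "\<epsilon>\<^sup>2 \<le> c k n" using big by blast
    moreover have "c k n \<le> (\<Sum>k\<in>K. c k n)"
      by (rule member_le_sum) (use \<open>k \<in> K\<close> \<open>finite K\<close> in \<open>auto simp: c_def\<close>)
    ultimately show ?thesis by linarith
  qed
  then have "(\<Sum>n<N. \<epsilon>\<^sup>2) \<le> (\<Sum>n<N. \<Sum>k\<in>K. c k n)"
    by (rule sum_mono)
  also have "\<dots> = (\<Sum>k\<in>K. \<Sum>n<N. c k n)"
    by (rule sum.swap)
  finally show False
    using N by (simp add: field_simps flip: sum_divide_distrib)
qed

text \<open>The shifts \<open>t m\<close> are chosen recursively so that every Gram entry between
  block \<open>m\<close> and an earlier block \<open>n\<close> is at most
  \<open>(1/2) ^ (m + n)\<close>. A row then has \<open>R\<close> entries in its own block, each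
  bounded by the total mass, and the entries of the other blocks add up to at most
  \<open>2 * R\<close>. Nothing depends on the frequencies \<open>b\<close>, so repetitions among
  them are allowed.\<close>

lemma exists_bessel_shifts:
  fixes b :: "nat \<Rightarrow> 'a::euclidean_space"
  assumes "finite K" "0 < R"
    and \<mu>: "\<And>k. k \<in> K \<Longrightarrow> finite_euclidean_measure (\<mu> k)"
    and null: "\<And>k c. k \<in> K \<Longrightarrow> emeasure (\<mu> k) {x. v \<bullet> x = c} = 0"
  shows "\<exists>t. \<forall>k\<in>K. bessel (\<mu> k) (UNIV \<times> {..<R}) (\<lambda>(m, r). b m + (t m + real r) *\<^sub>R v)
      (real R * (measure (\<mu> k) (space (\<mu> k)) + 2))"
proof -
  let ?F = "\<lambda>k. transform (\<mu> k)"
  define P where "P = (\<lambda>t m (u::real). \<forall>k\<in>K. \<forall>n<m. \<forall>r<R. \<forall>q<R.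
      cmod (?F k ((b m + (u + real r) *\<^sub>R v) - (b n + (t n + real q) *\<^sub>R v))) \<le> (1/2) ^ (m + n))"
  have "\<exists>t. \<forall>m. P t m (t m)"
  proof (rule dependent_wellorder_choice)
    fix r :: real and f g :: "nat \<Rightarrow> real" and x :: nat
    assume "\<And>y. y < x \<Longrightarrow> f y = g y"
    then show "P f x r = P g x r"
      unfolding P_def by auto
  next
    fix m :: nat and t :: "nat \<Rightarrow> real"
    \<comment> \<open>A single shift must handle every measure, every earlier block and every pair
      of positions inside the two blocks. Demanding the error \<open>(1/2) ^ (m + m)\<close> covers
      all \<open>n < m\<close> uniformly.\<close>
    define K' where "K' = K \<times> {..<m} \<times> {..<R} \<times> {..<R}"
    have "\<exists>j::nat. \<forall>z\<in>K'. cmod (?F (fst z)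
        ((\<lambda>(k, n, r, q). b m - b n + (real r - real q - t n) *\<^sub>R v) z + real j *\<^sub>R v)) \<le> (1/2) ^ (m + m)"
      by (rule exists_decaying_shift) (use assms in \<open>auto simp: K'_def\<close>)
    then obtain j :: nat where j: "\<And>k n r q. k \<in> K \<Longrightarrow> n < m \<Longrightarrow> r < R \<Longrightarrow> q < R \<Longrightarrow>
        cmod (?F k (b m - b n + (real r - real q - t n) *\<^sub>R v + real j *\<^sub>R v)) \<le> (1/2) ^ (m + m)"
      by (force simp: K'_def)
    have "P t m (real j)"
      unfolding P_def
    proof (intro ballI allI impI)
      fix k n r q assume *: "k \<in> K" "n < m" "r < R" "q < R"
      have "(b m + (real j + real r) *\<^sub>R v) - (b n + (t n + real q) *\<^sub>R v)
          = b m - b n + (real r - real q - t n) *\<^sub>R v + real j *\<^sub>R v"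
        by (simp add: algebra_simps)
      then have "cmod (?F k ((b m + (real j + real r) *\<^sub>R v) - (b n + (t n + real q) *\<^sub>R v))) \<le> (1/2) ^ (m + m)"
        using j[OF *] by (simp only:)
      also have "(1/2::real) ^ (m + m) \<le> (1/2) ^ (m + n)"
        using *(2) by (intro power_decreasing) auto
      finally show "cmod (?F k ((b m + (real j + real r) *\<^sub>R v) - (b n + (t n + real q) *\<^sub>R v))) \<le> (1/2) ^ (m + n)" .
    qed
    then show "\<exists>u. P t m u" ..
  qed
  then obtain t where t: "\<And>m. P t m (t m)" by blast
  define l where "l = (\<lambda>(m, r). b m + (t m + real r) *\<^sub>R v)"
  have "bessel (\<mu> k) (UNIV \<times> {..<R}) l (real R * (measure (\<mu> k) (space (\<mu> k)) + 2))" if k: "k \<in> K" for k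
  proof -
    interpret finite_euclidean_measure "\<mu> k" by (rule \<mu>[OF k])
    let ?m = "measure (\<mu> k) (space (\<mu> k))"
    have off: "cmod (?F k (l (m, r) - l (n, q))) \<le> (1/2) ^ (m + n)" if "n \<noteq> m" "r < R" "q < R" for m n r q
    proof (cases "n < m")
      case True
      then show ?thesis using t[of m] that k by (auto simp: P_def l_def)
    next
      case False
      then have "cmod (?F k (l (n, q) - l (m, r))) \<le> (1/2) ^ (n + m)"
        using t[of n] that k by (auto simp: P_def l_def)
      then show ?thesis
        by (simp add: norm_fourier_coefficient_1_commute[of "l (n, q)"] add.commute)
    qed
    show ?thesis
    proof (rule bessel_gram)
      show "0 < real R * (?m + 2)"
        using \<open>0 < R\<close> by (simp add: add_nonneg_pos)
      fix i :: "nat \<times> nat" and T :: "(nat \<times> nat) set" assume i: "i \<in> UNIV \<times> {..<R}" and T: "finite T" "T \<subseteq> UNIV \<times> {..<R}"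
      obtain m r where mr: "i = (m, r)" "r < R" using i by auto
      \<comment> \<open>The row index \<open>m\<close> is included so that the diagonal block lies
        in the rectangle containing \<open>T\<close> and is counted exactly once.\<close>
      define N where "N = Suc (Max (insert m (fst ` T)))"
      have N: "T \<subseteq> {..<N} \<times> {..<R}" "m < N"
      proof -
        have less: "n < N" if "n \<in> insert m (fst ` T)" for n
          using T that by (simp add: N_def less_Suc_eq_le Max_ge del: Max_insert)
        from less[of m] show "m < N" by simp
        show "T \<subseteq> {..<N} \<times> {..<R}"
        proof
          fix z assume z: "z \<in> T"
          then have "fst z \<in> insert m (fst ` T)" by blast
          then have "fst z < N" by (rule less)
          with z T(2) show "z \<in> {..<N} \<times> {..<R}" by (auto simp: mem_Times_iff)
        qed
      qed
      have bd: "cmod (?F k (l i - l (n, q))) \<le> (if n = m then ?m else 0) + (1/2) ^ n" if "q < R" for n q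
      proof (cases "n = m")
        case True
        then show ?thesis using norm_fourier_coefficient_1[of "l i - l (n, q)"] by (auto intro: add_increasing2)
      next
        case False
        have "(1/2::real) ^ (m + n) \<le> (1/2) ^ n" by (intro power_decreasing) auto
        from order_trans[OF off[OF False mr(2) that] this] False show ?thesis by (simp add: mr(1))
      qed
      have "(\<Sum>j\<in>T. cmod (?F k (l i - l j))) \<le> (\<Sum>j\<in>{..<N} \<times> {..<R}. cmod (?F k (l i - l j)))"
        by (rule sum_mono2) (use N in auto)
      also have "\<dots> = (\<Sum>n<N. \<Sum>q<R. cmod (?F k (l i - l (n, q))))"
        by (simp add: sum.cartesian_product)
      also have "\<dots> \<le> (\<Sum>n<N. \<Sum>q<R. (if n = m then ?m else 0) + (1/2) ^ n)"
        by (intro sum_mono bd) auto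
      also have "\<dots> = real R * (?m + (\<Sum>n<N. (1/2) ^ n))"
        using N(2) by (simp add: sum.distrib distrib_left sum.delta flip: sum_distrib_left)
      also have "(\<Sum>n<N. (1/2::real) ^ n) \<le> 2"
        by (simp add: sum_gp_strict)
      finally show "(\<Sum>j\<in>T. cmod (?F k (l i - l j))) \<le> real R * (?m + 2)"
        by (simp add: mult_left_mono)
    qed
  qed
  then show ?thesis
    unfolding l_def by blast
qed

section \<open>Sums of measures and parallel planes\<close>

lemma space_eq_UNIV: "sets M = sets (borel :: 'a::topological_space measure) \<Longrightarrow> space M = UNIV"
  using sets_eq_imp_space_eq[of M borel] by simp

lemma measurable_eq_borel: "sets M = sets borel \<Longrightarrow> borel_measurable M = borel_measurable borel"
  by (rule measurable_cong_sets) auto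

lemma borel_measurable_borel_measure_sum [simp]:
  "borel_measurable (borel_measure_sum M I) = borel_measurable borel"
  by (rule measurable_eq_borel) simp

lemma nn_integral_borel_measure_sum:
  assumes "finite I" and sets: "\<And>i. i \<in> I \<Longrightarrow> sets (M i) = sets borel"
    and "f \<in> borel_measurable borel"
  shows "(\<integral>\<^sup>+x. f x \<partial>borel_measure_sum M I) = (\<Sum>i\<in>I. \<integral>\<^sup>+x. f x \<partial>M i)"
proof -
  note [simp] = measurable_eq_borel[OF sets]
  show ?thesis using assms(3)
  proof (induction f rule: borel_measurable_induct)
    case (cong f g)
    then have "f = g" by auto
    with cong show ?case by simp
  next
    case (set A)
    then show ?case
      by (simp add: emeasure_borel_measure_sum sets)
  next
    case (mult u c)
    then show ?case
      by (simp add: nn_integral_cmult sets sum_distrib_left cong: sum.cong)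
  next
    case (add u v)
    then show ?case
      by (simp add: nn_integral_add sets sum.distrib cong: sum.cong)
  next
    case (seq U)
    have "(\<integral>\<^sup>+x. (SUP j. U j) x \<partial>borel_measure_sum M I) = (SUP j. \<integral>\<^sup>+x. U j x \<partial>borel_measure_sum M I)"
      unfolding SUP_apply using seq
      by (intro nn_integral_monotone_convergence_SUP) auto
    also have "\<dots> = (SUP j. \<Sum>i\<in>I. \<integral>\<^sup>+x. U j x \<partial>M i)"
      by (simp add: seq)
    also have "\<dots> = (\<Sum>i\<in>I. SUP j. \<integral>\<^sup>+x. U j x \<partial>M i)"
      using \<open>incseq U\<close>
      by (intro ennreal_SUP_sum) (auto simp: incseq_def le_fun_def intro!: nn_integral_mono)
    also have "\<dots> = (\<Sum>i\<in>I. \<integral>\<^sup>+x. (SUP j. U j) x \<partial>M i)"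
      unfolding SUP_apply using seq
      by (intro sum.cong refl nn_integral_monotone_convergence_SUP[symmetric]) auto
    finally show ?case .
  qed
qed

lemma integrable_borel_measure_sum:
  fixes f :: "'a::topological_space \<Rightarrow> 'b::{banach, second_countable_topology}"
  assumes "finite I" "\<And>i. i \<in> I \<Longrightarrow> sets (M i) = sets borel"
    and "f \<in> borel_measurable borel"
  shows "integrable (borel_measure_sum M I) f \<longleftrightarrow> (\<forall>i\<in>I. integrable (M i) f)"
  using assms measurable_eq_borel[OF assms(2)] by (auto simp: integrable_iff_bounded nn_integral_borel_measure_sum)

lemma integral_borel_measure_sum_real:
  fixes f :: "'a::topological_space \<Rightarrow> real"
  assumes I: "finite I" "\<And>i. i \<in> I \<Longrightarrow> sets (M i) = sets borel"
    and int: "integrable (borel_measure_sum M I) f"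
  shows "(\<integral>x. f x \<partial>borel_measure_sum M I) = (\<Sum>i\<in>I. \<integral>x. f x \<partial>M i)"
proof -
  have f: "f \<in> borel_measurable borel"
    using borel_measurable_integrable[OF int] by simp
  have fi: "integrable (M i) f" if "i \<in> I" for i
    using integrable_borel_measure_sum[OF I f] int that by simp
  have "(\<Sum>i\<in>I. enn2real (\<integral>\<^sup>+x. ennreal (f x) \<partial>M i)) = enn2real (\<Sum>i\<in>I. \<integral>\<^sup>+x. ennreal (f x) \<partial>M i)"
    "(\<Sum>i\<in>I. enn2real (\<integral>\<^sup>+x. ennreal (- f x) \<partial>M i)) = enn2real (\<Sum>i\<in>I. \<integral>\<^sup>+x. ennreal (- f x) \<partial>M i)"
    using fi by (subst enn2real_sum; force simp: real_integrable_def less_top[symmetric])+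
  then show ?thesis
    using I f int fi
    by (simp add: real_lebesgue_integral_def nn_integral_borel_measure_sum sum_subtractf)
qed

lemma integral_borel_measure_sum:
  fixes f :: "'a::topological_space \<Rightarrow> complex"
  assumes I: "finite I" "\<And>i. i \<in> I \<Longrightarrow> sets (M i) = sets borel"
    and int: "integrable (borel_measure_sum M I) f"
  shows "(\<integral>x. f x \<partial>borel_measure_sum M I) = (\<Sum>i\<in>I. \<integral>x. f x \<partial>M i)"
proof -
  have f: "f \<in> borel_measurable borel"
    using borel_measurable_integrable[OF int] by simp
  have fi: "integrable (M i) f" if "i \<in> I" for i
    using integrable_borel_measure_sum[OF I f] int that by simp
  show ?thesis
  proof (rule complex_eqI)
    have "Re (\<integral>x. f x \<partial>borel_measure_sum M I) = (\<integral>x. Re (f x) \<partial>borel_measure_sum M I)"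
      using int by simp
    also have "\<dots> = (\<Sum>i\<in>I. \<integral>x. Re (f x) \<partial>M i)"
      using int by (intro integral_borel_measure_sum_real I) auto
    finally show "Re (\<integral>x. f x \<partial>borel_measure_sum M I) = Re (\<Sum>i\<in>I. \<integral>x. f x \<partial>M i)"
      using fi by simp
    have "Im (\<integral>x. f x \<partial>borel_measure_sum M I) = (\<integral>x. Im (f x) \<partial>borel_measure_sum M I)"
      using int by simp
    also have "\<dots> = (\<Sum>i\<in>I. \<integral>x. Im (f x) \<partial>M i)"
      using int by (intro integral_borel_measure_sum_real I) auto
    finally show "Im (\<integral>x. f x \<partial>borel_measure_sum M I) = Im (\<Sum>i\<in>I. \<integral>x. f x \<partial>M i)"
      using fi by simp
  qed
qed

lemma finite_euclidean_measure_sum: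
  assumes "finite I" "\<And>i. i \<in> I \<Longrightarrow> finite_euclidean_measure (M i)"
  shows "finite_euclidean_measure (borel_measure_sum M I)"
proof (rule finite_euclidean_measure.intro)
  have s: "sets (M i) = sets borel" "emeasure (M i) UNIV \<noteq> \<infinity>" if "i \<in> I" for i
  proof -
    interpret finite_euclidean_measure "M i" by (rule assms(2)[OF that])
    show "sets (M i) = sets borel" by simp
    show "emeasure (M i) UNIV \<noteq> \<infinity>" using emeasure_finite[of UNIV] by simp
  qed
  show "finite_measure (borel_measure_sum M I)"
    by (rule finite_measureI) (use s assms(1) in \<open>simp add: space_eq_UNIV emeasure_borel_measure_sum\<close>)
  show "finite_euclidean_measure_axioms (borel_measure_sum M I)"
    by standard simp
qed

lemma square_integrable_borel_measure_sum:
  assumes "finite I" "\<forall>i\<in>I. finite_euclidean_measure (M i)"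
    and f: "square_integrable (borel_measure_sum M I) f"
  shows "\<And>i. i \<in> I \<Longrightarrow> square_integrable (M i) f"
    and "sqnorm (borel_measure_sum M I) f = (\<Sum>i\<in>I. \<integral>x. (cmod (f x))\<^sup>2 \<partial>M i)"
    and "fourier_coefficient (borel_measure_sum M I) f l = (\<Sum>i\<in>I. fourier_coefficient (M i) f l)"
proof -
  interpret S: finite_euclidean_measure "borel_measure_sum M I"
    using assms by (intro finite_euclidean_measure_sum) auto
  have s: "sets (M i) = sets borel" if "i \<in> I" for i
    by (rule finite_euclidean_measure.sets_eq_borel) (use assms(2) that in blast)
  have fm: "f \<in> borel_measurable borel"
    using f by (simp add: square_integrable_def)
  then have f2m: "(\<lambda>x. (cmod (f x))\<^sup>2) \<in> borel_measurable borel"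
    by measurable
  have int: "integrable (borel_measure_sum M I) (\<lambda>x. (cmod (f x))\<^sup>2)"
    using f by (simp add: square_integrable_def)
  show "square_integrable (M i) f" if "i \<in> I" for i
    using that fm int integrable_borel_measure_sum[OF assms(1) s f2m]
    by (simp add: square_integrable_def measurable_eq_borel[OF s])
  show "sqnorm (borel_measure_sum M I) f = (\<Sum>i\<in>I. \<integral>x. (cmod (f x))\<^sup>2 \<partial>M i)"
    by (rule integral_borel_measure_sum_real[OF assms(1) s int])
  show "fourier_coefficient (borel_measure_sum M I) f l = (\<Sum>i\<in>I. fourier_coefficient (M i) f l)"
    unfolding fourier_coefficient_character
    by (intro integral_borel_measure_sum assms(1) s S.integrable_mult_bounded
        S.square_integrable_integrable f) auto
qed

section \<open>Frames for finitely many parallel planes\<close>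

lemma norm_sum_square_le:
  fixes a :: "'i \<Rightarrow> complex"
  shows "(cmod (\<Sum>i\<in>I. a i))\<^sup>2 \<le> real (card I) * (\<Sum>i\<in>I. (cmod (a i))\<^sup>2)"
proof -
  have "(cmod (\<Sum>i\<in>I. a i))\<^sup>2 \<le> (\<Sum>i\<in>I. cmod (a i))\<^sup>2"
    by (intro power_mono norm_sum) auto
  also have "\<dots> \<le> (\<Sum>i\<in>I. (cmod (a i))\<^sup>2) * card I"
    by (rule sum_squared_le_sum_of_squares)
  finally show ?thesis by (simp add: mult.commute)
qed

text \<open>The characters of \<open>\<int>\<close> with frequencies distinct modulo 1 are asymptotically orthogonal.\<close>

lemma exists_separating_length:
  fixes c :: "'j \<Rightarrow> real"
  assumes J: "finite J" and c: "\<And>i j. i \<in> J \<Longrightarrow> j \<in> J \<Longrightarrow> i \<noteq> j \<Longrightarrow> c i - c j \<notin> \<int>"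
  shows "\<exists>R>0. \<forall>t (a :: 'j \<Rightarrow> complex). real R / 2 * (\<Sum>j\<in>J. (cmod (a j))\<^sup>2)
      \<le> (\<Sum>r<R. (cmod (\<Sum>j\<in>J. a j * cis (- (2 * pi * ((t + real r) * c j)))))\<^sup>2)"
proof (cases "J = {}")
  case True
  then show ?thesis by (intro exI[of _ 1]) simp
next
  case False
  \<comment> \<open>The threshold \<open>1 / (2 * n)\<close> below is tuned to Cauchy-Schwarz:
    off-diagonal entries of size \<open>R / (2 * n)\<close> contribute at most
    \<open>n * S * R / (2 * n)\<close>, half of the diagonal part \<open>R * S\<close>.\<close>
  define n where "n = real (card J)"
  have n: "n > 0" using J False by (simp add: n_def card_gt_0_iff)
  have "\<forall>\<^sub>F R in sequentially. \<forall>p\<in>{(i, j) \<in> J \<times> J. i \<noteq> j}.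
      cmod ((\<Sum>r<R. cis (2 * pi * (real r * (c (snd p) - c (fst p))))) / of_nat R) < 1 / (2 * n)"
  proof (rule eventually_ball_finite)
    show "finite {(i, j) \<in> J \<times> J. i \<noteq> j}"
      by (rule finite_subset[of _ "J \<times> J"]) (use J in auto)
    show "\<forall>p\<in>{(i, j) \<in> J \<times> J. i \<noteq> j}. \<forall>\<^sub>F R in sequentially.
        cmod ((\<Sum>r<R. cis (2 * pi * (real r * (c (snd p) - c (fst p))))) / of_nat R) < 1 / (2 * n)"
    proof
      fix p assume "p \<in> {(i, j) \<in> J \<times> J. i \<noteq> j}"
      then have "c (snd p) - c (fst p) \<notin> \<int>" using c[of "snd p" "fst p"] by auto
      from tendsto_norm_zero[OF cis_cesaro[OF this]] n
      show "\<forall>\<^sub>F R in sequentially.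
          cmod ((\<Sum>r<R. cis (2 * pi * (real r * (c (snd p) - c (fst p))))) / of_nat R) < 1 / (2 * n)"
        by (intro order_tendstoD) auto
    qed
  qed
  then obtain R where R: "R > 0" and off': "\<forall>p\<in>{(i, j) \<in> J \<times> J. i \<noteq> j}.
      cmod ((\<Sum>r<R. cis (2 * pi * (real r * (c (snd p) - c (fst p))))) / of_nat R) < 1 / (2 * n)"
    using eventually_happens'[OF sequentially_bot eventually_conj[OF eventually_gt_at_top[of 0]]] by blast
  have off: "\<And>i j. i \<in> J \<Longrightarrow> j \<in> J \<Longrightarrow> i \<noteq> j \<Longrightarrow>
      cmod ((\<Sum>r<R. cis (2 * pi * (real r * (c j - c i)))) / of_nat R) < 1 / (2 * n)"
    using bspec[OF off'] by auto
  define G where "G = (\<lambda>i j. \<Sum>r<R. cis (2 * pi * (real r * (c j - c i))))"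
  have G_diag: "G i i = of_nat R" for i
    by (simp add: G_def)
  have G_off: "cmod (G i j) \<le> R / (2 * n)" if "i \<in> J" "j \<in> J" "i \<noteq> j" for i j
  proof -
    have "cmod (G i j) / real R < 1 / (2 * n)"
      using off[OF that] unfolding G_def norm_divide norm_of_nat .
    then have "cmod (G i j) < 1 / (2 * n) * real R"
      using R by (subst (asm) pos_divide_less_eq) auto
    then show ?thesis by simp
  qed
  have "real R / 2 * (\<Sum>j\<in>J. (cmod (a j))\<^sup>2)
      \<le> (\<Sum>r<R. (cmod (\<Sum>j\<in>J. a j * cis (- (2 * pi * ((t + real r) * c j)))))\<^sup>2)"
    for t and a :: "'j \<Rightarrow> complex"
  proof -
    \<comment> \<open>Putting the phase due to \<open>t\<close> into the coefficients leaves their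
      absolute values unchanged; hence \<open>R\<close> works for all \<open>t\<close>
      simultaneously.\<close>
    define b where "b = (\<lambda>j. a j * cis (- (2 * pi * (t * c j))))"
    define S where "S = (\<Sum>j\<in>J. (cmod (b j))\<^sup>2)"
    have b_norm: "cmod (b j) = cmod (a j)" for j
      by (simp add: b_def norm_mult)
    define e where "e = (\<lambda>r j. cis (- (2 * pi * (real r * c j))))"
    have split: "a j * cis (- (2 * pi * ((t + real r) * c j))) = b j * e r j" for j r
      by (simp add: b_def e_def cis_mult distrib_left distrib_right mult.assoc)
    have e_mult: "e r i * cnj (e r j) = cis (2 * pi * (real r * (c j - c i)))" for r i j
      by (simp add: e_def cis_cnj cis_mult algebra_simps)
    define H where "H = (\<lambda>i j. if i = j then 0 else G i j)"
    have H: "cmod (H i j) \<le> R / (2 * n)" if "i \<in> J" "j \<in> J" for i j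
      using G_off[OF that] n by (auto simp: H_def)
    have "complex_of_real (\<Sum>r<R. (cmod (\<Sum>j\<in>J. b j * e r j))\<^sup>2)
        = (\<Sum>r<R. \<Sum>i\<in>J. \<Sum>j\<in>J. b i * cnj (b j) * (e r i * cnj (e r j)))"
      by (simp only: of_real_sum of_real_norm_square cnj_sum complex_cnj_mult sum_product) (simp add: ac_simps)
    also have "\<dots> = (\<Sum>i\<in>J. \<Sum>r<R. \<Sum>j\<in>J. b i * cnj (b j) * (e r i * cnj (e r j)))"
      by (rule sum.swap)
    also have "\<dots> = (\<Sum>i\<in>J. \<Sum>j\<in>J. \<Sum>r<R. b i * cnj (b j) * (e r i * cnj (e r j)))"
      by (rule sum.cong[OF refl], rule sum.swap)
    also have "\<dots> = (\<Sum>i\<in>J. \<Sum>j\<in>J. b i * cnj (b j) * G i j)"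
      by (simp only: e_mult G_def sum_distrib_left)
    also have "\<dots> = (\<Sum>i\<in>J. \<Sum>j\<in>J. (if i = j then of_nat R * (b i * cnj (b i)) else 0) + b i * cnj (b j) * H i j)"
      by (intro sum.cong refl) (auto simp: H_def G_diag)
    also have "\<dots> = of_nat R * (\<Sum>i\<in>J. b i * cnj (b i)) + (\<Sum>i\<in>J. \<Sum>j\<in>J. b i * cnj (b j) * H i j)"
      using J by (simp add: sum.distrib sum_distrib_left)
    also have "(\<Sum>i\<in>J. b i * cnj (b i)) = complex_of_real S"
      by (simp only: S_def of_real_sum of_real_norm_square)
    finally have "complex_of_real (\<Sum>r<R. (cmod (\<Sum>j\<in>J. b j * e r j))\<^sup>2)
        = complex_of_real (R * S) + (\<Sum>i\<in>J. \<Sum>j\<in>J. b i * cnj (b j) * H i j)"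
      by simp
    from arg_cong[OF this, of Re] have "(\<Sum>r<R. (cmod (\<Sum>j\<in>J. b j * e r j))\<^sup>2) = R * S + Re (\<Sum>i\<in>J. \<Sum>j\<in>J. b i * cnj (b j) * H i j)"
      by (simp only: Re_complex_of_real plus_complex.sel)
    moreover have "cmod (\<Sum>i\<in>J. \<Sum>j\<in>J. b i * cnj (b j) * H i j) \<le> R * S / 2"
    proof -
      have "cmod (\<Sum>i\<in>J. \<Sum>j\<in>J. b i * cnj (b j) * H i j) \<le> (\<Sum>i\<in>J. \<Sum>j\<in>J. cmod (b i) * cmod (b j) * (R / (2 * n)))"
        by (intro sum_norm_le) (simp only: norm_mult complex_mod_cnj, rule mult_left_mono, auto intro: H)
      also have "\<dots> = (\<Sum>i\<in>J. cmod (b i))\<^sup>2 * (R / (2 * n))"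
        by (simp only: power2_eq_square sum_product sum_distrib_right[symmetric])
      also have "\<dots> \<le> (S * n) * (R / (2 * n))"
        unfolding S_def n_def by (intro mult_right_mono sum_squared_le_sum_of_squares) auto
      finally show ?thesis using n by (simp add: mult.commute)
    qed
    ultimately have "(\<Sum>r<R. (cmod (\<Sum>j\<in>J. b j * e r j))\<^sup>2) \<ge> R * S / 2"
      using abs_Re_le_cmod[of "\<Sum>i\<in>J. \<Sum>j\<in>J. b i * cnj (b j) * H i j"] by linarith
    then show ?thesis
      unfolding split by (simp add: S_def b_norm)
  qed
  with R show ?thesis by blast
qed

text \<open>The copies are numbered by \<open>prod_encode\<close> because the recursive choice of
  shifts runs over the natural numbers. Each coefficient occurs \<open>N\<close> times, so the bound
  is multiplied by \<open>N\<close>.\<close>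

lemma lower_frame_copies:
  assumes "lower_frame M X l A"
  shows "lower_frame M (prod_encode ` (X \<times> {..<N})) (l \<circ> fst \<circ> prod_decode) (real N * A)"
  unfolding lower_frame_def
proof (intro allI impI)
  fix f assume f: "square_integrable M f"
  obtain T where T: "finite T" "T \<subseteq> X"
    "A * sqnorm M f \<le> (\<Sum>i\<in>T. coeff_sq M f (l i))"
    by (rule lower_frameE[OF assms f])
  have "(\<Sum>i\<in>prod_encode ` (T \<times> {..<N}). coeff_sq M f ((l \<circ> fst \<circ> prod_decode) i))
      = (\<Sum>p\<in>T \<times> {..<N}. coeff_sq M f (l (fst p)))"
    by (subst sum.reindex) (auto simp: inj_on_def)
  also have "\<dots> = real N * (\<Sum>i\<in>T. coeff_sq M f (l i))"
    by (simp add: sum.cartesian_product' sum_distrib_left)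
  also have "\<dots> \<ge> real N * (A * sqnorm M f)"
    using T(3) by (intro mult_left_mono) auto
  finally have "real N * A * sqnorm M f
      \<le> (\<Sum>i\<in>prod_encode ` (T \<times> {..<N}). coeff_sq M f ((l \<circ> fst \<circ> prod_decode) i))"
    by (simp add: mult.assoc)
  then show "\<exists>T. finite T \<and> T \<subseteq> prod_encode ` (X \<times> {..<N}) \<and> real N * A * sqnorm M f
      \<le> (\<Sum>i\<in>T. coeff_sq M f ((l \<circ> fst \<circ> prod_decode) i))"
    using T(1,2) by (intro exI[of _ "prod_encode ` (T \<times> {..<N})"]) auto
qed

lemma bessel_copies:
  assumes "bessel M X l B"
  shows "bessel M (prod_encode ` (X \<times> {..<N})) (l \<circ> fst \<circ> prod_decode) (real N * B)"
  unfolding bessel_def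
proof (intro allI impI)
  fix f T assume f: "square_integrable M f" and T: "finite T" "T \<subseteq> prod_encode ` (X \<times> {..<N})"
  define T' where "T' = (fst \<circ> prod_decode) ` T"
  have T': "finite T'" "T' \<subseteq> X" "T \<subseteq> prod_encode ` (T' \<times> {..<N})"
    using T by (auto simp: T'_def image_iff) force+
  have "(\<Sum>i\<in>T. coeff_sq M f ((l \<circ> fst \<circ> prod_decode) i))
      \<le> (\<Sum>i\<in>prod_encode ` (T' \<times> {..<N}). coeff_sq M f ((l \<circ> fst \<circ> prod_decode) i))"
    using T' by (intro sum_mono2) auto
  also have "\<dots> = (\<Sum>p\<in>T' \<times> {..<N}. coeff_sq M f (l (fst p)))"
    by (subst sum.reindex) (auto simp: inj_on_def)
  also have "\<dots> = real N * (\<Sum>i\<in>T'. coeff_sq M f (l i))"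
    by (simp add: sum.cartesian_product' sum_distrib_left)
  also have "\<dots> \<le> real N * (B * sqnorm M f)"
    by (intro mult_left_mono besselD[OF assms f] T') auto
  finally show "(\<Sum>i\<in>T. coeff_sq M f ((l \<circ> fst \<circ> prod_decode) i))
      \<le> real N * B * sqnorm M f"
    by (simp add: mult.assoc)
qed

text \<open>This is why shifts along \<open>v\<close> are free for planes orthogonal to
  \<open>v\<close>: absolute values of coefficients on a single plane do not change, and the phases
  depend only on the height \<open>c\<close> of the plane.\<close>

lemma fourier_coefficient_shift:
  assumes "finite_euclidean_measure M" and c: "AE x in M. v \<bullet> x = c" and f: "square_integrable M f"
  shows "fourier_coefficient M f (l + u *\<^sub>R v) = fourier_coefficient M f l * cis (- (2 * pi * (u * c)))"
proof -
  interpret finite_euclidean_measure M by fact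
  have fm: "f \<in> borel_measurable borel"
    using f by (simp add: square_integrable_def borel_measurable_eq)
  have "fourier_coefficient M f (l + u *\<^sub>R v) = (\<integral>x. (f x * cnj (character l x)) * cis (- (2 * pi * (u * c))) \<partial>M)"
    unfolding fourier_coefficient_character
  proof (rule integral_cong_AE)
    show "AE x in M. f x * cnj (character (l + u *\<^sub>R v) x) = f x * cnj (character l x) * cis (- (2 * pi * (u * c)))"
      using c by eventually_elim (simp add: character_add, simp add: character_def cis_cnj)
  qed (use fm in \<open>simp_all add: borel_measurable_eq\<close>)
  also have "\<dots> = fourier_coefficient M f l * cis (- (2 * pi * (u * c)))"
    unfolding fourier_coefficient_character by (rule integral_mult_left_zero)
  finally show ?thesis .
qed

text \<open>At each base frequency the coefficients of the sum at the \<open>R\<close> shifts are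
  trigonometric sums in the heights \<open>c j\<close>, from which
  \<open>exists_separating_length\<close> recovers the coefficients on the single planes.
  \<open>R\<close> is quantified before \<open>X\<close> and \<open>t\<close>, because in the
  application both are chosen after \<open>R\<close>.\<close>

lemma parallel_frame:
  assumes J: "finite J" and \<mu>: "\<And>j. j \<in> J \<Longrightarrow> finite_euclidean_measure (\<mu> j)"
    and c: "\<And>j. j \<in> J \<Longrightarrow> AE x in \<mu> j. v \<bullet> x = c j"
    and cZ: "\<And>i j. i \<in> J \<Longrightarrow> j \<in> J \<Longrightarrow> i \<noteq> j \<Longrightarrow> c i - c j \<notin> \<int>"
  shows "\<exists>R>0. \<forall>(X :: 'x set) \<xi> A B t.
      (\<forall>j\<in>J. lower_frame (\<mu> j) X \<xi> A) \<longrightarrow> (\<forall>j\<in>J. bessel (\<mu> j) X \<xi> B) \<longrightarrow>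
      lower_frame (borel_measure_sum \<mu> J) (X \<times> {..<R}) (\<lambda>(m, r). \<xi> m + (t m + real r) *\<^sub>R v) (real R / 2 * A) \<and>
      bessel (borel_measure_sum \<mu> J) (X \<times> {..<R}) (\<lambda>(m, r). \<xi> m + (t m + real r) *\<^sub>R v) (real R * card J * B)"
proof -
  have "\<exists>R>0. \<forall>t (a :: _ \<Rightarrow> complex). real R / 2 * (\<Sum>j\<in>J. (cmod (a j))\<^sup>2)
      \<le> (\<Sum>r<R. (cmod (\<Sum>j\<in>J. a j * cis (- (2 * pi * ((t + real r) * c j)))))\<^sup>2)"
    by (rule exists_separating_length) (fact J cZ)+
  then obtain R where R: "R > 0" and sep: "\<And>t (a :: _ \<Rightarrow> complex). real R / 2 * (\<Sum>j\<in>J. (cmod (a j))\<^sup>2)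
      \<le> (\<Sum>r<R. (cmod (\<Sum>j\<in>J. a j * cis (- (2 * pi * ((t + real r) * c j)))))\<^sup>2)"
    by blast
  let ?S = "borel_measure_sum \<mu> J"
  have \<mu>': "\<forall>j\<in>J. finite_euclidean_measure (\<mu> j)" using \<mu> by blast
  show ?thesis
  proof (intro exI[of _ R] conjI[OF R] allI impI)
    fix X :: "'x set" and \<xi> A B and t :: "'x \<Rightarrow> real"
    assume low: "\<forall>j\<in>J. lower_frame (\<mu> j) X \<xi> A" and bes: "\<forall>j\<in>J. bessel (\<mu> j) X \<xi> B"
    define l where "l = (\<lambda>(m, r). \<xi> m + (t m + real r) *\<^sub>R v)"
    have fc: "fourier_coefficient ?S f (l (m, r))
        = (\<Sum>j\<in>J. fourier_coefficient (\<mu> j) f (\<xi> m) * cis (- (2 * pi * ((t m + real r) * c j))))"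
      if f: "square_integrable ?S f" for f m r
      unfolding square_integrable_borel_measure_sum(3)[OF J \<mu>' f] l_def prod.case
      by (intro sum.cong refl fourier_coefficient_shift \<mu> c square_integrable_borel_measure_sum(1)[OF J \<mu>' f])
    have "lower_frame ?S (X \<times> {..<R}) l (real R / 2 * A)"
      unfolding lower_frame_def
    proof (intro allI impI)
      fix f assume f: "square_integrable ?S f"
      note fj = square_integrable_borel_measure_sum[OF J \<mu>' f]
      have "\<exists>T. finite T \<and> T \<subseteq> X \<and>
        A * sqnorm (\<mu> j) f \<le> (\<Sum>i\<in>T. coeff_sq (\<mu> j) f (\<xi> i))" if "j \<in> J" for j
        using low fj(1) that unfolding lower_frame_def by blast
      then obtain T where T: "\<And>j. j \<in> J \<Longrightarrow> finite (T j)" "\<And>j. j \<in> J \<Longrightarrow> T j \<subseteq> X"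
        "\<And>j. j \<in> J \<Longrightarrow> A * sqnorm (\<mu> j) f \<le> (\<Sum>i\<in>T j. coeff_sq (\<mu> j) f (\<xi> i))"
        by metis
      \<comment> \<open>The separation inequality at a frequency involves all planes at once, so one
        finite set must serve every \<open>j\<close>; enlarging \<open>T j\<close> only increases
        its sum.\<close>
      define U where "U = (\<Union>j\<in>J. T j)"
      have U: "finite U" "U \<subseteq> X" using T J by (auto simp: U_def)
      have "A * sqnorm ?S f = (\<Sum>j\<in>J. A * sqnorm (\<mu> j) f)"
        by (simp add: fj(2) sum_distrib_left)
      also have "\<dots> \<le> (\<Sum>j\<in>J. \<Sum>i\<in>U. coeff_sq (\<mu> j) f (\<xi> i))"
        using U by (intro sum_mono order_trans[OF T(3)] sum_mono2) (auto simp: U_def)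
      also have "\<dots> = (\<Sum>i\<in>U. \<Sum>j\<in>J. coeff_sq (\<mu> j) f (\<xi> i))"
        by (rule sum.swap)
      finally have "real R / 2 * (A * sqnorm ?S f)
          \<le> real R / 2 * (\<Sum>i\<in>U. \<Sum>j\<in>J. coeff_sq (\<mu> j) f (\<xi> i))"
        by (intro mult_left_mono) auto
      also have "\<dots> \<le> (\<Sum>i\<in>U. \<Sum>r<R. coeff_sq ?S f (l (i, r)))"
        unfolding sum_distrib_left[of _ _ U] by (intro sum_mono) (simp only: fc[OF f] sep)
      also have "\<dots> = (\<Sum>p\<in>U \<times> {..<R}. coeff_sq ?S f (l p))"
        by (simp add: sum.cartesian_product)
      finally show "\<exists>T. finite T \<and> T \<subseteq> X \<times> {..<R} \<and>
          real R / 2 * A * sqnorm ?S f \<le> (\<Sum>i\<in>T. coeff_sq ?S f (l i))"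
        using U by (intro exI[of _ "U \<times> {..<R}"]) (auto simp: mult.assoc)
    qed
    moreover have "bessel ?S (X \<times> {..<R}) l (real R * card J * B)"
      unfolding bessel_def
    proof (intro allI impI)
      fix f T assume f: "square_integrable ?S f" and T: "finite T" "T \<subseteq> X \<times> {..<R}"
      note fj = square_integrable_borel_measure_sum[OF J \<mu>' f]
      define U where "U = fst ` T"
      have U: "finite U" "U \<subseteq> X" "T \<subseteq> U \<times> {..<R}"
        using T by (auto simp: U_def image_iff) force+
      have "(\<Sum>p\<in>T. coeff_sq ?S f (l p))
          \<le> (\<Sum>p\<in>U \<times> {..<R}. coeff_sq ?S f (l p))"
        using U by (intro sum_mono2) auto
      also have "\<dots> = (\<Sum>i\<in>U. \<Sum>r<R. coeff_sq ?S f (l (i, r)))"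
        by (simp add: sum.cartesian_product)
      also have "\<dots> \<le> (\<Sum>i\<in>U. \<Sum>r<R. card J * (\<Sum>j\<in>J. coeff_sq (\<mu> j) f (\<xi> i)))"
        unfolding fc[OF f]
        by (intro sum_mono order_trans[OF norm_sum_square_le]) (simp add: norm_mult)
      also have "\<dots> = real R * card J * (\<Sum>i\<in>U. \<Sum>j\<in>J. coeff_sq (\<mu> j) f (\<xi> i))"
        by (simp add: sum_distrib_left mult.assoc)
      also have "(\<Sum>i\<in>U. \<Sum>j\<in>J. coeff_sq (\<mu> j) f (\<xi> i))
          = (\<Sum>j\<in>J. \<Sum>i\<in>U. coeff_sq (\<mu> j) f (\<xi> i))"
        by (rule sum.swap)
      also have "real R * card J * (\<Sum>j\<in>J. \<Sum>i\<in>U. coeff_sq (\<mu> j) f (\<xi> i))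
          \<le> real R * card J * (\<Sum>j\<in>J. B * sqnorm (\<mu> j) f)"
        using bes U by (intro mult_left_mono sum_mono besselD[where X = X] fj(1)) auto
      finally show "(\<Sum>p\<in>T. coeff_sq ?S f (l p))
          \<le> real R * card J * B * sqnorm ?S f"
        by (simp add: fj(2) sum_distrib_left mult.assoc)
    qed
    ultimately show "lower_frame ?S (X \<times> {..<R}) (\<lambda>(m, r). \<xi> m + (t m + real r) *\<^sub>R v) (real R / 2 * A) \<and>
        bessel ?S (X \<times> {..<R}) (\<lambda>(m, r). \<xi> m + (t m + real r) *\<^sub>R v) (real R * card J * B)"
      by (simp add: l_def)
  qed
qed

text \<open>
  Repeating the base frequencies raises the lower bound as much as desired, while the Bessel bounds
  for the measures \<open>\<nu> k\<close> do not change because the copies are moved apart along \<open>v\<close>.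
\<close>

lemma oversampled_frame:
  fixes X :: "nat set"
  assumes J: "finite J" and \<mu>: "\<And>j. j \<in> J \<Longrightarrow> finite_euclidean_measure (\<mu> j)"
    and c: "\<And>j. j \<in> J \<Longrightarrow> AE x in \<mu> j. v \<bullet> x = c j"
    and cZ: "\<And>i j. i \<in> J \<Longrightarrow> j \<in> J \<Longrightarrow> i \<noteq> j \<Longrightarrow> c i - c j \<notin> \<int>"
    and base: "0 < A" "\<And>j. j \<in> J \<Longrightarrow> lower_frame (\<mu> j) X \<xi> A" "\<And>j. j \<in> J \<Longrightarrow> bessel (\<mu> j) X \<xi> B"
    and K: "finite K" and \<nu>: "\<And>k. k \<in> K \<Longrightarrow> finite_euclidean_measure (\<nu> k)"
    and null: "\<And>k c. k \<in> K \<Longrightarrow> emeasure (\<nu> k) {x. v \<bullet> x = c} = 0"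
  shows "\<exists>C. \<forall>A'. \<exists>Y (l :: nat \<times> nat \<Rightarrow> _) D. lower_frame (borel_measure_sum \<mu> J) Y l A' \<and>
      bessel (borel_measure_sum \<mu> J) Y l D \<and> (\<forall>k\<in>K. bessel (\<nu> k) Y l C)"
proof -
  have "\<exists>R>0. \<forall>(X :: nat set) \<xi> A B t.
      (\<forall>j\<in>J. lower_frame (\<mu> j) X \<xi> A) \<longrightarrow> (\<forall>j\<in>J. bessel (\<mu> j) X \<xi> B) \<longrightarrow>
      lower_frame (borel_measure_sum \<mu> J) (X \<times> {..<R}) (\<lambda>(m, r). \<xi> m + (t m + real r) *\<^sub>R v) (real R / 2 * A) \<and>
      bessel (borel_measure_sum \<mu> J) (X \<times> {..<R}) (\<lambda>(m, r). \<xi> m + (t m + real r) *\<^sub>R v) (real R * card J * B)"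
    by (rule parallel_frame) (fact J \<mu> c cZ)+
  then obtain R where R: "R > 0" and fr: "\<And>(X :: nat set) \<xi> A B t.
      (\<forall>j\<in>J. lower_frame (\<mu> j) X \<xi> A) \<Longrightarrow> (\<forall>j\<in>J. bessel (\<mu> j) X \<xi> B) \<Longrightarrow>
      lower_frame (borel_measure_sum \<mu> J) (X \<times> {..<R}) (\<lambda>(m, r). \<xi> m + (t m + real r) *\<^sub>R v) (real R / 2 * A) \<and>
      bessel (borel_measure_sum \<mu> J) (X \<times> {..<R}) (\<lambda>(m, r). \<xi> m + (t m + real r) *\<^sub>R v) (real R * card J * B)"
    by blast
  \<comment> \<open>The bound involves the block length \<open>R\<close> and the masses, but not the
    number \<open>N\<close> of copies, which is chosen only after \<open>A'\<close> is
    given.\<close>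
  define C where "C = Max (insert 0 ((\<lambda>k. real R * (measure (\<nu> k) (space (\<nu> k)) + 2)) ` K))"
  show ?thesis
  proof (intro exI[of _ C] allI)
    fix A'
    obtain N :: nat where N: "A' \<le> real N * (real R / 2 * A)"
      using reals_Archimedean3[of "real R / 2 * A"] R base(1) by (meson less_imp_le divide_pos_pos mult_pos_pos of_nat_0_less_iff zero_less_numeral)
    define X' where "X' = prod_encode ` (X \<times> {..<N})"
    define \<xi>' where "\<xi>' = \<xi> \<circ> fst \<circ> prod_decode"
    have "\<exists>t. \<forall>k\<in>K. bessel (\<nu> k) (UNIV \<times> {..<R}) (\<lambda>(m, r). \<xi>' m + (t m + real r) *\<^sub>R v)
        (real R * (measure (\<nu> k) (space (\<nu> k)) + 2))"
      by (rule exists_bessel_shifts) (fact K R \<nu> null)+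
    then obtain t where t: "\<And>k. k \<in> K \<Longrightarrow> bessel (\<nu> k) (UNIV \<times> {..<R}) (\<lambda>(m, r). \<xi>' m + (t m + real r) *\<^sub>R v)
        (real R * (measure (\<nu> k) (space (\<nu> k)) + 2))"
      by blast
    define l where "l = (\<lambda>(m, r). \<xi>' m + (t m + real r) *\<^sub>R v)"
    have fr': "lower_frame (borel_measure_sum \<mu> J) (X' \<times> {..<R}) l (real R / 2 * (real N * A))"
      "bessel (borel_measure_sum \<mu> J) (X' \<times> {..<R}) l (real R * card J * (real N * B))"
      using fr[of X' \<xi>' "real N * A" "real N * B" t] base(2,3)
      by (auto simp: l_def X'_def \<xi>'_def intro: lower_frame_copies bessel_copies)
    have "bessel (\<nu> k) (X' \<times> {..<R}) l C" if k: "k \<in> K" for k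
    proof (rule bessel_mono)
      show "bessel (\<nu> k) (X' \<times> {..<R}) l (real R * (measure (\<nu> k) (space (\<nu> k)) + 2))"
        using t[OF k] unfolding l_def by (rule bessel_subset) auto
      show "real R * (measure (\<nu> k) (space (\<nu> k)) + 2) \<le> C"
        unfolding C_def using K k by (intro Max_ge) auto
    qed
    moreover have "lower_frame (borel_measure_sum \<mu> J) (X' \<times> {..<R}) l A'"
      using fr'(1) by (rule lower_frame_mono) (use N in \<open>simp add: ac_simps\<close>)
    ultimately show "\<exists>Y (l :: nat \<times> nat \<Rightarrow> _) D. lower_frame (borel_measure_sum \<mu> J) Y l A' \<and>
      bessel (borel_measure_sum \<mu> J) Y l D \<and> (\<forall>k\<in>K. bessel (\<nu> k) Y l C)"
      using fr'(2) by blast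
  qed
qed

text \<open>Repetitions among the frequencies are harmless: the Bessel bound limits their multiplicities.\<close>

lemma admits_fourier_frame_family:
  assumes M: "finite_euclidean_measure M" and "countable X"
    and A: "0 < A" "lower_frame M X l A" and B: "bessel M X l B"
  shows "admits_fourier_frame M"
proof (cases "measure M (space M) = 0")
  \<comment> \<open>The zero measure has no positive mass by which to bound multiplicities; the
    empty set of frequencies is a frame for it.\<close>
  case True
  interpret finite_euclidean_measure M by fact
  have "emeasure M (space M) = 0"
    using True by (simp add: emeasure_eq_measure)
  then have ae: "AE x in M. P x" for P
    by (intro AE_I'[of "space M"]) auto
  have "sqnorm M f = 0" for f :: "'a \<Rightarrow> complex"
    by (rule integral_eq_zero_AE[OF ae])
  then show ?thesis
    unfolding admits_fourier_frame_def
    by (auto intro!: exI[of _ "{}"] exI[of _ 1] finite_measure_axioms)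
next
  case False
  interpret finite_euclidean_measure M by fact
  let ?m = "measure M (space M)"
  have m: "?m > 0" using False by (simp add: zero_less_measure_iff)
  let ?n = "\<lambda>f. \<integral>x. (cmod (f x))\<^sup>2 \<partial>M"
  let ?c = "\<lambda>f w. coeff_sq M f w"
  define q where "q = max 1 (B / ?m)"
  have q: "q \<ge> 1" by (simp add: q_def)
  have mult: "real (card T) \<le> q" if T: "finite T" "T \<subseteq> X" "\<And>i. i \<in> T \<Longrightarrow> l i = w" for T w
  proof -
    \<comment> \<open>Test the Bessel bound on the character \<open>w\<close> itself: each index in
      \<open>T\<close> contributes the square of the mass, while the squared norm equals the mass.
      Hence at most \<open>B / ?m\<close> indices share the frequency \<open>w\<close>.\<close>
    have "square_integrable M (character w)"
      by (rule square_integrable_bounded[where c = 1]) auto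
    from besselD[OF B this T(1,2)] have "real (card T) * ?m\<^sup>2 \<le> B * ?m"
      using T(3) by (simp add: fourier_coefficient_character)
    then have "real (card T) * ?m \<le> B"
      using m by (simp add: power2_eq_square)
    then have "real (card T) \<le> B / ?m"
      using m by (simp add: pos_le_divide_eq)
    then show ?thesis
      by (simp add: q_def le_max_iff_disj)
  qed
  define L where "L = l ` X"
  have "countable L" using \<open>countable X\<close> by (simp add: L_def)
  have up: "sum (?c f) T \<le> B * ?n f" if f: "square_integrable M f" and T: "finite T" "T \<subseteq> L" for f T
  proof -
    obtain Y where Y: "finite Y" "Y \<subseteq> X" "inj_on l Y" "T = l ` Y"
      using T unfolding L_def subset_image_inj by (metis finite_imageD)
    have "sum (?c f) T = (\<Sum>i\<in>Y. ?c f (l i))"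
      unfolding Y(4) by (simp add: sum.reindex[OF Y(3)])
    also have "\<dots> \<le> B * ?n f"
      by (rule besselD[OF B f Y(1,2)])
    finally show ?thesis .
  qed
  have summable: "?c f summable_on L" if f: "square_integrable M f" for f
    by (rule nonneg_bdd_above_summable_on) (use up[OF f] in \<open>auto intro!: bdd_aboveI[where M = "B * ?n f"]\<close>)
  have upper: "(\<Sum>\<^sub>\<infinity>w\<in>L. ?c f w) \<le> B * ?n f" if f: "square_integrable M f" for f
    by (rule infsum_le_finite_sums[OF summable[OF f] up[OF f]])
  have lower: "A / q * ?n f \<le> (\<Sum>\<^sub>\<infinity>w\<in>L. ?c f w)" if f: "square_integrable M f" for f
  proof -
    obtain T where T: "finite T" "T \<subseteq> X" "A * ?n f \<le> (\<Sum>i\<in>T. ?c f (l i))"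
      by (rule lower_frameE[OF A(2) f])
    have "(\<Sum>i\<in>T. ?c f (l i)) = (\<Sum>w\<in>l ` T. \<Sum>i\<in>{i\<in>T. l i = w}. ?c f (l i))"
      by (rule sum.image_gen[OF T(1)])
    also have "\<dots> = (\<Sum>w\<in>l ` T. real (card {i\<in>T. l i = w}) * ?c f w)"
      by (intro sum.cong) auto
    also have "\<dots> \<le> (\<Sum>w\<in>l ` T. q * ?c f w)"
      using T by (intro sum_mono mult_right_mono mult) auto
    also have "\<dots> = q * sum (?c f) (l ` T)"
      by (simp add: sum_distrib_left)
    also have "\<dots> \<le> q * (\<Sum>\<^sub>\<infinity>w\<in>L. ?c f w)"
      using q T by (intro mult_left_mono finite_sum_le_infsum summable f) (auto simp: L_def)
    finally show ?thesis
      using T(3) q by (simp add: field_simps)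
  qed
  \<comment> \<open>The maximum secures the order of the two frame constants that the definition
    requires.\<close>
  have "A / q \<le> max B (A / q)" "0 < A / q"
    using A(1) q by auto
  moreover have "(\<Sum>\<^sub>\<infinity>w\<in>L. ?c f w) \<le> max B (A / q) * ?n f" if "square_integrable M f" for f
    using upper[OF that] by (rule order_trans) (intro mult_right_mono, auto)
  ultimately show ?thesis
    unfolding admits_fourier_frame_def
    using summable lower \<open>countable L\<close> finite_measure_axioms sets_eq_borel by blast
qed

section \<open>Combining different directions\<close>

text \<open>From \<open>(x + y)\<^sup>2 \<le> 2 * x\<^sup>2 + 2 * y\<^sup>2\<close> and the triangle
  inequality. Half of the main term survives, and the interference is additive with a factor that a
  large lower frame bound can absorb.\<close>

lemma norm_sum_square_ge:
  fixes a :: "'i \<Rightarrow> complex"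
  assumes I: "finite I" "i \<in> I"
  shows "(cmod (a i))\<^sup>2 / 2 - real (card I) * (\<Sum>j\<in>I - {i}. (cmod (a j))\<^sup>2) \<le> (cmod (\<Sum>j\<in>I. a j))\<^sup>2"
proof -
  have eq: "(\<Sum>j\<in>I. a j) = a i + (\<Sum>j\<in>I - {i}. a j)"
    by (rule sum.remove[OF I])
  have "cmod (a i) \<le> cmod (\<Sum>j\<in>I. a j) + cmod (\<Sum>j\<in>I - {i}. a j)"
    using norm_triangle_ineq4[of "\<Sum>j\<in>I. a j" "\<Sum>j\<in>I - {i}. a j"] by (simp add: eq)
  then have "(cmod (a i))\<^sup>2 \<le> (cmod (\<Sum>j\<in>I. a j) + cmod (\<Sum>j\<in>I - {i}. a j))\<^sup>2"
    by (intro power_mono) auto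
  also have "\<dots> \<le> 2 * (cmod (\<Sum>j\<in>I. a j))\<^sup>2 + 2 * (cmod (\<Sum>j\<in>I - {i}. a j))\<^sup>2"
    using sum_squares_bound[of "cmod (\<Sum>j\<in>I. a j)" "cmod (\<Sum>j\<in>I - {i}. a j)"]
    by (simp add: power2_sum)
  finally have "(cmod (a i))\<^sup>2 / 2 - (cmod (\<Sum>j\<in>I - {i}. a j))\<^sup>2 \<le> (cmod (\<Sum>j\<in>I. a j))\<^sup>2"
    by simp
  moreover have "(cmod (\<Sum>j\<in>I - {i}. a j))\<^sup>2 \<le> real (card I) * (\<Sum>j\<in>I - {i}. (cmod (a j))\<^sup>2)"
    by (rule order_trans[OF norm_sum_square_le])
       (use I in \<open>auto intro!: mult_right_mono sum_nonneg card_mono simp del: card_Diff_singleton card_Diff_insert\<close>)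
  ultimately show ?thesis by linarith
qed

text \<open>The frequencies chosen for \<open>i\<close> see \<open>\<mu> i\<close> with a large
  lower bound and every other measure with a Bessel bound \<open>E\<close> fixed beforehand. So the
  main terms can be made to outweigh all the interference, summed over all families.\<close>

lemma admits_fourier_frame_sum:
  assumes I: "finite I" and \<mu>: "\<And>i. i \<in> I \<Longrightarrow> finite_euclidean_measure (\<mu> i)"
    and fr: "\<And>i. i \<in> I \<Longrightarrow> \<exists>C. \<forall>A. \<exists>Y (l :: nat \<times> nat \<Rightarrow> _) D. lower_frame (\<mu> i) Y l A \<and>
      bessel (\<mu> i) Y l D \<and> (\<forall>k\<in>I - {i}. bessel (\<mu> k) Y l C)"
  shows "admits_fourier_frame (borel_measure_sum \<mu> I)"
proof -
  let ?S = "borel_measure_sum \<mu> I"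
  have \<mu>': "\<forall>i\<in>I. finite_euclidean_measure (\<mu> i)" using \<mu> by blast
  let ?c = "\<lambda>i f w. coeff_sq (\<mu> i) f w"
  let ?n = "\<lambda>i f. \<integral>x. (cmod (f x))\<^sup>2 \<partial>\<mu> i"
  define n where "n = real (card I)"
  obtain C where C: "\<And>i. i \<in> I \<Longrightarrow> \<forall>A. \<exists>Y (l :: nat \<times> nat \<Rightarrow> _) D. lower_frame (\<mu> i) Y l A \<and>
      bessel (\<mu> i) Y l D \<and> (\<forall>k\<in>I - {i}. bessel (\<mu> k) Y l (C i))"
    using fr by metis
  \<comment> \<open>The inserted 0 keeps \<open>E\<close> nonnegative and the maximum defined when
    \<open>I\<close> is empty.\<close>
  define E where "E = Max (insert 0 (C ` I))"
  have E: "0 \<le> E" "\<And>i. i \<in> I \<Longrightarrow> C i \<le> E"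
    using I by (auto simp: E_def)
  \<comment> \<open>Half of \<open>2 * n * n * E + 2\<close> is \<open>n * n * E + 1\<close>. Each
    of the \<open>n\<close> families loses at most \<open>n * E\<close> times the total squared
    norm; summed over the families this cancels the \<open>n * n * E\<close> parts and leaves the
    bound 1.\<close>
  have "\<exists>Y (l :: nat \<times> nat \<Rightarrow> _) D. lower_frame (\<mu> i) Y l (2 * n * n * E + 2) \<and>
      bessel (\<mu> i) Y l D \<and> (\<forall>k\<in>I - {i}. bessel (\<mu> k) Y l (C i))" if "i \<in> I" for i
    using C[OF that] by blast
  then obtain Y and l :: "_ \<Rightarrow> nat \<times> nat \<Rightarrow> _" and D where
    low: "\<And>i. i \<in> I \<Longrightarrow> lower_frame (\<mu> i) (Y i) (l i) (2 * n * n * E + 2)" and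
    own: "\<And>i. i \<in> I \<Longrightarrow> bessel (\<mu> i) (Y i) (l i) (D i)" and
    oth: "\<And>i k. i \<in> I \<Longrightarrow> k \<in> I - {i} \<Longrightarrow> bessel (\<mu> k) (Y i) (l i) (C i)"
    by metis
  have oth: "bessel (\<mu> k) (Y i) (l i) E" if "i \<in> I" "k \<in> I - {i}" for i k
    using oth[OF that] E(2)[OF that(1)] by (rule bessel_mono)
  define F where "F = Max (insert E (D ` I))"
  have F: "E \<le> F" "\<And>i. i \<in> I \<Longrightarrow> D i \<le> F"
    using I by (auto simp: F_def)
  have all: "bessel (\<mu> k) (Y i) (l i) F" if "i \<in> I" "k \<in> I" for i k
    using bessel_mono[OF own[OF that(1)] F(2)[OF that(1)]] bessel_mono[OF oth F(1)] that by (cases "i = k") auto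
  \<comment> \<open>The index sets are made disjoint; frequencies may still coincide, which
    \<open>admits_fourier_frame_family\<close> tolerates.\<close>
  define X where "X = Sigma I Y"
  define m where "m = (\<lambda>(i, p). l i p)"
  have "countable X"
    unfolding X_def using I by (intro countable_SIGMA) (auto simp: countable_finite)
  moreover have "lower_frame ?S X m 1"
    unfolding lower_frame_def
  proof (intro allI impI)
    fix f assume f: "square_integrable ?S f"
    note fj = square_integrable_borel_measure_sum[OF I \<mu>' f]
    have fc: "fourier_coefficient ?S f w = (\<Sum>j\<in>I. fourier_coefficient (\<mu> j) f w)" for w
      by (rule fj(3))
    have "\<exists>T. finite T \<and> T \<subseteq> Y i \<and> (2 * n * n * E + 2) * ?n i f \<le> (\<Sum>p\<in>T. ?c i f (l i p))" if "i \<in> I" for i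
      using low fj(1) that unfolding lower_frame_def by blast
    then obtain T where T: "\<And>i. i \<in> I \<Longrightarrow> finite (T i)" "\<And>i. i \<in> I \<Longrightarrow> T i \<subseteq> Y i"
      "\<And>i. i \<in> I \<Longrightarrow> (2 * n * n * E + 2) * ?n i f \<le> (\<Sum>p\<in>T i. ?c i f (l i p))"
      by metis
    have n_nonneg: "0 \<le> ?n i f" for i by simp
    have "(\<Sum>p\<in>T i. coeff_sq ?S f (l i p))
        \<ge> (n * n * E + 1) * ?n i f - n * E * (\<Sum>j\<in>I. ?n j f)" if i: "i \<in> I" for i
    proof -
      have "(n * n * E + 1) * ?n i f - n * E * (\<Sum>j\<in>I. ?n j f)
          \<le> (\<Sum>p\<in>T i. ?c i f (l i p)) / 2 - n * (\<Sum>j\<in>I - {i}. E * ?n j f)"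
      proof -
        have "n * (\<Sum>j\<in>I - {i}. E * ?n j f) \<le> n * E * (\<Sum>j\<in>I. ?n j f)"
          unfolding mult.assoc sum_distrib_left[symmetric]
          using I E by (intro mult_left_mono sum_mono2) (auto simp: n_def)
        then show ?thesis using T(3)[OF i] by (simp add: algebra_simps)
      qed
      also have "\<dots> \<le> (\<Sum>p\<in>T i. ?c i f (l i p)) / 2 - n * (\<Sum>j\<in>I - {i}. \<Sum>p\<in>T i. ?c j f (l i p))"
        using oth[OF i] T i
        by (intro diff_left_mono mult_left_mono sum_mono besselD[where X = "Y i"] fj(1)) (auto simp: n_def)
      also have "\<dots> = (\<Sum>p\<in>T i. ?c i f (l i p) / 2 - n * (\<Sum>j\<in>I - {i}. ?c j f (l i p)))"
        by (subst sum.swap) (simp add: sum_subtractf sum_divide_distrib sum_distrib_left)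
      also have "\<dots> \<le> (\<Sum>p\<in>T i. coeff_sq ?S f (l i p))"
        unfolding fc n_def by (rule sum_mono, rule norm_sum_square_ge[OF I i])
      finally show ?thesis .
    qed
    then have "(\<Sum>i\<in>I. (n * n * E + 1) * ?n i f - n * E * (\<Sum>j\<in>I. ?n j f))
        \<le> (\<Sum>i\<in>I. \<Sum>p\<in>T i. coeff_sq ?S f (l i p))"
      by (rule sum_mono)
    also have "(\<Sum>i\<in>I. (n * n * E + 1) * ?n i f - n * E * (\<Sum>j\<in>I. ?n j f)) = (\<Sum>i\<in>I. ?n i f)"
      unfolding sum_subtractf sum_distrib_left[symmetric] by (simp add: n_def algebra_simps)
    also have "(\<Sum>i\<in>I. \<Sum>p\<in>T i. coeff_sq ?S f (l i p))
        = (\<Sum>z\<in>Sigma I T. coeff_sq ?S f (m z))"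
      by (subst sum.Sigma) (use I T in \<open>auto simp: m_def case_prod_unfold\<close>)
    finally show "\<exists>T. finite T \<and> T \<subseteq> X \<and>
        1 * sqnorm ?S f \<le> (\<Sum>z\<in>T. coeff_sq ?S f (m z))"
      using I T by (intro exI[of _ "Sigma I T"]) (auto simp: fj(2) X_def)
  qed
  moreover have "bessel ?S X m (n * n * F)"
    unfolding bessel_def
  proof (intro allI impI)
    fix f T assume f: "square_integrable ?S f" and T: "finite T" "T \<subseteq> X"
    note fj = square_integrable_borel_measure_sum[OF I \<mu>' f]
    have fc: "fourier_coefficient ?S f w = (\<Sum>j\<in>I. fourier_coefficient (\<mu> j) f w)" for w
      by (rule fj(3))
    define U where "U = (\<lambda>i. {p. (i, p) \<in> T})"
    have U: "finite (U i)" for i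
      using finite_vimageI[OF T(1), of "Pair i"] by (simp add: U_def vimage_def inj_on_def)
    have TU: "T = Sigma I U" and UY: "\<And>i. i \<in> I \<Longrightarrow> U i \<subseteq> Y i"
      using T(2) by (auto simp: U_def X_def)
    have "(\<Sum>z\<in>T. coeff_sq ?S f (m z))
        = (\<Sum>i\<in>I. \<Sum>p\<in>U i. coeff_sq ?S f (l i p))"
      unfolding TU by (subst sum.Sigma) (use I U in \<open>auto simp: m_def case_prod_unfold\<close>)
    also have "\<dots> \<le> (\<Sum>i\<in>I. \<Sum>p\<in>U i. n * (\<Sum>j\<in>I. ?c j f (l i p)))"
      unfolding fc n_def by (intro sum_mono norm_sum_square_le)
    also have "\<dots> = (\<Sum>i\<in>I. n * (\<Sum>j\<in>I. \<Sum>p\<in>U i. ?c j f (l i p)))"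
      by (rule sum.cong[OF refl]) (simp only: sum_distrib_left[symmetric], subst sum.swap, rule refl)
    also have "\<dots> \<le> (\<Sum>i\<in>I. n * (\<Sum>j\<in>I. F * ?n j f))"
      using all U UY by (intro sum_mono mult_left_mono besselD[OF all] fj(1)) (auto simp: n_def)
    also have "\<dots> = n * n * F * sqnorm ?S f"
      by (simp add: fj(2) n_def sum_distrib_left mult.assoc)
    finally show "(\<Sum>z\<in>T. coeff_sq ?S f (m z)) \<le> n * n * F * sqnorm ?S f" .
  qed
  ultimately show ?thesis
    by (intro admits_fourier_frame_family[of _ X 1 m] finite_euclidean_measure_sum I \<mu>) auto
qed

section \<open>The lattice frame on a plane\<close>

definition trig_poly :: "'a::euclidean_space set \<Rightarrow> ('a \<Rightarrow> complex) set" where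
  "trig_poly \<Lambda> = {p. \<exists>T a. finite T \<and> T \<subseteq> \<Lambda> \<and> p = (\<lambda>x. \<Sum>l\<in>T. a l * character l x)}"

lemma trig_poly_character: "l \<in> \<Lambda> \<Longrightarrow> (\<lambda>x. c * character l x) \<in> trig_poly \<Lambda>"
  unfolding trig_poly_def by (auto intro!: exI[of _ "{l}"] exI[of _ "\<lambda>_. c"])

lemma trig_poly_add:
  assumes "p \<in> trig_poly \<Lambda>" "q \<in> trig_poly \<Lambda>"
  shows "(\<lambda>x. p x + q x) \<in> trig_poly \<Lambda>"
proof -
  obtain T a where T: "finite T" "T \<subseteq> \<Lambda>" "p = (\<lambda>x. \<Sum>l\<in>T. a l * character l x)"
    using assms(1) by (auto simp: trig_poly_def)
  obtain U b where U: "finite U" "U \<subseteq> \<Lambda>" "q = (\<lambda>x. \<Sum>l\<in>U. b l * character l x)"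
    using assms(2) by (auto simp: trig_poly_def)
  define c where "c = (\<lambda>l. (if l \<in> T then a l else 0) + (if l \<in> U then b l else 0))"
  have "p x + q x = (\<Sum>l\<in>T \<union> U. c l * character l x)" for x
  proof -
    have "p x = (\<Sum>l\<in>T \<union> U. (if l \<in> T then a l else 0) * character l x)"
      unfolding T(3) using T U by (intro sum.mono_neutral_cong_left) auto
    moreover have "q x = (\<Sum>l\<in>T \<union> U. (if l \<in> U then b l else 0) * character l x)"
      unfolding U(3) using T U by (intro sum.mono_neutral_cong_left) auto
    ultimately show ?thesis
      by (simp only: c_def distrib_right sum.distrib)
  qed
  then show ?thesis
    unfolding trig_poly_def using T U by (auto intro!: exI[of _ "T \<union> U"] exI[of _ c])
qed

lemma trig_poly_0: "(\<lambda>x. 0) \<in> trig_poly \<Lambda>"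
  unfolding trig_poly_def by (auto intro!: exI[of _ "{}"])

lemma trig_poly_sum:
  "(\<And>i. i \<in> I \<Longrightarrow> p i \<in> trig_poly \<Lambda>) \<Longrightarrow> (\<lambda>x. \<Sum>i\<in>I. p i x) \<in> trig_poly \<Lambda>"
  by (induction I rule: infinite_finite_induct) (auto intro: trig_poly_0 trig_poly_add)

lemma trig_poly_mult:
  assumes "p \<in> trig_poly \<Lambda>" "q \<in> trig_poly \<Lambda>" and add: "\<And>l m. l \<in> \<Lambda> \<Longrightarrow> m \<in> \<Lambda> \<Longrightarrow> l + m \<in> \<Lambda>"
  shows "(\<lambda>x. p x * q x) \<in> trig_poly \<Lambda>"
proof -
  obtain T a where T: "finite T" "T \<subseteq> \<Lambda>" "p = (\<lambda>x. \<Sum>l\<in>T. a l * character l x)"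
    using assms(1) by (auto simp: trig_poly_def)
  obtain U b where U: "finite U" "U \<subseteq> \<Lambda>" "q = (\<lambda>x. \<Sum>l\<in>U. b l * character l x)"
    using assms(2) by (auto simp: trig_poly_def)
  have "(\<lambda>x. p x * q x) = (\<lambda>x. \<Sum>l\<in>T. \<Sum>m\<in>U. (a l * b m) * character (l + m) x)"
    unfolding T(3) U(3) sum_product by (simp add: character_add ac_simps)
  also have "\<dots> \<in> trig_poly \<Lambda>"
    using T U by (intro trig_poly_sum trig_poly_character add) auto
  finally show ?thesis .
qed

lemma trig_poly_cmult:
  assumes "p \<in> trig_poly \<Lambda>"
  shows "(\<lambda>x. c * p x) \<in> trig_poly \<Lambda>"
proof -
  obtain T a where T: "finite T" "T \<subseteq> \<Lambda>" "p = (\<lambda>x. \<Sum>l\<in>T. a l * character l x)"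
    using assms(1) by (auto simp: trig_poly_def)
  then have "(\<lambda>x. c * p x) = (\<lambda>x. \<Sum>l\<in>T. (c * a l) * character l x)"
    by (simp add: sum_distrib_left mult.assoc)
  also have "\<dots> \<in> trig_poly \<Lambda>"
    using T by (intro trig_poly_sum trig_poly_character) auto
  finally show ?thesis .
qed

lemma trig_poly_measurable: "p \<in> trig_poly \<Lambda> \<Longrightarrow> p \<in> borel_measurable borel"
  by (auto simp: trig_poly_def)

section \<open>The lattice, its cell and the orthogonality of its characters\<close>

text \<open>For orthonormal \<open>B\<close> these are the frequencies in \<open>span B\<close>
  whose characters have period \<open>s\<close> along each vector of \<open>B\<close>. Integer
  functions on the whole type serve as coordinates; only their values on \<open>B\<close>
  matter.\<close>

definition dual_lattice :: "'a::euclidean_space set \<Rightarrow> real \<Rightarrow> 'a set" where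
  "dual_lattice B s = range (\<lambda>n :: 'a \<Rightarrow> int. \<Sum>b\<in>B. (real_of_int (n b) / s) *\<^sub>R b)"

lemma dual_lattice_0: "0 \<in> dual_lattice B s"
  unfolding dual_lattice_def by (rule range_eqI[of _ _ "\<lambda>_. 0"]) simp

lemma dual_lattice_add:
  assumes "l \<in> dual_lattice B s" "m \<in> dual_lattice B s"
  shows "l + m \<in> dual_lattice B s"
proof -
  obtain f g :: "'a \<Rightarrow> int" where "l = (\<Sum>b\<in>B. (real_of_int (f b) / s) *\<^sub>R b)" "m = (\<Sum>b\<in>B. (real_of_int (g b) / s) *\<^sub>R b)"
    using assms by (auto simp: dual_lattice_def)
  then have "l + m = (\<Sum>b\<in>B. (real_of_int (f b + g b) / s) *\<^sub>R b)"
    by (simp add: sum.distrib add_divide_distrib scaleR_add_left)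
  then show ?thesis unfolding dual_lattice_def by (rule range_eqI[of _ _ "\<lambda>b. f b + g b"])
qed

lemma dual_lattice_minus:
  assumes "l \<in> dual_lattice B s"
  shows "- l \<in> dual_lattice B s"
proof -
  obtain f :: "'a \<Rightarrow> int" where "l = (\<Sum>b\<in>B. (real_of_int (f b) / s) *\<^sub>R b)"
    using assms by (auto simp: dual_lattice_def)
  then have "- l = (\<Sum>b\<in>B. (real_of_int (- f b) / s) *\<^sub>R b)"
    by (simp add: sum_negf)
  then show ?thesis unfolding dual_lattice_def by (rule range_eqI[of _ _ "\<lambda>b. - f b"])
qed

lemma dual_lattice_diff:
  "l \<in> dual_lattice B s \<Longrightarrow> m \<in> dual_lattice B s \<Longrightarrow> l - m \<in> dual_lattice B s"
  using dual_lattice_add[of l B s "- m"] dual_lattice_minus[of m B s] by simp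

lemma dual_lattice_basis:
  assumes "finite B" "b \<in> B"
  shows "(1 / s) *\<^sub>R b \<in> dual_lattice B s"
proof -
  have "(\<Sum>c\<in>B. (real_of_int (if c = b then 1 else 0) / s) *\<^sub>R c) = (\<Sum>c\<in>B. if c = b then (1 / s) *\<^sub>R c else 0)"
    by (intro sum.cong) auto
  then have "(1 / s) *\<^sub>R b = (\<Sum>c\<in>B. (real_of_int (if c = b then 1 else 0) / s) *\<^sub>R c)"
    using assms by simp
  then show ?thesis unfolding dual_lattice_def by (rule range_eqI[of _ _ "\<lambda>c. if c = b then 1 else 0"])
qed

text \<open>The functions that parametrise the lattice may form an uncountable set, but their
  restrictions to the finite set \<open>B\<close> do not.\<close>

lemma countable_dual_lattice:
  assumes "finite B"
  shows "countable (dual_lattice B s)"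
proof -
  have "dual_lattice B s \<subseteq> (\<lambda>n :: 'a \<Rightarrow> int. \<Sum>b\<in>B. (real_of_int (n b) / s) *\<^sub>R b) ` (PiE B (\<lambda>_. UNIV))"
  proof
    fix l assume "l \<in> dual_lattice B s"
    then obtain n :: "'a \<Rightarrow> int" where "l = (\<Sum>b\<in>B. (real_of_int (n b) / s) *\<^sub>R b)"
      by (auto simp: dual_lattice_def)
    then have "l = (\<Sum>b\<in>B. (real_of_int (restrict n B b) / s) *\<^sub>R b)"
      by simp
    moreover have "restrict n B \<in> PiE B (\<lambda>_. UNIV)" by simp
    ultimately show "l \<in> (\<lambda>n :: 'a \<Rightarrow> int. \<Sum>b\<in>B. (real_of_int (n b) / s) *\<^sub>R b) ` (PiE B (\<lambda>_. UNIV))"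
      by (rule image_eqI)
  qed
  moreover have "countable (PiE B (\<lambda>_ :: 'a. UNIV :: int set))"
    using assms by (intro countable_PiE) auto
  ultimately show ?thesis
    by (meson countable_image countable_subset)
qed

text \<open>A fundamental domain in the plane through \<open>x0\<close> for translations by
  \<open>s\<close> along the vectors of an orthonormal \<open>B\<close>. It is half-open so that its
  translates tile the plane exactly and no boundary set has to be shown null.\<close>

definition cell :: "'a::euclidean_space set \<Rightarrow> real \<Rightarrow> 'a \<Rightarrow> 'a set" where
  "cell B s x0 = {x. x - x0 \<in> span B \<and> (\<forall>b\<in>B. - (s / 2) \<le> (x - x0) \<bullet> b \<and> (x - x0) \<bullet> b < s / 2)}"

lemma cell_borel [measurable]:
  assumes "finite B"
  shows "cell B s x0 \<in> sets borel"
proof -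
  have "closed ((\<lambda>x. x - x0) -` span B)"
    by (intro continuous_closed_vimage closed_span continuous_intros)
  then have 1: "{x. x - x0 \<in> span B} \<in> sets borel"
    by (simp add: vimage_def borel_closed)
  have 2: "{x. - (s / 2) \<le> (x - x0) \<bullet> b \<and> (x - x0) \<bullet> b < s / 2} \<in> sets borel" for b
    by measurable
  \<comment> \<open>The index 0 is added to keep the finite intersection nonempty when
    \<open>B\<close> is empty; indices outside \<open>B\<close> contribute the whole space.\<close>
  have "cell B s x0 = {x. x - x0 \<in> span B} \<inter> (\<Inter>b\<in>insert 0 B. if b \<in> B then {x. - (s / 2) \<le> (x - x0) \<bullet> b \<and> (x - x0) \<bullet> b < s / 2} else UNIV)"
    by (auto simp: cell_def)
  also have "\<dots> \<in> sets borel"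
    using assms 1 2 by (intro sets.Int sets.finite_INT) auto
  finally show ?thesis .
qed

locale lattice_cell =
  fixes B :: "'a::euclidean_space set" and s :: real and x0 :: 'a and \<nu> :: "'a measure"
  assumes finite_B: "finite B" and orthogonal_B: "pairwise orthogonal B"
    and norm_B: "\<And>b. b \<in> B \<Longrightarrow> norm b = 1" and s_pos: "0 < s"
    and sets_\<nu> [simp, measurable_cong]: "sets \<nu> = sets borel"
    and translation: "\<And>w. distr \<nu> borel (\<lambda>x. x + w) = \<nu>"
    and finite_cell: "emeasure \<nu> (cell B s x0) < \<infinity>"
begin

abbreviation "Q \<equiv> cell B s x0"
abbreviation "\<Lambda> \<equiv> dual_lattice B s"

definition \<mu> :: "'a measure" where "\<mu> = density \<nu> (\<lambda>x. ennreal (indicator Q x))"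
definition vol :: real where "vol = measure \<nu> Q"

lemma borel_\<nu>: "borel_measurable \<nu> = borel_measurable borel"
  by (rule measurable_cong_sets) auto

lemma inner_B: "b \<in> B \<Longrightarrow> c \<in> B \<Longrightarrow> b \<bullet> c = (if b = c then 1 else 0)"
  using orthogonal_B norm_B by (auto simp: pairwise_def orthogonal_def norm_eq_1)

lemma Q_borel [measurable]: "Q \<in> sets borel"
  using finite_B by (rule cell_borel)

lemma emeasure_\<mu>: "A \<in> sets borel \<Longrightarrow> emeasure \<mu> A = emeasure \<nu> (A \<inter> Q)"
proof -
  assume A: "A \<in> sets borel"
  have "emeasure \<mu> A = (\<integral>\<^sup>+x. ennreal (indicator Q x) * indicator A x \<partial>\<nu>)"
    unfolding \<mu>_def using A by (intro emeasure_density) (auto simp: borel_\<nu>)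
  also have "\<dots> = (\<integral>\<^sup>+x. indicator (A \<inter> Q) x \<partial>\<nu>)"
    by (intro nn_integral_cong) (auto simp: indicator_def)
  also have "\<dots> = emeasure \<nu> (A \<inter> Q)"
    using A by (intro nn_integral_indicator) auto
  finally show ?thesis .
qed

sublocale \<mu>: finite_euclidean_measure \<mu>
proof (rule finite_euclidean_measure.intro)
  have "space \<mu> = UNIV"
    by (simp add: \<mu>_def space_eq_UNIV)
  then show "finite_measure \<mu>"
    using finite_cell by (intro finite_measureI) (simp add: emeasure_\<mu>)
  show "finite_euclidean_measure_axioms \<mu>"
    by standard (simp add: \<mu>_def)
qed

lemma space_\<mu>: "space \<mu> = UNIV"
  by (simp add: \<mu>_def space_eq_UNIV)

lemma measure_\<mu>: "measure \<mu> (space \<mu>) = vol"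
  by (simp add: space_\<mu> measure_def emeasure_\<mu> vol_def)

lemma AE_Q: "AE x in \<mu>. x \<in> Q"
  unfolding \<mu>_def by (subst AE_density) (auto simp: borel_\<nu> indicator_def)

lemma integral_\<mu>:
  fixes f :: "'a \<Rightarrow> complex"
  assumes "f \<in> borel_measurable borel"
  shows "(\<integral>x. f x \<partial>\<mu>) = (\<integral>x. indicator Q x *\<^sub>R f x \<partial>\<nu>)"
  unfolding \<mu>_def by (rule integral_density) (use assms in \<open>auto simp: borel_\<nu>\<close>)

lemma translate_integral:
  fixes f :: "'a \<Rightarrow> complex"
  assumes "f \<in> borel_measurable borel"
  shows "(\<integral>x. f x \<partial>\<nu>) = (\<integral>x. f (x + w) \<partial>\<nu>)"
proof -
  have "(\<integral>x. f x \<partial>\<nu>) = (\<integral>x. f x \<partial>distr \<nu> borel (\<lambda>x. x + w))"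
    by (simp only: translation)
  also have "\<dots> = (\<integral>x. f (x + w) \<partial>\<nu>)"
    by (rule integral_distr) (use assms in auto)
  finally show ?thesis .
qed

lemma character_lattice:
  assumes "c \<in> B"
  shows "character (\<Sum>b\<in>B. (real_of_int (n b) / s) *\<^sub>R b) (t *\<^sub>R c) = cis (2 * pi * (n c * t / s))"
proof -
  have "(\<Sum>b\<in>B. (real_of_int (n b) / s) *\<^sub>R b) \<bullet> (t *\<^sub>R c) = (\<Sum>b\<in>B. if b = c then n b / s * t else 0)"
    unfolding inner_sum_left by (intro sum.cong refl) (use inner_B assms in auto)
  also have "\<dots> = n c * t / s"
    using assms finite_B by simp
  finally show ?thesis by (simp add: character_def)
qed

text \<open>Only translation invariance is available, no product structure. Translating by half a
  period of the character along some \<open>c\<close> reverses its sign, and on the torus this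
  translation maps the cell onto itself; so the integral equals its own negative.\<close>

lemma orthogonality:
  assumes "l \<in> \<Lambda>" "l \<noteq> 0"
  shows "transform \<mu> l = 0"
proof -
  obtain n :: "'a \<Rightarrow> int" where l: "l = (\<Sum>b\<in>B. (real_of_int (n b) / s) *\<^sub>R b)"
    using assms(1) by (auto simp: dual_lattice_def)
  obtain c where c: "c \<in> B" "n c \<noteq> 0"
    using assms(2) unfolding l by (metis (mono_tags, lifting) div_0 of_int_0 scaleR_zero_left sum.neutral)
  \<comment> \<open>Half of the period \<open>s / \<bar>n c\<bar>\<close> of the character along
    \<open>c\<close>.\<close>
  define h where "h = s / (2 * \<bar>real_of_int (n c)\<bar>)"
  have h: "0 < h" "h \<le> s / 2"
  proof -
    have "1 \<le> \<bar>real_of_int (n c)\<bar>" using c(2) by linarith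
    then show "0 < h" "h \<le> s / 2"
      using s_pos by (auto simp: h_def field_simps)
  qed
  define g where "g = (\<lambda>x. cnj (character l x))"
  have g_meas: "g \<in> borel_measurable borel" by (simp add: g_def)
  have g1: "g (x + h *\<^sub>R c) = - g x" for x
  proof -
    have "character l (h *\<^sub>R c) = cis (pi * (n c / \<bar>real_of_int (n c)\<bar>))"
      unfolding l character_lattice[OF c(1)] h_def using s_pos c(2) by (simp add: field_simps)
    also have "\<dots> = -1"
    proof (cases "0 < n c")
      case True
      then show ?thesis by simp
    next
      case False
      then have "n c / \<bar>real_of_int (n c)\<bar> = -1" using c(2) by (simp add: field_simps)
      then show ?thesis by (simp add: complex_eq_iff)
    qed
    finally show ?thesis by (simp add: g_def character_add_right)
  qed
  have g2: "g (x + (h - s) *\<^sub>R c) = - g x" for x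
  proof -
    have "character l (s *\<^sub>R c) = 1"
      unfolding l character_lattice[OF c(1)] using s_pos cis_multiple_2pi[of "n c"] by (simp add: mult.assoc)
    then have "g (y - s *\<^sub>R c) = g y" for y
      using character_add_right[of l "y - s *\<^sub>R c" "s *\<^sub>R c"] by (simp add: g_def)
    from this[of "x + h *\<^sub>R c"] show ?thesis
      by (simp add: g1 scaleR_left_diff_distrib algebra_simps)
  qed
  define I where "I = (\<lambda>A. \<integral>x. indicator A x *\<^sub>R g x \<partial>\<nu>)"
  \<comment> \<open>The torus translation is realised in two pieces: \<open>Q1\<close> stays in the
    cell when moved by \<open>h\<close> and becomes \<open>R1\<close>, while \<open>Q2\<close>
    leaves it and is brought back by one period, so it moves by \<open>h - s\<close> and becomes
    \<open>R2\<close>.\<close>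
  define Q1 where "Q1 = {x\<in>Q. (x - x0) \<bullet> c < s / 2 - h}"
  define Q2 where "Q2 = {x\<in>Q. \<not> (x - x0) \<bullet> c < s / 2 - h}"
  define R1 where "R1 = {x\<in>Q. - (s / 2) + h \<le> (x - x0) \<bullet> c}"
  define R2 where "R2 = {x\<in>Q. \<not> - (s / 2) + h \<le> (x - x0) \<bullet> c}"
  have half: "{x. (x - x0) \<bullet> c < k} \<in> sets borel" "{x. k \<le> (x - x0) \<bullet> c} \<in> sets borel" for k
    by measurable
  have meas: "Q1 \<in> sets borel" "Q2 \<in> sets borel" "R1 \<in> sets borel" "R2 \<in> sets borel"
  proof -
    have "Q1 = Q \<inter> {x. (x - x0) \<bullet> c < s / 2 - h}" "Q2 = Q - {x. (x - x0) \<bullet> c < s / 2 - h}"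
      "R1 = Q \<inter> {x. - (s / 2) + h \<le> (x - x0) \<bullet> c}" "R2 = Q - {x. - (s / 2) + h \<le> (x - x0) \<bullet> c}"
      by (auto simp: Q1_def Q2_def R1_def R2_def)
    then show "Q1 \<in> sets borel" "Q2 \<in> sets borel" "R1 \<in> sets borel" "R2 \<in> sets borel"
      using half by auto
  qed
  have integrable: "integrable \<nu> (\<lambda>x. indicator A x *\<^sub>R g x)" if "A \<in> sets borel" "A \<subseteq> Q" for A
  proof (rule Bochner_Integration.integrable_bound)
    show "integrable \<nu> (\<lambda>x. indicator Q x :: real)"
      using finite_cell by (simp add: integrable_indicator_iff)
    show "(\<lambda>x. indicator A x *\<^sub>R g x) \<in> borel_measurable \<nu>"
      using that g_meas by (simp add: borel_\<nu>)
    show "AE x in \<nu>. norm (indicator A x *\<^sub>R g x) \<le> norm (indicator Q x :: real)"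
      using that(2) by (auto simp: indicator_def g_def)
  qed
  have split: "I Q = I A + I A'" if "A \<in> sets borel" "A' \<in> sets borel" "A \<union> A' = Q" "A \<inter> A' = {}" for A A'
  proof -
    have "I Q = (\<integral>x. indicator A x *\<^sub>R g x + indicator A' x *\<^sub>R g x \<partial>\<nu>)"
      unfolding I_def that(3)[symmetric] using that(4)
      by (intro Bochner_Integration.integral_cong refl) (auto simp: indicator_def)
    also have "\<dots> = I A + I A'"
      unfolding I_def using that by (intro Bochner_Integration.integral_add integrable) auto
    finally show ?thesis .
  qed
  have span_c: "t *\<^sub>R c \<in> span B" for t
    using c(1) by (simp add: span_base span_scale)
  have plane: "x + t *\<^sub>R c - x0 \<in> span B \<longleftrightarrow> x - x0 \<in> span B" for x t
  proof -
    have "x + t *\<^sub>R c - x0 = (x - x0) + t *\<^sub>R c" by simp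
    then show ?thesis using span_c[of t] by (metis span_add_eq2)
  qed
  have coord: "(x + t *\<^sub>R c - x0) \<bullet> b = (x - x0) \<bullet> b + (if b = c then t else 0)" if "b \<in> B" for x t b
    using inner_B[OF c(1) that] by (auto simp: inner_simps)
  have shift: "I A' = - I A" if "A' \<in> sets borel" "\<And>x. x + w \<in> A' \<longleftrightarrow> x \<in> A" "\<And>x. g (x + w) = - g x" for A A' w
  proof -
    have "I A' = (\<integral>x. indicator A' (x + w) *\<^sub>R g (x + w) \<partial>\<nu>)"
      unfolding I_def by (rule translate_integral) (use that(1) g_meas in auto)
    also have "\<dots> = (\<integral>x. - (indicator A x *\<^sub>R g x) \<partial>\<nu>)"
      using that by (intro Bochner_Integration.integral_cong refl) (auto simp: indicator_def)
    finally show ?thesis by (simp add: I_def)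
  qed
  have "x + h *\<^sub>R c \<in> R1 \<longleftrightarrow> x \<in> Q1" for x
    unfolding R1_def Q1_def cell_def mem_Collect_eq plane
    using coord c(1) h by (auto split: if_splits; fastforce split: if_splits)
  then have "I R1 = - I Q1"
    by (intro shift[where w = "h *\<^sub>R c"] meas g1)
  moreover have "x + (h - s) *\<^sub>R c \<in> R2 \<longleftrightarrow> x \<in> Q2" for x
    unfolding R2_def Q2_def cell_def mem_Collect_eq plane
    using coord c(1) h by (auto split: if_splits; fastforce split: if_splits)
  then have "I R2 = - I Q2"
    by (intro shift[where w = "(h - s) *\<^sub>R c"] meas g2)
  ultimately have "I R1 + I R2 = - (I Q1 + I Q2)" by simp
  moreover have "I Q = I Q1 + I Q2" "I Q = I R1 + I R2"
    by (rule split; use meas in \<open>auto simp: Q1_def Q2_def R1_def R2_def\<close>)+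
  ultimately have "I Q = - I Q" by simp
  then have "I Q = 0" by simp
  then show ?thesis
    unfolding fourier_coefficient_character by (subst integral_\<mu>) (simp_all add: I_def g_def)
qed

text \<open>The Gram matrix is \<open>vol\<close> times the identity. The added 1 supplies the
  positive constant that Schur's test asks for even if \<open>vol\<close> is 0.\<close>

lemma bessel_\<mu>: "bessel \<mu> \<Lambda> (\<lambda>l. l) (vol + 1)"
proof (rule \<mu>.bessel_gram)
  show "0 < vol + 1" by (simp add: vol_def add_nonneg_pos)
  fix i T assume i: "i \<in> \<Lambda>" and T: "finite T" "T \<subseteq> \<Lambda>"
  have "(\<Sum>j\<in>T. cmod (transform \<mu> (i - j))) \<le> (\<Sum>j\<in>T. if j = i then vol else 0)"
  proof (rule sum_mono)
    fix j assume "j \<in> T"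
    then show "cmod (transform \<mu> (i - j)) \<le> (if j = i then vol else 0)"
      using orthogonality[of "i - j"] dual_lattice_diff[of i B s j] i T
        \<mu>.norm_fourier_coefficient_1[of "i - j"] by (auto simp: measure_\<mu>)
  qed
  also have "\<dots> \<le> vol + 1"
    using T(1) by (simp add: vol_def)
  finally show "(\<Sum>j\<in>T. cmod (transform \<mu> (i - j))) \<le> vol + 1" .
qed

end

section \<open>Density of trigonometric polynomials on the cell\<close>

context lattice_cell
begin

text \<open>The map \<open>\<theta>\<close> identifies the cell with a torus; it is injective on the half-open cell.\<close>

definition \<theta> :: "'a \<Rightarrow> 'a \<times> 'a" where
  "\<theta> x = (\<Sum>b\<in>B. cos (2 * pi * (x \<bullet> b / s)) *\<^sub>R (b, 0) + sin (2 * pi * (x \<bullet> b / s)) *\<^sub>R (0, b))"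

text \<open>The cell itself need not be compact. This compact piece lies well inside it, so closed
  subsets of it have closed images under \<theta>. The given sets are made to fit into it by taking
  \<open>s\<close> large.\<close>

abbreviation "K \<equiv> {x. x - x0 \<in> span B} \<inter> cball x0 (s / 4)"

abbreviation dist_sq :: "('a \<Rightarrow> complex) \<Rightarrow> ('a \<Rightarrow> complex) \<Rightarrow> ennreal" where
  "dist_sq f g \<equiv> \<integral>\<^sup>+x. ennreal ((cmod (f x - g x))\<^sup>2) \<partial>\<mu>"

definition trig_approx :: "('a \<Rightarrow> complex) \<Rightarrow> bool" where
  "trig_approx f \<longleftrightarrow> f \<in> borel_measurable borel \<and>
     (\<forall>e>0. \<exists>p\<in>trig_poly \<Lambda>. dist_sq f p < ennreal e)"

lemma \<theta>_inner:
  assumes "b \<in> B"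
  shows "\<theta> x \<bullet> (b, 0) = cos (2 * pi * (x \<bullet> b / s))" "\<theta> x \<bullet> (0, b) = sin (2 * pi * (x \<bullet> b / s))"
proof -
  have "\<theta> x \<bullet> (b, 0) = (\<Sum>c\<in>B. if c = b then cos (2 * pi * (x \<bullet> c / s)) else 0)"
    unfolding \<theta>_def inner_sum_left by (intro sum.cong refl) (auto simp: inner_B assms inner_simps)
  then show "\<theta> x \<bullet> (b, 0) = cos (2 * pi * (x \<bullet> b / s))"
    using assms finite_B by simp
  have "\<theta> x \<bullet> (0, b) = (\<Sum>c\<in>B. if c = b then sin (2 * pi * (x \<bullet> c / s)) else 0)"
    unfolding \<theta>_def inner_sum_left by (intro sum.cong refl) (auto simp: inner_B assms inner_simps)
  then show "\<theta> x \<bullet> (0, b) = sin (2 * pi * (x \<bullet> b / s))"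
    using assms finite_B by simp
qed

lemma span_eqI:
  assumes "x \<in> span B" "y \<in> span B" "\<And>b. b \<in> B \<Longrightarrow> x \<bullet> b = y \<bullet> b"
  shows "x = y"
proof -
  have "(\<Sum>b\<in>B. (x \<bullet> b) *\<^sub>R b) = x" "(\<Sum>b\<in>B. (y \<bullet> b) *\<^sub>R b) = y"
    using assms(1,2) norm_B orthogonal_B finite_B by (auto intro!: orthonormal_basis_expand)
  then show ?thesis using assms(3) by (metis (no_types, lifting) sum.cong)
qed

lemma \<theta>_inj: "inj_on \<theta> Q"
proof (rule inj_onI)
  fix x y assume x: "x \<in> Q" and y: "y \<in> Q" and eq: "\<theta> x = \<theta> y"
  have "x - x0 = y - x0"
  proof (rule span_eqI)
    fix b assume b: "b \<in> B"
    have "sin (2 * pi * (x \<bullet> b / s)) = sin (2 * pi * (y \<bullet> b / s)) \<and> cos (2 * pi * (x \<bullet> b / s)) = cos (2 * pi * (y \<bullet> b / s))"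
      using eq \<theta>_inner[OF b] by metis
    then obtain n :: int where "2 * pi * (x \<bullet> b / s) = 2 * pi * (y \<bullet> b / s) + 2 * pi * n"
      unfolding sin_cos_eq_iff by blast
    then have "2 * pi * (x \<bullet> b / s - y \<bullet> b / s - n) = 0"
      by (simp add: right_diff_distrib)
    then have "x \<bullet> b / s - y \<bullet> b / s = n" by simp
    moreover have "(x - x0) \<bullet> b - (y - x0) \<bullet> b = s * (x \<bullet> b / s - y \<bullet> b / s)"
      using s_pos by (simp add: inner_diff_left right_diff_distrib)
    ultimately have n: "(x - x0) \<bullet> b - (y - x0) \<bullet> b = s * n" by simp
    \<comment> \<open>Two points of a half-open interval of length \<open>s\<close> differ by less
      than \<open>s\<close>; with the closed cell, opposite faces would be identified.\<close>
    have "\<bar>(x - x0) \<bullet> b - (y - x0) \<bullet> b\<bar> < s"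
      using x y b unfolding cell_def by fastforce
    then have "\<bar>real_of_int n\<bar> < 1"
      unfolding n using s_pos by (simp add: abs_mult)
    then have "n = 0" by linarith
    then show "(x - x0) \<bullet> b = (y - x0) \<bullet> b" using n by simp
  qed (use x y in \<open>auto simp: cell_def\<close>)
  then show "x = y" by simp
qed

lemma \<theta>_continuous: "continuous_on S \<theta>"
  unfolding \<theta>_def[abs_def] by (intro continuous_intros) (use s_pos in auto)

lemma \<theta>_bounded: "norm (\<theta> x) \<le> 2 * real (card B)"
proof -
  have "norm (\<theta> x) \<le> (\<Sum>b\<in>B. 2)"
    unfolding \<theta>_def
  proof (rule sum_norm_le)
    fix b assume b: "b \<in> B"
    have "norm (cos (2 * pi * (x \<bullet> b / s)) *\<^sub>R (b, 0::'a) + sin (2 * pi * (x \<bullet> b / s)) *\<^sub>R (0::'a, b))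
        \<le> \<bar>cos (2 * pi * (x \<bullet> b / s))\<bar> + \<bar>sin (2 * pi * (x \<bullet> b / s))\<bar>"
      by (rule order_trans[OF norm_triangle_ineq]) (simp add: norm_B[OF b] norm_Pair)
    also have "\<dots> \<le> 2"
      using abs_cos_le_one[of "2 * pi * (x \<bullet> b / s)"] abs_sin_le_one[of "2 * pi * (x \<bullet> b / s)"] by linarith
    finally show "norm (cos (2 * pi * (x \<bullet> b / s)) *\<^sub>R (b, 0::'a) + sin (2 * pi * (x \<bullet> b / s)) *\<^sub>R (0::'a, b)) \<le> 2" .
  qed
  then show ?thesis by simp
qed

text \<open>The components of \<theta> are cosines and sines, which are combinations of the
  characters of \<open>(1 / s) *\<^sub>R b\<close> and its negative. Products stay in the class
  because the lattice is closed under addition.\<close>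

lemma trig_poly_polynomial:
  assumes "real_polynomial_function g"
  shows "(\<lambda>x. complex_of_real (g (\<theta> x))) \<in> trig_poly \<Lambda>"
  using assms
proof induction
  case (linear f)
  interpret f: bounded_linear f by fact
  have cos_eq: "complex_of_real (cos (2 * pi * (x \<bullet> b / s))) =
      1 / 2 * character ((1 / s) *\<^sub>R b) x + 1 / 2 * character (- ((1 / s) *\<^sub>R b)) x" for x b
    by (simp add: character_def complex_eq_iff inner_commute)
  have sin_eq: "complex_of_real (sin (2 * pi * (x \<bullet> b / s))) =
      - \<i> / 2 * character ((1 / s) *\<^sub>R b) x + \<i> / 2 * character (- ((1 / s) *\<^sub>R b)) x" for x b
    by (simp add: character_def complex_eq_iff inner_commute)
  have "(\<lambda>x. complex_of_real (f (\<theta> x))) = (\<lambda>x. \<Sum>b\<in>B.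
      complex_of_real (f (b, 0)) * complex_of_real (cos (2 * pi * (x \<bullet> b / s)))
      + complex_of_real (f (0, b)) * complex_of_real (sin (2 * pi * (x \<bullet> b / s))))"
    by (simp add: \<theta>_def f.sum f.add f.scaleR mult.commute del: scaleR_Pair)
  also have "\<dots> \<in> trig_poly \<Lambda>"
    unfolding cos_eq sin_eq
    by (intro trig_poly_sum trig_poly_add trig_poly_cmult trig_poly_character dual_lattice_minus
        dual_lattice_basis finite_B)
  finally show ?case .
next
  case (const c)
  then show ?case
    using trig_poly_character[OF dual_lattice_0, of "complex_of_real c"] by simp
next
  case (add f g)
  then show ?case using trig_poly_add by fastforce
next
  case (mult f g)
  then show ?case using trig_poly_mult[OF _ _ dual_lattice_add] by fastforce
qed

lemma trig_approx_limit:
  assumes f: "f \<in> borel_measurable borel"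
    and lim: "\<And>e. 0 < e \<Longrightarrow> \<exists>g. trig_approx g \<and> dist_sq f g < ennreal e"
  shows "trig_approx f"
  unfolding trig_approx_def
proof (intro conjI f allI impI)
  fix e :: real assume e: "0 < e"
  \<comment> \<open>The squared triangle inequality costs a factor 2 on each of the two errors, and
    \<open>2 * (e / 4) + 2 * (e / 4)\<close> is \<open>e\<close>.\<close>
  obtain g where g: "trig_approx g" "dist_sq f g < ennreal (e / 4)"
    using lim[of "e / 4"] e by auto
  obtain p where p: "p \<in> trig_poly \<Lambda>" "dist_sq g p < ennreal (e / 4)"
    using g(1) e unfolding trig_approx_def by (meson divide_pos_pos zero_less_numeral)
  have meas: "g \<in> borel_measurable borel" "p \<in> borel_measurable borel"
    using g(1) trig_poly_measurable[OF p(1)] by (auto simp: trig_approx_def)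
  have pt: "ennreal ((cmod (f x - p x))\<^sup>2) \<le> 2 * ennreal ((cmod (f x - g x))\<^sup>2) + 2 * ennreal ((cmod (g x - p x))\<^sup>2)" for x
  proof -
    have "cmod (f x - p x) \<le> cmod (f x - g x) + cmod (g x - p x)"
      using norm_triangle_ineq[of "f x - g x" "g x - p x"] by simp
    then have "(cmod (f x - p x))\<^sup>2 \<le> (cmod (f x - g x) + cmod (g x - p x))\<^sup>2"
      by (intro power_mono) auto
    also have "\<dots> \<le> 2 * (cmod (f x - g x))\<^sup>2 + 2 * (cmod (g x - p x))\<^sup>2"
      using sum_squares_bound[of "cmod (f x - g x)" "cmod (g x - p x)"] by (simp add: power2_sum)
    finally have "ennreal ((cmod (f x - p x))\<^sup>2) \<le> ennreal (2 * (cmod (f x - g x))\<^sup>2 + 2 * (cmod (g x - p x))\<^sup>2)"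
      by (rule ennreal_leI)
    then show ?thesis
      by (simp add: ennreal_plus ennreal_mult)
  qed
  have "dist_sq f p
      \<le> (\<integral>\<^sup>+x. 2 * ennreal ((cmod (f x - g x))\<^sup>2) + 2 * ennreal ((cmod (g x - p x))\<^sup>2) \<partial>\<mu>)"
    by (intro nn_integral_mono pt)
  also have "\<dots> = 2 * dist_sq f g + 2 * dist_sq g p"
    using f meas by (subst nn_integral_add) (auto simp: nn_integral_cmult \<mu>.borel_measurable_eq)
  also have "\<dots> < ennreal e"
  proof -
    have "dist_sq f g + dist_sq g p < ennreal (e / 4) + ennreal (e / 4)"
      using g(2) p(2) by (rule add_strict_mono)
    also have "\<dots> = ennreal (e / 2)"
      using e by (simp flip: ennreal_plus)
    finally have "2 * (dist_sq f g + dist_sq g p) < 2 * ennreal (e / 2)"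
      by (intro ennreal_mult_strict_left_mono) auto
    also have "2 * ennreal (e / 2) = ennreal e"
      using e by (simp add: ennreal_mult[symmetric] flip: ennreal_numeral)
    finally show ?thesis by (simp add: distrib_left)
  qed
  finally show "\<exists>p\<in>trig_poly \<Lambda>. dist_sq f p < ennreal e"
    using p(1) by blast
qed

lemma trig_approx_measurable: "trig_approx f \<Longrightarrow> f \<in> borel_measurable borel"
  by (simp add: trig_approx_def)

lemma trig_approx_trig_poly: "p \<in> trig_poly \<Lambda> \<Longrightarrow> trig_approx p"
  unfolding trig_approx_def by (auto intro!: bexI[of _ p] trig_poly_measurable)

lemma trig_approx_cmult:
  assumes "trig_approx f"
  shows "trig_approx (\<lambda>x. c * f x)"
proof (rule trig_approx_limit)
  show "(\<lambda>x. c * f x) \<in> borel_measurable borel"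
    using trig_approx_measurable[OF assms] by simp
  fix e :: real assume e: "0 < e"
  define d where "d = e / ((cmod c)\<^sup>2 + 1)"
  have d: "0 < d" using e by (simp add: d_def add_nonneg_pos)
  then obtain p where p: "p \<in> trig_poly \<Lambda>" "dist_sq f p < ennreal d"
    using assms unfolding trig_approx_def by blast
  have meas: "f \<in> borel_measurable borel" "p \<in> borel_measurable borel"
    using assms trig_poly_measurable[OF p(1)] by (auto simp: trig_approx_def)
  have "(\<integral>\<^sup>+x. ennreal ((cmod (c * f x - c * p x))\<^sup>2) \<partial>\<mu>)
      = (\<integral>\<^sup>+x. ennreal ((cmod c)\<^sup>2) * ennreal ((cmod (f x - p x))\<^sup>2) \<partial>\<mu>)"
    by (simp add: norm_mult power_mult_distrib ennreal_mult flip: right_diff_distrib)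
  also have "\<dots> = ennreal ((cmod c)\<^sup>2) * dist_sq f p"
    using meas by (intro nn_integral_cmult) (simp add: \<mu>.borel_measurable_eq)
  also have "\<dots> \<le> ennreal ((cmod c)\<^sup>2) * ennreal d"
    using p(2) by (intro mult_left_mono) auto
  also have "\<dots> = ennreal ((cmod c)\<^sup>2 * d)"
    using d by (simp add: ennreal_mult)
  also have "\<dots> < ennreal e"
  proof (rule ennreal_lessI[OF e])
    have "(cmod c)\<^sup>2 * d < ((cmod c)\<^sup>2 + 1) * d"
      using d by simp
    also have "\<dots> = e"
      using add_nonneg_pos[of "(cmod c)\<^sup>2" 1] by (simp add: d_def)
    finally show "(cmod c)\<^sup>2 * d < e" .
  qed
  finally show "\<exists>g. trig_approx g \<and> (\<integral>\<^sup>+x. ennreal ((cmod (c * f x - g x))\<^sup>2) \<partial>\<mu>) < ennreal e"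
    using trig_approx_trig_poly[OF trig_poly_cmult[OF p(1)]] by blast
qed

lemma trig_approx_add:
  assumes "trig_approx f" "trig_approx g"
  shows "trig_approx (\<lambda>x. f x + g x)"
proof (rule trig_approx_limit)
  show "(\<lambda>x. f x + g x) \<in> borel_measurable borel"
    using assms[THEN trig_approx_measurable] by simp
  have *: "trig_approx (\<lambda>x. f x + q x)" if q: "q \<in> trig_poly \<Lambda>" for q
    unfolding trig_approx_def
  proof (intro conjI allI impI)
    show "(\<lambda>x. f x + q x) \<in> borel_measurable borel"
      using trig_approx_measurable[OF assms(1)] trig_poly_measurable[OF q] by simp
    fix e :: real assume "0 < e"
    then obtain p where "p \<in> trig_poly \<Lambda>" "dist_sq f p < ennreal e"
      using assms(1) unfolding trig_approx_def by blast
    then show "\<exists>p\<in>trig_poly \<Lambda>. (\<integral>\<^sup>+x. ennreal ((cmod (f x + q x - p x))\<^sup>2) \<partial>\<mu>) < ennreal e"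
      using q by (intro bexI[of _ "\<lambda>x. p x + q x"] trig_poly_add) auto
  qed
  fix e :: real assume "0 < e"
  then obtain q where q: "q \<in> trig_poly \<Lambda>" "dist_sq g q < ennreal e"
    using assms(2) unfolding trig_approx_def by blast
  then show "\<exists>h. trig_approx h \<and> (\<integral>\<^sup>+x. ennreal ((cmod (f x + g x - h x))\<^sup>2) \<partial>\<mu>) < ennreal e"
    using *[OF q(1)] by (intro exI[of _ "\<lambda>x. f x + q x"]) auto
qed

lemma trig_approx_0: "trig_approx (\<lambda>x. 0)"
  by (rule trig_approx_trig_poly[OF trig_poly_0])

lemma trig_approx_sum:
  "(\<And>i. i \<in> I \<Longrightarrow> trig_approx (f i)) \<Longrightarrow> trig_approx (\<lambda>x. \<Sum>i\<in>I. f i x)"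
  by (induction I rule: infinite_finite_induct) (auto intro: trig_approx_0 trig_approx_add)

text \<open>The image of \<theta> lies in a compact ball, where Stone-Weierstrass gives uniform
  polynomial approximation. The finite mass of \<mu> turns a uniform error \<open>d\<close> into a
  squared distance of at most \<open>d\<^sup>2 * vol\<close>.\<close>

lemma trig_approx_continuous:
  assumes \<psi>: "continuous_on UNIV \<psi>"
  shows "trig_approx (\<lambda>x. complex_of_real (\<psi> (\<theta> x)))"
proof (rule trig_approx_limit)
  have "continuous_on UNIV (\<lambda>x. complex_of_real (\<psi> (\<theta> x)))"
    by (intro continuous_intros continuous_on_compose2[OF \<psi>] \<theta>_continuous) auto
  then show "(\<lambda>x. complex_of_real (\<psi> (\<theta> x))) \<in> borel_measurable borel"
    by (rule borel_measurable_continuous_onI)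
  fix e :: real assume e: "0 < e"
  have vol: "0 \<le> vol" by (simp add: vol_def)
  define d where "d = sqrt (e / (vol + 1))"
  have d: "0 < d" "d\<^sup>2 = e / (vol + 1)"
    using e vol by (auto simp: d_def)
  obtain g where g: "real_polynomial_function g" "\<And>y. y \<in> cball 0 (2 * real (card B)) \<Longrightarrow> \<bar>\<psi> y - g y\<bar> < d"
    using Stone_Weierstrass_real_polynomial_function[OF compact_cball continuous_on_subset[OF \<psi> subset_UNIV] d(1)]
    by metis
  have "(\<integral>\<^sup>+x. ennreal ((cmod (complex_of_real (\<psi> (\<theta> x)) - complex_of_real (g (\<theta> x))))\<^sup>2) \<partial>\<mu>) \<le> (\<integral>\<^sup>+x. ennreal (d\<^sup>2) \<partial>\<mu>)"
  proof (intro nn_integral_mono ennreal_leI power_mono)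
    fix x
    have "\<bar>\<psi> (\<theta> x) - g (\<theta> x)\<bar> < d"
      using \<theta>_bounded by (intro g(2)) simp
    then show "cmod (complex_of_real (\<psi> (\<theta> x)) - complex_of_real (g (\<theta> x))) \<le> d"
      by (simp flip: of_real_diff)
  qed auto
  also have "\<dots> = ennreal (d\<^sup>2 * vol)"
    using \<mu>.emeasure_eq_measure[of "space \<mu>"] measure_\<mu> vol by (simp add: ennreal_mult)
  also have "\<dots> < ennreal e"
    using e vol unfolding d(2) by (intro ennreal_lessI) (auto simp: field_simps)
  finally show "\<exists>h. trig_approx h \<and> (\<integral>\<^sup>+x. ennreal ((cmod (complex_of_real (\<psi> (\<theta> x)) - h x))\<^sup>2) \<partial>\<mu>) < ennreal e"
    using trig_approx_trig_poly[OF trig_poly_polynomial[OF g(1)]] by blast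
qed

lemma K_subset: "K \<subseteq> Q"
proof
  fix x assume x: "x \<in> K"
  have bd: "\<bar>(x - x0) \<bullet> b\<bar> \<le> s / 4" if "b \<in> B" for b
    using Cauchy_Schwarz_ineq2[of "x - x0" b] norm_B[OF that] x by (simp add: dist_norm norm_minus_commute)
  then have "- (s / 2) \<le> (x - x0) \<bullet> b \<and> (x - x0) \<bullet> b < s / 2" if "b \<in> B" for b
    using bd[OF that] s_pos unfolding abs_le_iff by linarith
  then show "x \<in> Q" using x by (auto simp: cell_def)
qed

lemma closed_plane: "closed {x. x - x0 \<in> span B}"
proof -
  have "closed ((\<lambda>x. x - x0) -` span B)"
    by (intro continuous_closed_vimage closed_span continuous_intros)
  then show ?thesis by (simp add: vimage_def)
qed

lemma compact_K: "compact K"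
  by (intro closed_Int_compact closed_plane compact_cball)

lemma K_borel: "K \<in> sets borel"
  using compact_K by (simp add: borel_compact)

lemma trig_approx_LIMSEQ:
  assumes f: "f \<in> borel_measurable borel" and g: "\<And>n. trig_approx (g n)"
    and lim: "(\<lambda>n. dist_sq f (g n)) \<longlonglongrightarrow> 0"
  shows "trig_approx f"
proof (rule trig_approx_limit[OF f])
  fix e :: real assume "0 < e"
  then have "\<forall>\<^sub>F n in sequentially. dist_sq f (g n) < ennreal e"
    by (intro order_tendstoD[OF lim]) auto
  then obtain n where "dist_sq f (g n) < ennreal e"
    using eventually_happens'[OF sequentially_bot] by blast
  then show "\<exists>h. trig_approx h \<and> dist_sq f h < ennreal e"
    using g by blast
qed

lemma trig_approx_dominated:
  assumes f: "f \<in> borel_measurable borel" and g: "\<And>n. trig_approx (g n)"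
    and w: "w \<in> borel_measurable borel" "(\<integral>\<^sup>+x. w x \<partial>\<mu>) < \<infinity>"
    and bound: "\<And>n x. x \<in> Q \<Longrightarrow> ennreal ((cmod (f x - g n x))\<^sup>2) \<le> w x"
    and lim: "\<And>x. x \<in> Q \<Longrightarrow> (\<lambda>n. g n x) \<longlonglongrightarrow> f x"
  shows "trig_approx f"
proof (rule trig_approx_LIMSEQ[OF f g])
  have "(\<lambda>n. dist_sq f (g n)) \<longlonglongrightarrow> (\<integral>\<^sup>+x. 0 \<partial>\<mu>)"
  proof (rule nn_integral_dominated_convergence[where w = w])
    show "(\<lambda>x. ennreal ((cmod (f x - g n x))\<^sup>2)) \<in> borel_measurable \<mu>" for n
      using f trig_approx_measurable[OF g[of n]] by (simp add: \<mu>.borel_measurable_eq)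
    show "AE x in \<mu>. ennreal ((cmod (f x - g n x))\<^sup>2) \<le> w x" for n
      using AE_Q by eventually_elim (rule bound)
    show "AE x in \<mu>. (\<lambda>n. ennreal ((cmod (f x - g n x))\<^sup>2)) \<longlonglongrightarrow> 0"
      using AE_Q
    proof eventually_elim
      case (elim x)
      have "(\<lambda>n. (cmod (f x - g n x))\<^sup>2) \<longlonglongrightarrow> (cmod (f x - f x))\<^sup>2"
        by (intro tendsto_intros lim elim)
      then have "(\<lambda>n. (cmod (f x - g n x))\<^sup>2) \<longlonglongrightarrow> 0"
        by (simp only: diff_self norm_zero power_zero_numeral)
      from tendsto_ennrealI[OF this] show ?case
        by (simp only: ennreal_0)
    qed
  qed (use w in \<open>auto simp: \<mu>.borel_measurable_eq\<close>)
  then show "(\<lambda>n. dist_sq f (g n)) \<longlonglongrightarrow> 0" by simp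
qed

lemma nn_integral_1_finite: "(\<integral>\<^sup>+x. 1 \<partial>\<mu>) < \<infinity>"
proof -
  have "(\<integral>\<^sup>+x. 1 \<partial>\<mu>) = emeasure \<mu> (space \<mu>)" by simp
  also have "\<dots> < \<infinity>"
    using \<mu>.emeasure_finite[of "space \<mu>"] by (metis infinity_ennreal_def top.not_eq_extremum)
  finally show ?thesis .
qed

text \<open>Continuous functions of \<theta> that equal 1 on the closed image of
  \<open>A \<inter> K\<close> and fall off with slope \<open>n\<close> converge to the indicator on
  the cell. Injectivity of \<theta> ensures that points of the cell outside
  \<open>A \<inter> K\<close> are at positive distance from that image.\<close>

lemma trig_approx_closed:
  assumes "closed A"
  shows "trig_approx (indicator (A \<inter> K))"
proof (cases "A \<inter> K = {}")
  case True
  then show ?thesis using trig_approx_0 by (simp add: indicator_def[abs_def])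
next
  case False
  define C where "C = A \<inter> K"
  have C: "compact C" "C \<noteq> {}" "C \<subseteq> Q"
    using assms compact_K False K_subset by (auto simp: C_def closed_Int_compact)
  have \<theta>C: "closed (\<theta> ` C)" "\<theta> ` C \<noteq> {}"
    using C compact_continuous_image[OF \<theta>_continuous C(1)] by (auto intro: compact_imp_closed)
  define \<psi> where "\<psi> = (\<lambda>n y. max 0 (1 - real n * infdist y (\<theta> ` C)))"
  have "trig_approx (indicator C)"
  proof (rule trig_approx_dominated)
    show "indicator C \<in> borel_measurable borel"
      using C(1) by (intro borel_measurable_indicator borel_compact)
    show "trig_approx (\<lambda>x. complex_of_real (\<psi> n (\<theta> x)))" for n
      unfolding \<psi>_def by (intro trig_approx_continuous continuous_intros)
    show "(\<integral>\<^sup>+x. 1 \<partial>\<mu>) < \<infinity>"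
      by (rule nn_integral_1_finite)
    fix x assume x: "x \<in> Q"
    show "ennreal ((cmod (indicator C x - complex_of_real (\<psi> n (\<theta> x))))\<^sup>2) \<le> 1" for n
    proof -
      have "0 \<le> \<psi> n (\<theta> x)" "\<psi> n (\<theta> x) \<le> 1"
        by (auto simp: \<psi>_def infdist_nonneg)
      then have "\<bar>indicator C x - \<psi> n (\<theta> x)\<bar> \<le> 1"
        by (auto simp: indicator_def)
      moreover have "indicator C x - complex_of_real (\<psi> n (\<theta> x)) = complex_of_real (indicator C x - \<psi> n (\<theta> x))"
        by (simp add: indicator_def)
      ultimately have "cmod (indicator C x - complex_of_real (\<psi> n (\<theta> x))) \<le> 1"
        by (simp only: norm_of_real)
      then have "(cmod (indicator C x - complex_of_real (\<psi> n (\<theta> x))))\<^sup>2 \<le> 1"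
        by (intro power_le_one norm_ge_zero)
      from ennreal_leI[OF this] show ?thesis by (simp only: ennreal_1)
    qed
    show "(\<lambda>n. complex_of_real (\<psi> n (\<theta> x))) \<longlonglongrightarrow> indicator C x"
    proof (cases "x \<in> C")
      case True
      then have "infdist (\<theta> x) (\<theta> ` C) = 0" by simp
      then show ?thesis using True by (simp add: \<psi>_def)
    next
      case False
      have "\<theta> x \<notin> \<theta> ` C"
        using inj_on_image_mem_iff[OF \<theta>_inj x C(3)] False by blast
      then have pos: "0 < infdist (\<theta> x) (\<theta> ` C)"
        using in_closed_iff_infdist_zero[OF \<theta>C, of "\<theta> x"] infdist_nonneg[of "\<theta> x" "\<theta> ` C"]
        by (simp add: order_less_le)
      obtain N where N: "1 < real N * infdist (\<theta> x) (\<theta> ` C)"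
        using reals_Archimedean3[OF pos] by blast
      have "\<psi> n (\<theta> x) = 0" if "N \<le> n" for n
      proof -
        have "real N * infdist (\<theta> x) (\<theta> ` C) \<le> real n * infdist (\<theta> x) (\<theta> ` C)"
          using that pos by (intro mult_right_mono) auto
        then show ?thesis using N by (simp add: \<psi>_def)
      qed
      then have "\<forall>\<^sub>F n in sequentially. complex_of_real (\<psi> n (\<theta> x)) = indicator C x"
        unfolding eventually_sequentially using False by auto
      then show ?thesis by (rule tendsto_eventually)
    qed
  qed simp
  then show ?thesis by (simp add: C_def)
qed

text \<open>Dynkin's argument: the closed sets generate the Borel sets and are stable under
  intersection, and the sets \<open>A\<close> with the asserted property are stable under
  complements and countable disjoint unions.\<close>

lemma trig_approx_indicator:
  assumes "A \<in> sets borel"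
  shows "trig_approx (indicator (A \<inter> K))"
proof -
  have "Int_stable (Collect closed :: 'a set set)"
    by (auto simp: Int_stable_def)
  moreover have "Collect closed \<subseteq> Pow (UNIV :: 'a set)"
    by simp
  moreover have "A \<in> sigma_sets UNIV (Collect closed)"
    using assms by (simp add: borel_eq_closed)
  ultimately show ?thesis
  proof (induction rule: sigma_sets_induct_disjoint)
    case (basic A)
    then show ?case using trig_approx_closed by simp
  next
    case empty
    then show ?case using trig_approx_0 by (simp add: indicator_def[abs_def])
  next
    case (compl A)
    have "trig_approx (\<lambda>x. indicator (UNIV \<inter> K) x + (- 1) * indicator (A \<inter> K) x)"
      by (intro trig_approx_add trig_approx_cmult trig_approx_closed compl) auto
    moreover have "(\<lambda>x. indicator (UNIV \<inter> K) x + (- 1) * indicator (A \<inter> K) x) = (indicator ((UNIV - A) \<inter> K) :: 'a \<Rightarrow> complex)"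
      by (auto simp: indicator_def fun_eq_iff)
    ultimately show ?case by simp
  next
    case (union A)
    have "range A \<subseteq> sets borel"
      using union(2) by (simp add: borel_eq_closed)
    show ?case
    proof (rule trig_approx_dominated)
      show "indicator ((\<Union>i. A i) \<inter> K) \<in> borel_measurable borel"
        using \<open>range A \<subseteq> sets borel\<close> K_borel by (intro borel_measurable_indicator) auto
      show "trig_approx (\<lambda>x. \<Sum>i<n. indicator (A i \<inter> K) x)" for n
        by (intro trig_approx_sum union(3))
      show "(\<integral>\<^sup>+x. 1 \<partial>\<mu>) < \<infinity>"
        by (rule nn_integral_1_finite)
      have part: "(\<Sum>i<n. indicator (A i \<inter> K) x) = (indicator ((\<Union>i<n. A i) \<inter> K) x :: complex)" for n x
      proof -
        have "(\<Sum>i<n. indicator (A i \<inter> K) x) = (indicator (\<Union>i<n. A i \<inter> K) x :: complex)"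
          using union(1) by (intro indicator_UN_disjoint[symmetric]) (auto simp: disjoint_family_on_def)
        moreover have "(\<Union>i<n. A i \<inter> K) = (\<Union>i<n. A i) \<inter> K" by auto
        ultimately show ?thesis by simp
      qed
      fix x
      show "ennreal ((cmod (indicator ((\<Union>i. A i) \<inter> K) x - (\<Sum>i<n. indicator (A i \<inter> K) x)))\<^sup>2) \<le> 1" for n
        unfolding part by (auto simp: indicator_def)
      show "(\<lambda>n. \<Sum>i<n. indicator (A i \<inter> K) x) \<longlonglongrightarrow> (indicator ((\<Union>i. A i) \<inter> K) x :: complex)"
      proof (cases "x \<in> (\<Union>i. A i) \<inter> K")
        case True
        then obtain i where i: "x \<in> A i" "x \<in> K" by auto
        have "\<forall>\<^sub>F n in sequentially. (\<Sum>i<n. indicator (A i \<inter> K) x) = (indicator ((\<Union>i. A i) \<inter> K) x :: complex)"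
          unfolding part using eventually_gt_at_top[of i] by eventually_elim (use i in \<open>auto simp: indicator_def\<close>)
        then show ?thesis by (rule tendsto_eventually)
      next
        case False
        then have "(\<Sum>i<n. indicator (A i \<inter> K) x) = (indicator ((\<Union>i. A i) \<inter> K) x :: complex)" for n
          unfolding part by (auto simp: indicator_def)
        then show ?thesis by simp
      qed
    qed simp
  qed
qed

text \<open>Approximation by simple functions with \<open>cmod (S n x) \<le> 2 * cmod (f x)\<close>.
  This bound makes them vanish off \<open>K\<close> as well, so that only indicators of subsets of
  \<open>K\<close> occur, and it bounds the squared error by
  \<open>9 * (cmod (f x))\<^sup>2\<close>.\<close>

lemma trig_approx_square_integrable:
  assumes f: "square_integrable \<mu> f" and K: "\<And>x. x \<notin> K \<Longrightarrow> f x = 0"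
  shows "trig_approx f"
proof -
  have fm: "f \<in> borel_measurable borel"
    using f by (simp add: square_integrable_def \<mu>.borel_measurable_eq)
  obtain S where S: "\<And>n. simple_function borel (S n)" "\<And>x. (\<lambda>n. S n x) \<longlonglongrightarrow> f x" "\<And>n x. cmod (S n x) \<le> 2 * cmod (f x)"
    using borel_measurable_implies_sequence_metric[OF fm, of 0] by auto
  show ?thesis
  proof (rule trig_approx_dominated[OF fm])
    show "trig_approx (S n)" for n
    proof -
      have S_eq: "S n x = (\<Sum>y\<in>S n ` UNIV. y * indicator (S n -` {y} \<inter> K) x)" for x
      proof (cases "x \<in> K")
        case True
        have "(\<Sum>y\<in>S n ` UNIV. y * indicator (S n -` {y} \<inter> K) x) = (\<Sum>y\<in>S n ` UNIV. if y = S n x then y else 0)"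
          using True by (intro sum.cong) (auto simp: indicator_def)
        also have "\<dots> = S n x"
          using simple_functionD(1)[OF S(1)[of n]] by simp
        finally show ?thesis by simp
      next
        case False
        then have "S n x = 0" using S(3)[of n x] K by simp
        moreover have "indicator (S n -` {y} \<inter> K) x = (0 :: complex)" for y
          by (rule indicator_simps(2)) (use False in blast)
        ultimately show ?thesis by (simp only: mult_zero_right sum.neutral_const)
      qed
      have "trig_approx (\<lambda>x. \<Sum>y\<in>S n ` UNIV. y * indicator (S n -` {y} \<inter> K) x)"
        using simple_functionD(2)[OF S(1)[of n]]
        by (intro trig_approx_sum trig_approx_cmult trig_approx_indicator) auto
      then show ?thesis by (simp only: S_eq[symmetric])
    qed
    show "(\<lambda>x. ennreal (9 * (cmod (f x))\<^sup>2)) \<in> borel_measurable borel"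
      using fm by simp
    have "integrable \<mu> (\<lambda>x. 9 * (cmod (f x))\<^sup>2)"
      using f by (simp add: square_integrable_def)
    then show "(\<integral>\<^sup>+x. ennreal (9 * (cmod (f x))\<^sup>2) \<partial>\<mu>) < \<infinity>"
      by (simp only: integrable_iff_bounded real_norm_def abs_mult abs_numeral abs_power2)
    fix x
    show "(\<lambda>n. S n x) \<longlonglongrightarrow> f x" by (rule S(2))
    show "ennreal ((cmod (f x - S n x))\<^sup>2) \<le> ennreal (9 * (cmod (f x))\<^sup>2)" for n
    proof (rule ennreal_leI)
      have "cmod (f x - S n x) \<le> 3 * cmod (f x)"
        using norm_triangle_ineq4[of "f x" "S n x"] S(3)[of n x] by simp
      then have "(cmod (f x - S n x))\<^sup>2 \<le> (3 * cmod (f x))\<^sup>2"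
        by (intro power_mono) auto
      then show "(cmod (f x - S n x))\<^sup>2 \<le> 9 * (cmod (f x))\<^sup>2"
        by (simp add: power_mult_distrib)
    qed
  qed
qed

section \<open>Frame bounds on the cell and for measures with a density\<close>

text \<open>A quantitative substitute for Parseval's identity. Orthogonality implies that any
  trigonometric polynomial with frequencies in \<open>T\<close> is at squared distance at least
  \<open>n - (\<Sum>i\<in>T. (cmod (c i))\<^sup>2) / vol\<close> from \<open>f\<close>; one at
  squared distance at most \<open>n / 2\<close> therefore forces large coefficients on
  \<open>T\<close>.\<close>

lemma lower_bound:
  assumes f: "square_integrable \<mu> f" and K: "\<And>x. x \<notin> K \<Longrightarrow> f x = 0" and vol: "0 < vol"
  shows "\<exists>T. finite T \<and> T \<subseteq> \<Lambda> \<and>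
    vol / 2 * sqnorm \<mu> f \<le> (\<Sum>l\<in>T. coeff_sq \<mu> f l)"
proof -
  define n where "n = sqnorm \<mu> f"
  show ?thesis
  proof (cases "n = 0")
    case True
    then show ?thesis by (intro exI[of _ "{}"]) (simp add: n_def)
  next
    case False
    then have n: "0 < n" by (simp add: n_def order_less_le)
    have fm: "f \<in> borel_measurable borel"
      using f by (simp add: square_integrable_def \<mu>.borel_measurable_eq)
    obtain p where p: "p \<in> trig_poly \<Lambda>" "dist_sq f p < ennreal (n / 2)"
      using trig_approx_square_integrable[OF f K] n unfolding trig_approx_def by (meson half_gt_zero)
    have err: "(\<integral>x. (cmod (f x - p x))\<^sup>2 \<partial>\<mu>) \<le> n / 2"
    proof -
      have "(\<integral>x. (cmod (f x - p x))\<^sup>2 \<partial>\<mu>) = enn2real (dist_sq f p)"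
        using fm trig_poly_measurable[OF p(1)]
        by (intro integral_eq_nn_integral) (auto simp: \<mu>.borel_measurable_eq)
      also have "\<dots> \<le> enn2real (ennreal (n / 2))"
        using p(2) by (intro enn2real_mono) (auto simp: less_imp_le)
      finally show ?thesis using n by simp
    qed
    obtain T a where T: "finite T" "T \<subseteq> \<Lambda>" "p = (\<lambda>x. \<Sum>l\<in>T. a l * character l x)"
      using p(1) by (auto simp: trig_poly_def)
    define c where "c = fourier_coefficient \<mu> f"
    have G: "transform \<mu> (j - i) = (if i = j then complex_of_real vol else 0)" if "i \<in> T" "j \<in> T" for i j
      using that T(2) orthogonality[of "j - i"] dual_lattice_diff[of j B s i] \<mu>.fourier_coefficient_1
      by (auto simp: measure_\<mu>)
    have "complex_of_real (\<integral>x. (cmod (f x - p x))\<^sup>2 \<partial>\<mu>) = complex_of_real n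
        - (\<Sum>i\<in>T. cnj (a i) * c i) - (\<Sum>i\<in>T. a i * cnj (c i))
        + (\<Sum>i\<in>T. \<Sum>j\<in>T. a i * cnj (a j) * transform \<mu> (j - i))"
      unfolding T(3) n_def c_def by (rule \<mu>.integral_norm_diff_trig[OF f T(1)])
    also have "(\<Sum>i\<in>T. \<Sum>j\<in>T. a i * cnj (a j) * transform \<mu> (j - i))
        = (\<Sum>i\<in>T. \<Sum>j\<in>T. if j = i then a i * cnj (a i) * vol else 0)"
      by (intro sum.cong refl) (auto simp: G)
    also have "\<dots> = (\<Sum>i\<in>T. a i * cnj (a i) * vol)"
      using T(1) by simp
    also have "complex_of_real n - (\<Sum>i\<in>T. cnj (a i) * c i) - (\<Sum>i\<in>T. a i * cnj (c i)) + (\<Sum>i\<in>T. a i * cnj (a i) * vol)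
        = complex_of_real n + (\<Sum>i\<in>T. a i * cnj (a i) * vol - cnj (a i) * c i - a i * cnj (c i))"
      by (simp add: sum_subtractf)
    \<comment> \<open>Completing the square: the optimal coefficient is
      \<open>c i / vol\<close>.\<close>
    also have "(\<Sum>i\<in>T. a i * cnj (a i) * vol - cnj (a i) * c i - a i * cnj (c i))
        = (\<Sum>i\<in>T. vol * ((a i - c i / vol) * cnj (a i - c i / vol)) - c i * cnj (c i) / vol)"
      using vol by (intro sum.cong refl) (simp add: field_simps)
    also have "\<dots> = complex_of_real (\<Sum>i\<in>T. vol * (cmod (a i - c i / vol))\<^sup>2 - (cmod (c i))\<^sup>2 / vol)"
      by (simp only: of_real_sum of_real_diff of_real_mult of_real_divide of_real_norm_square)
    finally have "complex_of_real (\<integral>x. (cmod (f x - p x))\<^sup>2 \<partial>\<mu>)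
        = complex_of_real (n + (\<Sum>i\<in>T. vol * (cmod (a i - c i / vol))\<^sup>2 - (cmod (c i))\<^sup>2 / vol))"
      by (simp only: of_real_add)
    then have "(\<integral>x. (cmod (f x - p x))\<^sup>2 \<partial>\<mu>) = n + (\<Sum>i\<in>T. vol * (cmod (a i - c i / vol))\<^sup>2 - (cmod (c i))\<^sup>2 / vol)"
      by (simp only: of_real_eq_iff)
    also have "\<dots> \<ge> n - (\<Sum>i\<in>T. (cmod (c i))\<^sup>2) / vol"
      using vol by (simp add: sum_subtractf sum_divide_distrib sum_nonneg)
    finally have "n - (\<Sum>i\<in>T. (cmod (c i))\<^sup>2) / vol \<le> n / 2"
      using err by simp
    then have "vol / 2 * n \<le> (\<Sum>i\<in>T. (cmod (c i))\<^sup>2)"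
      using vol by (simp add: field_simps)
    then show ?thesis
      using T(1,2) by (auto simp: n_def c_def)
  qed
qed

text \<open>Multiplication by \<open>m\<close> carries functions for \<rho> to functions for \<mu>
  on the cell with the same Fourier coefficients. It changes the squared norm by replacing the
  weight \<open>m\<close> with \<open>m * m\<close>, and \<open>m \<le> m * m \<le> N * m\<close>
  because \<open>m\<close> is 0 or lies between 1 and \<open>N\<close>.\<close>

lemma density_frame:
  fixes m :: "'a \<Rightarrow> real" and N :: real
  assumes m: "m \<in> borel_measurable borel" "\<And>x. x \<notin> K \<Longrightarrow> m x = 0" "\<And>x. m x = 0 \<or> 1 \<le> m x" "\<And>x. m x \<le> N"
    and vol: "0 < vol"
  defines "\<rho> \<equiv> density \<nu> (\<lambda>x. ennreal (m x))"
  shows "finite_euclidean_measure \<rho>" "lower_frame \<rho> \<Lambda> (\<lambda>l. l) (vol / 2)" "bessel \<rho> \<Lambda> (\<lambda>l. l) ((vol + 1) * N)"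
proof -
  have m_nonneg: "0 \<le> m x" for x using m(3)[of x] by auto
  have mQ: "m x = indicator Q x * m x" for x
  proof (cases "x \<in> Q")
    case False
    then have "x \<notin> K" using K_subset by blast
    then have "m x = 0" by (rule m(2))
    then show ?thesis by simp
  qed simp
  have [simp]: "sets \<rho> = sets borel" by (simp add: \<rho>_def)
  have borel_\<rho>: "borel_measurable \<rho> = borel_measurable borel"
    by (rule measurable_cong_sets) auto
  have "emeasure \<rho> (space \<rho>) \<noteq> \<infinity>"
  proof -
    have "emeasure \<rho> (space \<rho>) = (\<integral>\<^sup>+x. ennreal (m x) * indicator (space \<rho>) x \<partial>\<nu>)"
      using m(1) by (subst (1) \<rho>_def, intro emeasure_density) (auto simp: borel_\<nu> space_eq_UNIV)
    also have "\<dots> \<le> (\<integral>\<^sup>+x. ennreal \<bar>N\<bar> * indicator Q x \<partial>\<nu>)"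
    proof (rule nn_integral_mono)
      fix x
      have "m x \<le> \<bar>N\<bar>" using m(4)[of x] by linarith
      then show "ennreal (m x) * indicator (space \<rho>) x \<le> ennreal \<bar>N\<bar> * indicator Q x"
        using mQ[of x] by (auto simp: indicator_def intro: ennreal_leI)
    qed
    also have "\<dots> = ennreal \<bar>N\<bar> * emeasure \<nu> Q"
      by (intro nn_integral_cmult_indicator) auto
    also have "\<dots> < \<infinity>"
      using finite_cell by (simp add: ennreal_mult_less_top)
    finally show ?thesis by simp
  qed
  then show fin: "finite_euclidean_measure \<rho>"
    by (intro finite_euclidean_measure.intro finite_measureI finite_euclidean_measure_axioms.intro) auto
  have int_\<rho>1: "integrable \<rho> h \<longleftrightarrow> integrable \<nu> (\<lambda>x. m x *\<^sub>R h x)"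
    if "h \<in> borel_measurable borel" for h :: "'a \<Rightarrow> real"
    unfolding \<rho>_def using that m(1) m_nonneg by (intro integrable_density) (simp_all add: borel_\<nu>)
  have int_\<rho>2: "(\<integral>x. h x \<partial>\<rho>) = (\<integral>x. m x *\<^sub>R h x \<partial>\<nu>)"
    if "h \<in> borel_measurable borel" for h :: "'a \<Rightarrow> real"
    unfolding \<rho>_def using that m(1) m_nonneg by (intro integral_density) (simp_all add: borel_\<nu>)
  have int_\<rho>': "(\<integral>x. h x \<partial>\<rho>) = (\<integral>x. m x *\<^sub>R h x \<partial>\<nu>)"
    if "h \<in> borel_measurable borel" for h :: "'a \<Rightarrow> complex"
    unfolding \<rho>_def using that m(1) m_nonneg by (intro integral_density) (simp_all add: borel_\<nu>)
  have int_\<mu>1: "integrable \<mu> h \<longleftrightarrow> integrable \<nu> (\<lambda>x. indicator Q x *\<^sub>R h x)"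
    if "h \<in> borel_measurable borel" for h :: "'a \<Rightarrow> real"
    unfolding \<mu>_def using that by (intro integrable_density) (simp_all add: borel_\<nu>)
  have int_\<mu>2: "(\<integral>x. h x \<partial>\<mu>) = (\<integral>x. indicator Q x *\<^sub>R h x \<partial>\<nu>)"
    if "h \<in> borel_measurable borel" for h :: "'a \<Rightarrow> real"
    unfolding \<mu>_def using that by (intro integral_density) (simp_all add: borel_\<nu>)
  define g where "g = (\<lambda>f x. f x * complex_of_real (m x))"
  have main: "square_integrable \<mu> (g f)" "\<And>l. fourier_coefficient \<rho> f l = fourier_coefficient \<mu> (g f) l"
    "sqnorm \<rho> f \<le> sqnorm \<mu> (g f)"
    "sqnorm \<mu> (g f) \<le> N * sqnorm \<rho> f"
    if f: "square_integrable \<rho> f" for f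
  proof -
    have fm: "f \<in> borel_measurable borel"
      using f by (simp add: square_integrable_def borel_\<rho>)
    have gm: "g f \<in> borel_measurable borel"
      using fm m(1) by (simp add: g_def)
    have f2: "(\<lambda>x. (cmod (f x))\<^sup>2) \<in> borel_measurable borel" and g2: "(\<lambda>x. (cmod (g f x))\<^sup>2) \<in> borel_measurable borel"
      using fm gm by simp_all
    have if2: "integrable \<nu> (\<lambda>x. m x *\<^sub>R (cmod (f x))\<^sup>2)"
      using f int_\<rho>1[OF f2] by (simp add: square_integrable_def)
    have pt: "m x *\<^sub>R (cmod (f x))\<^sup>2 \<le> indicator Q x *\<^sub>R (cmod (g f x))\<^sup>2"
      "indicator Q x *\<^sub>R (cmod (g f x))\<^sup>2 \<le> N * (m x *\<^sub>R (cmod (f x))\<^sup>2)" for x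
    proof -
      have eq: "indicator Q x *\<^sub>R (cmod (g f x))\<^sup>2 = m x * m x * (cmod (f x))\<^sup>2"
        using mQ[of x] by (auto simp: g_def norm_mult power_mult_distrib power2_eq_square indicator_def)
      have "m x \<le> m x * m x"
        using m(3)[of x] by (auto simp: mult_le_cancel_left1)
      then show "m x *\<^sub>R (cmod (f x))\<^sup>2 \<le> indicator Q x *\<^sub>R (cmod (g f x))\<^sup>2"
        unfolding eq by (simp add: mult_right_mono)
      have "m x * m x \<le> N * m x"
        using m(4)[of x] m_nonneg[of x] by (intro mult_right_mono)
      then have "m x * m x * (cmod (f x))\<^sup>2 \<le> N * m x * (cmod (f x))\<^sup>2"
        by (rule mult_right_mono) simp
      then show "indicator Q x *\<^sub>R (cmod (g f x))\<^sup>2 \<le> N * (m x *\<^sub>R (cmod (f x))\<^sup>2)"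
        unfolding eq by (simp add: mult.assoc)
    qed
    have ig2: "integrable \<nu> (\<lambda>x. indicator Q x *\<^sub>R (cmod (g f x))\<^sup>2)"
    proof (rule Bochner_Integration.integrable_bound)
      show "integrable \<nu> (\<lambda>x. N * (m x *\<^sub>R (cmod (f x))\<^sup>2))"
        using if2 by simp
      show "(\<lambda>x. indicator Q x *\<^sub>R (cmod (g f x))\<^sup>2) \<in> borel_measurable \<nu>"
        using g2 by (simp add: borel_\<nu>)
      have "norm (indicator Q x *\<^sub>R (cmod (g f x))\<^sup>2) \<le> norm (N * (m x *\<^sub>R (cmod (f x))\<^sup>2))" for x
        using pt(2)[of x] by (simp only: real_norm_def) (simp add: abs_of_nonneg)
      then show "AE x in \<nu>. norm (indicator Q x *\<^sub>R (cmod (g f x))\<^sup>2) \<le> norm (N * (m x *\<^sub>R (cmod (f x))\<^sup>2))"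
        by simp
    qed
    show "square_integrable \<mu> (g f)"
      using ig2 gm int_\<mu>1[OF g2] by (simp add: square_integrable_def \<mu>.borel_measurable_eq)
    show "fourier_coefficient \<rho> f l = fourier_coefficient \<mu> (g f) l" for l
    proof -
      have "fourier_coefficient \<rho> f l = (\<integral>x. m x *\<^sub>R (f x * cnj (character l x)) \<partial>\<nu>)"
        unfolding fourier_coefficient_character by (rule int_\<rho>') (use fm in simp)
      also have "\<dots> = (\<integral>x. indicator Q x *\<^sub>R (g f x * cnj (character l x)) \<partial>\<nu>)"
      proof (intro Bochner_Integration.integral_cong refl)
        fix x show "m x *\<^sub>R (f x * cnj (character l x)) = indicator Q x *\<^sub>R (g f x * cnj (character l x))"
          using mQ[of x] by (auto simp: g_def indicator_def scaleR_conv_of_real)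
      qed
      also have "\<dots> = fourier_coefficient \<mu> (g f) l"
        unfolding fourier_coefficient_character by (rule integral_\<mu>[symmetric]) (use gm in simp)
      finally show ?thesis .
    qed
    show "sqnorm \<rho> f \<le> sqnorm \<mu> (g f)"
      unfolding int_\<rho>2[OF f2] int_\<mu>2[OF g2] by (intro integral_mono if2 ig2 pt)
    have "sqnorm \<mu> (g f) \<le> (\<integral>x. N * (m x *\<^sub>R (cmod (f x))\<^sup>2) \<partial>\<nu>)"
      unfolding int_\<mu>2[OF g2] by (intro integral_mono ig2 pt integrable_mult_right if2)
    then show "sqnorm \<mu> (g f) \<le> N * sqnorm \<rho> f"
      unfolding int_\<rho>2[OF f2] by simp
  qed
  show "lower_frame \<rho> \<Lambda> (\<lambda>l. l) (vol / 2)"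
    unfolding lower_frame_def
  proof (intro allI impI)
    fix f assume f: "square_integrable \<rho> f"
    have "\<And>x. x \<notin> K \<Longrightarrow> g f x = 0" by (simp add: g_def m(2))
    from lower_bound[OF main(1)[OF f] this vol] obtain T where T: "finite T" "T \<subseteq> \<Lambda>"
      "vol / 2 * sqnorm \<mu> (g f) \<le> (\<Sum>l\<in>T. coeff_sq \<mu> (g f) l)"
      by blast
    have "vol / 2 * sqnorm \<rho> f \<le> vol / 2 * sqnorm \<mu> (g f)"
      using vol main(3)[OF f] by (intro mult_left_mono) auto
    then show "\<exists>T. finite T \<and> T \<subseteq> \<Lambda> \<and> vol / 2 * sqnorm \<rho> f \<le> (\<Sum>l\<in>T. coeff_sq \<rho> f l)"
      using T by (intro exI[of _ T]) (auto simp: main(2)[OF f])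
  qed
  show "bessel \<rho> \<Lambda> (\<lambda>l. l) ((vol + 1) * N)"
    unfolding bessel_def
  proof (intro allI impI)
    fix f T assume f: "square_integrable \<rho> f" and T: "finite T" "T \<subseteq> \<Lambda>"
    have "(\<Sum>l\<in>T. coeff_sq \<rho> f l) \<le> (vol + 1) * sqnorm \<mu> (g f)"
      unfolding main(2)[OF f] by (rule besselD[OF bessel_\<mu> main(1)[OF f] T])
    also have "\<dots> \<le> (vol + 1) * (N * sqnorm \<rho> f)"
      using vol main(4)[OF f] by (intro mult_left_mono) auto
    finally show "(\<Sum>l\<in>T. coeff_sq \<rho> f l) \<le> (vol + 1) * N * sqnorm \<rho> f"
      by (simp add: mult.assoc)
  qed
qed

end

section \<open>Hausdorff measure on planes\<close>

lemma diameter_translation_le: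
  fixes S :: "'a::real_normed_vector set"
  assumes "bounded S"
  shows "diameter ((\<lambda>x. x + w) ` S) \<le> diameter S"
proof (rule diameter_le)
  show "(\<lambda>x. x + w) ` S \<noteq> {} \<or> 0 \<le> diameter S"
    using diameter_ge_0[OF assms] by simp
  fix x y assume "x \<in> (\<lambda>x. x + w) ` S" "y \<in> (\<lambda>x. x + w) ` S"
  then show "norm (x - y) \<le> diameter S"
    using diameter_bounded_bound[OF assms] by (auto simp: dist_norm)
qed

lemma hausdorff_weight_le:
  assumes "bounded U" "diameter U \<le> d"
  shows "hausdorff_weight k U \<le> ennreal (unit_ball_vol (real k) * (d / 2) ^ k)"
  using assms diameter_ge_0[OF assms(1)]
  by (auto simp: hausdorff_weight_def intro!: ennreal_leI mult_left_mono power_mono)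

lemma hausdorff_premeasure_translation_le:
  fixes A :: "'a::real_normed_vector set"
  shows "hausdorff_premeasure k \<delta> ((\<lambda>x. x + w) ` A) \<le> hausdorff_premeasure k \<delta> A"
  unfolding hausdorff_premeasure_def[of k \<delta> A]
proof (rule INF_greatest)
  fix U assume U: "U \<in> fine_covers \<delta> A"
  define V where "V = (\<lambda>i. (\<lambda>x. x + w) ` U i)"
  have bd: "bounded (U i)" "diameter (U i) \<le> \<delta>" for i
    using U by (auto simp: fine_covers_def)
  have bd': "bounded (V i)" "diameter (V i) \<le> diameter (U i)" for i
    unfolding V_def using bounded_translation[OF bd(1)[of i], of w] diameter_translation_le[OF bd(1)[of i], of w]
    by (simp_all only: add.commute[of _ w])
  have "V \<in> fine_covers \<delta> ((\<lambda>x. x + w) ` A)"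
    using U bd bd' order_trans[OF bd'(2) bd(2)] unfolding fine_covers_def V_def by blast
  then have "hausdorff_premeasure k \<delta> ((\<lambda>x. x + w) ` A) \<le> (\<Sum>i. hausdorff_weight k (V i))"
    unfolding hausdorff_premeasure_def by (rule INF_lower)
  also have "\<dots> \<le> (\<Sum>i. hausdorff_weight k (U i))"
  proof (rule suminf_le)
    fix i
    show "hausdorff_weight k (V i) \<le> hausdorff_weight k (U i)"
    proof (cases "U i = {}")
      case True
      then show ?thesis by (simp add: V_def)
    next
      case False
      then show ?thesis
        using hausdorff_weight_le[OF bd'(1)[of i] bd'(2)[of i], of k]
        by (simp add: hausdorff_weight_def[of k "U i"])
    qed
  qed auto
  finally show "hausdorff_premeasure k \<delta> ((\<lambda>x. x + w) ` A) \<le> (\<Sum>i. hausdorff_weight k (U i))" .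
qed

lemma hausdorff_outer_translation:
  fixes A :: "'a::real_normed_vector set"
  shows "hausdorff_outer k ((\<lambda>x. x + w) ` A) = hausdorff_outer k A"
proof (rule antisym)
  have le: "hausdorff_outer k ((\<lambda>x. x + w) ` A) \<le> hausdorff_outer k A" for w and A :: "'a set"
    unfolding hausdorff_outer_def by (intro SUP_mono' hausdorff_premeasure_translation_le)
  show "hausdorff_outer k ((\<lambda>x. x + w) ` A) \<le> hausdorff_outer k A" by (rule le)
  show "hausdorff_outer k A \<le> hausdorff_outer k ((\<lambda>x. x + w) ` A)"
    \<comment> \<open>The translation by \<open>- w\<close> undoes the one by \<open>w\<close>, so
      the inequality for all vectors gives equality.\<close>
    using le[of "- w" "(\<lambda>x. x + w) ` A"] by (simp add: image_image)
qed

lemma distr_hausdorff_measure_translation: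
  fixes w :: "'a::real_normed_vector"
  shows "distr (hausdorff_measure k) borel (\<lambda>x. x + w) = hausdorff_measure k"
proof (rule measure_eqI)
  fix A :: "'a set" assume "A \<in> sets (distr (hausdorff_measure k) borel (\<lambda>x. x + w))"
  then have A: "A \<in> sets borel" by simp
  have eq: "(\<lambda>x. x + w) -` A = (\<lambda>x. x + (- w)) ` A"
    by (force simp: image_iff)
  have meas: "(\<lambda>x. x + w) \<in> borel_measurable borel"
    by (intro borel_measurable_continuous_onI continuous_intros)
  have "(\<lambda>x. x + w) -` A \<in> sets borel"
    using measurable_sets[OF meas A] by simp
  moreover have "(\<lambda>x. x + w) \<in> measurable (hausdorff_measure k) borel"
    using meas by (simp add: measurable_def)
  ultimately have "emeasure (distr (hausdorff_measure k) borel (\<lambda>x. x + w)) A = hausdorff_outer k ((\<lambda>x. x + w) -` A)"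
    using emeasure_distr[OF _ A, of "\<lambda>x. x + w" "hausdorff_measure k"] by (simp add: emeasure_hausdorff_measure)
  also have "\<dots> = hausdorff_outer k A"
    unfolding eq by (rule hausdorff_outer_translation)
  finally show "emeasure (distr (hausdorff_measure k) borel (\<lambda>x. x + w)) A = emeasure (hausdorff_measure k) A"
    using A by (simp add: emeasure_hausdorff_measure)
qed simp

section \<open>Finiteness on bounded subsets of a plane\<close>

lemma hausdorff_premeasure_finite_cover:
  assumes "finite I" and cover: "A \<subseteq> (\<Union>i\<in>I. U i)" and "0 \<le> \<delta>"
    and U: "\<And>i. i \<in> I \<Longrightarrow> bounded (U i) \<and> diameter (U i) \<le> \<delta>"
  shows "hausdorff_premeasure k \<delta> A \<le> (\<Sum>i\<in>I. hausdorff_weight k (U i))"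
proof -
  obtain h where h: "bij_betw h {..<card I} I"
    using ex_bij_betw_nat_finite[OF \<open>finite I\<close>] by (auto simp: atLeast0LessThan)
  \<comment> \<open>Covers are sequences, so the finite one is padded with empty sets, which have
    weight 0 in every dimension, including dimension 0.\<close>
  define V where "V = (\<lambda>n. if n < card I then U (h n) else {})"
  have hI: "h n \<in> I" if "n < card I" for n
    using h that by (auto simp: bij_betw_def)
  have "V \<in> fine_covers \<delta> A"
    unfolding fine_covers_def mem_Collect_eq
  proof (intro conjI allI)
    show "bounded (V n)" "diameter (V n) \<le> \<delta>" for n
      using U hI \<open>0 \<le> \<delta>\<close> by (auto simp: V_def)
    show "A \<subseteq> (\<Union>n. V n)"
    proof
      fix x assume "x \<in> A"
      then obtain i where i: "i \<in> I" "x \<in> U i" using cover by auto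
      then obtain n where "n < card I" "h n = i"
        using bij_betw_imp_surj_on[OF h] by (metis imageE lessThan_iff)
      then show "x \<in> (\<Union>n. V n)" using i by (auto simp: V_def)
    qed
  qed
  then have "hausdorff_premeasure k \<delta> A \<le> (\<Sum>n. hausdorff_weight k (V n))"
    unfolding hausdorff_premeasure_def by (rule INF_lower)
  also have "\<dots> = (\<Sum>n<card I. hausdorff_weight k (V n))"
    by (rule suminf_finite) (auto simp: V_def)
  also have "\<dots> = (\<Sum>n<card I. hausdorff_weight k (U (h n)))"
    by (simp add: V_def)
  also have "\<dots> = (\<Sum>i\<in>I. hausdorff_weight k (U i))"
    by (rule sum.reindex_bij_betw[OF h])
  finally show ?thesis .
qed

lemma orthonormal_norm_le:
  fixes B :: "'a::euclidean_space set"
  assumes "finite B" "pairwise orthogonal B" "\<And>b. b \<in> B \<Longrightarrow> norm b = 1" "x \<in> span B"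
  shows "norm x \<le> (\<Sum>b\<in>B. \<bar>x \<bullet> b\<bar>)"
proof -
  have "x = (\<Sum>b\<in>B. (x \<bullet> b) *\<^sub>R b)"
    using assms by (intro orthonormal_basis_expand[symmetric]) auto
  then have "norm x = norm (\<Sum>b\<in>B. (x \<bullet> b) *\<^sub>R b)" by simp
  also have "\<dots> \<le> (\<Sum>b\<in>B. \<bar>x \<bullet> b\<bar>)"
    by (rule sum_norm_le) (simp add: assms(3))
  finally show ?thesis .
qed

text \<open>A grid of \<open>m ^ k\<close> cubes of side \<open>2 * \<rho> / m\<close> covers the
  set. Each piece has diameter at most \<open>k\<close> times the side, so its weight scales like
  \<open>m\<close> to the power \<open>- k\<close>, and the total is the constant \<open>C\<close>
  for every mesh.\<close>

lemma hausdorff_outer_bounded_plane: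
  fixes B :: "'a::euclidean_space set"
  assumes B: "finite B" "pairwise orthogonal B" "\<And>b. b \<in> B \<Longrightarrow> norm b = 1"
    and A: "bounded A" "A \<subseteq> {x. x - x0 \<in> span B}"
  shows "hausdorff_outer (card B) A < \<infinity>"
proof -
  define k where "k = card B"
  obtain \<rho> where \<rho>: "0 < \<rho>" "A \<subseteq> ball x0 \<rho>"
    using A(1) bounded_subset_ballD by blast
  define C where "C = unit_ball_vol (real k) * (real k * \<rho>) ^ k"
  have "hausdorff_premeasure k \<delta> A \<le> ennreal C" if \<delta>: "0 < \<delta>" for \<delta>
  proof -
    \<comment> \<open>The mesh is refined until the pieces have diameter at most \<delta>; passing
      to the successor makes \<open>m\<close> positive.\<close>
    obtain m0 :: nat where m0: "real k * (2 * \<rho>) < real m0 * \<delta>"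
      using reals_Archimedean3[OF \<delta>] by blast
    define m where "m = Suc m0"
    have m: "0 < real m" "real k * (2 * \<rho> / real m) \<le> \<delta>"
    proof -
      show "0 < real m" by (simp add: m_def)
      have "real k * (2 * \<rho>) \<le> real m * \<delta>" using m0 \<delta> by (simp add: m_def distrib_right)
      then show "real k * (2 * \<rho> / real m) \<le> \<delta>"
        using \<open>0 < real m\<close> by (simp add: field_simps)
    qed
    define h where "h = 2 * \<rho> / real m"
    have h: "0 < h" using \<rho> m by (simp add: h_def)
    define U where "U = (\<lambda>j :: 'a \<Rightarrow> nat. {x \<in> A. \<forall>b\<in>B. real (j b) * h \<le> (x - x0) \<bullet> b + \<rho> \<and> (x - x0) \<bullet> b + \<rho> \<le> (real (j b) + 1) * h})"
    define I where "I = PiE B (\<lambda>_. {..<m})"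
    have I: "finite I" "card I = m ^ k"
      using B(1) by (simp_all add: I_def finite_PiE card_PiE k_def)
    have bd: "bounded (U j)" for j
      using A(1) by (rule bounded_subset) (auto simp: U_def)
    have diam: "diameter (U j) \<le> real k * h" for j
    proof (rule diameter_le)
      show "U j \<noteq> {} \<or> 0 \<le> real k * h" using h by simp
      fix x y assume x: "x \<in> U j" and y: "y \<in> U j"
      have "x - y \<in> span B"
        using x y A(2) span_diff[of "x - x0" B "y - x0"] by (auto simp: U_def)
      then have "norm (x - y) \<le> (\<Sum>b\<in>B. \<bar>(x - y) \<bullet> b\<bar>)"
        by (intro orthonormal_norm_le) (use B in auto)
      also have "\<dots> \<le> (\<Sum>b\<in>B. h)"
      proof (rule sum_mono)
        fix b assume b: "b \<in> B"
        have "(x - y) \<bullet> b = ((x - x0) \<bullet> b + \<rho>) - ((y - x0) \<bullet> b + \<rho>)"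
          by (simp add: inner_diff_left)
        moreover have "real (j b) * h \<le> (x - x0) \<bullet> b + \<rho>" "(x - x0) \<bullet> b + \<rho> \<le> real (j b) * h + h"
          "real (j b) * h \<le> (y - x0) \<bullet> b + \<rho>" "(y - x0) \<bullet> b + \<rho> \<le> real (j b) * h + h"
          using x y b by (auto simp: U_def distrib_right)
        ultimately show "\<bar>(x - y) \<bullet> b\<bar> \<le> h" by linarith
      qed
      finally show "norm (x - y) \<le> real k * h" by (simp add: k_def)
    qed
    have cover: "A \<subseteq> (\<Union>j\<in>I. U j)"
    proof
      fix x assume x: "x \<in> A"
      define t where "t = (\<lambda>b. ((x - x0) \<bullet> b + \<rho>) / h)"
      have t: "0 \<le> t b" "t b < real m" if b: "b \<in> B" for b
      proof -
        have "\<bar>(x - x0) \<bullet> b\<bar> \<le> norm (x - x0)"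
          using Cauchy_Schwarz_ineq2[of "x - x0" b] B(3)[OF b] by simp
        also have "\<dots> < \<rho>"
          using x \<rho>(2) by (auto simp: dist_norm norm_minus_commute)
        finally have "0 \<le> (x - x0) \<bullet> b + \<rho>" "(x - x0) \<bullet> b + \<rho> < 2 * \<rho>" by linarith+
        moreover have "real m * h = 2 * \<rho>" using m(1) by (simp add: h_def)
        ultimately show "0 \<le> t b" "t b < real m"
          using h by (simp_all add: t_def pos_divide_less_eq)
      qed
      define j where "j = restrict (\<lambda>b. nat \<lfloor>t b\<rfloor>) B"
      have "j \<in> I"
        unfolding I_def
      proof (rule PiE_I)
        fix b assume b: "b \<in> B"
        then show "j b \<in> {..<m}"
          using t[OF b] by (simp add: j_def nat_less_iff floor_less_iff)
      qed (simp add: j_def)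
      moreover have "x \<in> U j"
        unfolding U_def
      proof (intro CollectI conjI ballI x)
        fix b assume b: "b \<in> B"
        have "real (j b) = of_int \<lfloor>t b\<rfloor>"
          using t[OF b] b by (simp add: j_def)
        then have "real (j b) \<le> t b" "t b \<le> real (j b) + 1"
          by linarith+
        then show "real (j b) * h \<le> (x - x0) \<bullet> b + \<rho>" "(x - x0) \<bullet> b + \<rho> \<le> (real (j b) + 1) * h"
          using h by (auto simp: t_def pos_le_divide_eq pos_divide_le_eq)
      qed
      ultimately show "x \<in> (\<Union>j\<in>I. U j)" by blast
    qed
    have "hausdorff_premeasure k \<delta> A \<le> (\<Sum>j\<in>I. hausdorff_weight k (U j))"
      using I bd order_trans[OF diam m(2)[folded h_def]] cover \<delta>
      by (intro hausdorff_premeasure_finite_cover) auto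
    also have "\<dots> \<le> (\<Sum>j\<in>I. ennreal (unit_ball_vol (real k) * (real k * h / 2) ^ k))"
      by (intro sum_mono hausdorff_weight_le bd diam)
    also have "\<dots> = ennreal (\<Sum>j\<in>I. unit_ball_vol (real k) * (real k * h / 2) ^ k)"
      by (rule sum_ennreal) (use h in auto)
    also have "(\<Sum>j\<in>I. unit_ball_vol (real k) * (real k * h / 2) ^ k) = C"
    proof -
      have "real k * h / 2 = real k * \<rho> / real m" by (simp add: h_def)
      then have "real m ^ k * (real k * h / 2) ^ k = (real k * \<rho>) ^ k"
        using m(1) by (simp flip: power_mult_distrib)
      then show ?thesis by (simp add: I C_def)
    qed
    finally show ?thesis .
  qed
  then have "hausdorff_outer k A \<le> ennreal C"
    unfolding hausdorff_outer_def by (intro SUP_least) auto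
  then show ?thesis
    unfolding k_def by (rule le_less_trans) simp
qed

section \<open>Hyperplane sections are null\<close>

lemma ennreal_multiples_bounded:
  assumes "\<And>n::nat. of_nat n * a \<le> M" "M < (\<infinity> :: ennreal)"
  shows "a = 0"
proof (rule ccontr)
  assume "a \<noteq> 0"
  have "a \<le> M" using assms(1)[of 1] by simp
  then have "a < top" using assms(2) by (auto intro: le_less_trans)
  then obtain r where r: "a = ennreal r" "0 \<le> r" by (metis ennreal_cases less_irrefl)
  then have "0 < r" using \<open>a \<noteq> 0\<close> by (metis ennreal_0 order_le_less)
  obtain R where R: "M = ennreal R" "0 \<le> R" using assms(2) by (metis ennreal_cases infinity_ennreal_def less_irrefl)
  obtain n :: nat where "R < real n * r"
    using reals_Archimedean3[OF \<open>0 < r\<close>] by blast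
  moreover have "ennreal (real n * r) \<le> ennreal R"
    using assms(1)[of n] by (simp add: r R ennreal_mult ennreal_of_nat_eq_real_of_nat)
  ultimately show False using R(2) by (simp add: ennreal_le_iff)
qed

text \<open>Translates of the section along the plane are disjoint and lie in a set of finite measure.\<close>

lemma hausdorff_measure_hyperplane_section:
  fixes B :: "'a::euclidean_space set"
  assumes B: "finite B" "pairwise orthogonal B" "\<And>b. b \<in> B \<Longrightarrow> norm b = 1"
    and F: "bounded F" "F \<in> sets borel" "F \<subseteq> {x. x - x0 \<in> span B}"
    and w: "w \<in> span B" "v \<bullet> w \<noteq> 0"
  shows "emeasure (hausdorff_measure (card B)) (F \<inter> {x. v \<bullet> x = c}) = 0"
proof -
  let ?H = "hausdorff_measure (card B) :: 'a measure"
  define A where "A = F \<inter> {x. v \<bullet> x = c}"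
  have A: "A \<in> sets borel"
    using F(2) by (auto simp: A_def intro!: sets.Int borel_closed closed_hyperplane)
  obtain \<rho> where \<rho>: "F \<subseteq> ball x0 \<rho>"
    using F(1) bounded_subset_ballD by blast
  define S where "S = {x. x - x0 \<in> span B} \<inter> ball x0 (\<rho> + norm w)"
  \<comment> \<open>The factors \<open>1 / real (Suc j)\<close> are distinct, so the translates lie
    in different hyperplanes; they are at most 1, so all translates stay in one bounded part of the
    plane.\<close>
  define T where "T = (\<lambda>j :: nat. (\<lambda>x. x + (1 / real (Suc j)) *\<^sub>R w) ` A)"
  have TS: "T j \<subseteq> S" for j
  proof
    fix y assume "y \<in> T j"
    then obtain x where x: "x \<in> A" "y = x + (1 / real (Suc j)) *\<^sub>R w" by (auto simp: T_def)
    have "x - x0 + (1 / real (Suc j)) *\<^sub>R w \<in> span B"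
      using x(1) F(3) w(1) by (intro span_add span_scale) (auto simp: A_def)
    moreover have yx: "y - x0 = x - x0 + (1 / real (Suc j)) *\<^sub>R w" using x(2) by simp
    ultimately have "y - x0 \<in> span B" by (simp only:)
    moreover have "norm (y - x0) < \<rho> + norm w"
    proof -
      have "norm (y - x0) \<le> norm (x - x0) + norm ((1 / real (Suc j)) *\<^sub>R w)"
        unfolding yx by (rule norm_triangle_ineq)
      moreover have "norm (x - x0) < \<rho>"
        using x(1) \<rho> by (auto simp: A_def dist_norm norm_minus_commute)
      moreover have "norm ((1 / real (Suc j)) *\<^sub>R w) \<le> norm w"
        by (simp add: divide_simps distrib_left)
      ultimately show ?thesis by linarith
    qed
    ultimately show "y \<in> S"
      by (simp add: S_def dist_norm norm_minus_commute)
  qed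
  have T_meas: "T j \<in> sets borel" for j
  proof -
    have "T j = (\<lambda>x. x - (1 / real (Suc j)) *\<^sub>R w) -` A"
      by (force simp: T_def image_iff)
    moreover have "(\<lambda>x. x - (1 / real (Suc j)) *\<^sub>R w) \<in> borel_measurable borel" by measurable
    ultimately show ?thesis using measurable_sets[OF _ A] by (metis Int_UNIV_right space_borel)
  qed
  have T_eq: "emeasure ?H (T j) = emeasure ?H A" for j
    using A T_meas[of j] by (simp add: emeasure_hausdorff_measure) (simp add: T_def hausdorff_outer_translation)
  have disj: "disjoint_family T"
    unfolding disjoint_family_on_def
  proof (intro ballI impI)
    fix i j :: nat assume "i \<noteq> j"
    have T_inner: "v \<bullet> y = c + (1 / real (Suc i)) * (v \<bullet> w)" if "y \<in> T i" for y i
      using that by (auto simp: T_def A_def inner_simps)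
    have False if "y \<in> T i" "y \<in> T j" for y
    proof -
      have "(1 / real (Suc i)) * (v \<bullet> w) = (1 / real (Suc j)) * (v \<bullet> w)"
        using T_inner[OF that(1)] T_inner[OF that(2)] by linarith
      then have "1 / real (Suc i) = 1 / real (Suc j)" using w(2) mult_right_cancel by blast
      then show False using \<open>i \<noteq> j\<close> by (simp add: field_simps)
    qed
    then show "T i \<inter> T j = {}" by blast
  qed
  have "of_nat n * emeasure ?H A \<le> hausdorff_outer (card B) S" for n
  proof -
    have "of_nat n * emeasure ?H A = (\<Sum>j<n. emeasure ?H (T j))"
      by (simp add: T_eq)
    also have "\<dots> = emeasure ?H (\<Union>j<n. T j)"
      using T_meas disj by (intro sum_emeasure) (auto simp: disjoint_family_on_def)
    also have "\<dots> = hausdorff_outer (card B) (\<Union>j<n. T j)"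
      using T_meas by (intro emeasure_hausdorff_measure) auto
    also have "\<dots> \<le> hausdorff_outer (card B) S"
      using TS by (intro hausdorff_outer_mono) auto
    finally show ?thesis .
  qed
  moreover have "hausdorff_outer (card B) S < \<infinity>"
    by (rule hausdorff_outer_bounded_plane[where ?x0.0 = x0])
       (use B in \<open>auto simp: S_def intro: bounded_subset[OF bounded_ball]\<close>)
  ultimately show ?thesis
    unfolding A_def[symmetric] by (rule ennreal_multiples_bounded)
qed

section \<open>Vectors in general position\<close>

text \<open>In the induction \<open>v\<close> is perturbed along the component \<open>z\<close> of
  \<open>u0\<close> orthogonal to \<open>W\<close>, which is nonzero since \<open>u0\<close> is not
  in \<open>W\<close>. Each of the finitely many vectors excludes at most one value of the parameter
  \<open>e\<close>.\<close>

lemma exists_generic_vector: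
  fixes W :: "'a::euclidean_space set"
  assumes W: "subspace W" and "finite U" "U \<inter> W = {}"
  shows "\<exists>v. (\<forall>w\<in>W. v \<bullet> w = 0) \<and> (\<forall>u\<in>U. v \<bullet> u \<noteq> 0)"
  using assms(2,3)
proof (induction U rule: finite_induct)
  case empty
  then show ?case by (intro exI[of _ 0]) simp
next
  case (insert u0 U)
  then obtain v where v: "\<And>w. w \<in> W \<Longrightarrow> v \<bullet> w = 0" "\<And>u. u \<in> U \<Longrightarrow> v \<bullet> u \<noteq> 0"
    by auto
  obtain y z where yz: "y \<in> span W" "\<And>w. w \<in> span W \<Longrightarrow> orthogonal z w" "u0 = y + z"
    using orthogonal_subspace_decomp_exists[of W u0] by blast
  have span: "span W = W" using W by (simp add: span_eq_iff)
  have "z \<noteq> 0" using yz insert.prems by (auto simp: span)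
  moreover have "z \<bullet> y = 0" using yz by (simp add: orthogonal_def)
  ultimately have zu: "z \<bullet> u0 \<noteq> 0" by (simp add: yz(3) inner_add_right)
  define bad where "bad = (\<Union>u\<in>insert u0 U. {e. (v + e *\<^sub>R z) \<bullet> u = 0})"
  have "finite {e. (v + e *\<^sub>R z) \<bullet> u = 0}" if "u \<in> insert u0 U" for u
  proof (cases "z \<bullet> u = 0")
    case True
    then have "v \<bullet> u \<noteq> 0" using that zu v(2) by auto
    then show ?thesis using True by (simp add: inner_add_left)
  next
    case False
    then have "{e. (v + e *\<^sub>R z) \<bullet> u = 0} \<subseteq> {- (v \<bullet> u) / (z \<bullet> u)}"
      by (auto simp: inner_add_left field_simps)
    then show ?thesis by (rule finite_subset) simp
  qed
  then have "finite bad" using insert.hyps(1) by (auto simp: bad_def)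
  then obtain e where "e \<notin> bad"
    using ex_new_if_finite[OF infinite_UNIV_char_0] by blast
  then have "(v + e *\<^sub>R z) \<bullet> u \<noteq> 0" if "u \<in> insert u0 U" for u
    using that by (auto simp: bad_def)
  moreover have "(v + e *\<^sub>R z) \<bullet> w = 0" if "w \<in> W" for w
    using v(1)[OF that] yz(2)[of w] that by (simp add: span inner_add_left orthogonal_def)
  ultimately show ?case by blast
qed

text \<open>Rescaling brings all the nonzero products strictly between -1 and 1, where 0 is the only
  integer.\<close>

lemma exists_generic_vector_nonint:
  fixes W :: "'a::euclidean_space set"
  assumes W: "subspace W" and U: "finite U" "U \<inter> W = {}"
  shows "\<exists>v. (\<forall>w\<in>W. v \<bullet> w = 0) \<and> (\<forall>u\<in>U. v \<bullet> u \<notin> \<int>)"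
proof -
  obtain v where v: "\<And>w. w \<in> W \<Longrightarrow> v \<bullet> w = 0" "\<And>u. u \<in> U \<Longrightarrow> v \<bullet> u \<noteq> 0"
    using exists_generic_vector[OF W U] by blast
  define m where "m = 1 + (\<Sum>u\<in>U. \<bar>v \<bullet> u\<bar>)"
  have m: "0 < m" by (simp add: m_def add_pos_nonneg sum_nonneg)
  have "((1 / m) *\<^sub>R v) \<bullet> u \<notin> \<int>" if u: "u \<in> U" for u
  proof
    assume "((1 / m) *\<^sub>R v) \<bullet> u \<in> \<int>"
    then obtain i :: int where i: "v \<bullet> u / m = of_int i"
      by (auto simp: Ints_def)
    have "\<bar>v \<bullet> u\<bar> \<le> (\<Sum>u\<in>U. \<bar>v \<bullet> u\<bar>)"
      by (rule member_le_sum) (use u U in auto)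
    then have "\<bar>v \<bullet> u / m\<bar> < 1"
      using m by (simp add: m_def)
    then have "i = 0" unfolding i by linarith
    then show False using i v(2)[OF u] m by simp
  qed
  then show ?thesis
    using v(1) by (intro exI[of _ "(1 / m) *\<^sub>R v"]) auto
qed

section \<open>Families of planes\<close>

lemma lower_frame_reindex:
  assumes "lower_frame M (h ` Y) l A" "inj_on h Y"
  shows "lower_frame M Y (\<lambda>i. l (h i)) A"
  unfolding lower_frame_def
proof (intro allI impI)
  fix f assume f: "square_integrable M f"
  obtain T where T: "finite T" "T \<subseteq> h ` Y"
    "A * sqnorm M f \<le> (\<Sum>i\<in>T. coeff_sq M f (l i))"
    by (rule lower_frameE[OF assms(1) f])
  obtain S where S: "S \<subseteq> Y" "inj_on h S" "T = h ` S"
    using T(2) unfolding subset_image_inj by blast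
  then have "finite S" using T(1) finite_imageD by blast
  then show "\<exists>S. finite S \<and> S \<subseteq> Y \<and>
      A * sqnorm M f \<le> (\<Sum>i\<in>S. coeff_sq M f (l (h i)))"
    using S T(3) by (intro exI[of _ S]) (simp add: sum.reindex)
qed

text \<open>
  \<open>D p\<close> is the direction of the plane \<open>p\<close> and \<open>a p\<close> a base point; \<open>m p\<close> counts the sets of the
  family that lie in \<open>p\<close>, and \<open>S p\<close> is their union.
\<close>

lemma admits_fourier_frame_planes:
  fixes \<P> :: "'a::euclidean_space set set" and m :: "'a set \<Rightarrow> 'a \<Rightarrow> real"
    and D :: "'a set \<Rightarrow> 'a set" and a :: "'a set \<Rightarrow> 'a" and S :: "'a set \<Rightarrow> 'a set"
  defines "\<rho> \<equiv> \<lambda>p. density (hausdorff_measure (dim (D p))) (\<lambda>x. ennreal (m p x))"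
  assumes \<P>: "finite \<P>"
    and plane: "\<And>p. p \<in> \<P> \<Longrightarrow> subspace (D p) \<and> p = {x. x - a p \<in> D p}"
    and S: "\<And>p. p \<in> \<P> \<Longrightarrow> bounded (S p) \<and> S p \<in> sets borel \<and> S p \<subseteq> p \<and>
      emeasure (hausdorff_measure (dim (D p))) (S p) > 0"
    and m: "\<And>p. p \<in> \<P> \<Longrightarrow> m p \<in> borel_measurable borel"
      "\<And>p x. p \<in> \<P> \<Longrightarrow> x \<notin> S p \<Longrightarrow> m p x = 0"
      "\<And>p x. p \<in> \<P> \<Longrightarrow> m p x = 0 \<or> 1 \<le> m p x" "\<And>p x. p \<in> \<P> \<Longrightarrow> m p x \<le> N"
    and incomparable: "\<And>p q. p \<in> \<P> \<Longrightarrow> q \<in> \<P> \<Longrightarrow> D p \<noteq> D q \<Longrightarrow> \<not> D q \<subseteq> D p"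
  shows "admits_fourier_frame (borel_measure_sum (\<lambda>W. borel_measure_sum \<rho> {p \<in> \<P>. D p = W}) (D ` \<P>))"
proof -
  let ?H = "\<lambda>p. hausdorff_measure (dim (D p)) :: 'a measure"
  define J where "J = (\<lambda>W. {p \<in> \<P>. D p = W})"
  have J: "finite (J W)" "J W \<subseteq> \<P>" for W
    using \<P> by (auto simp: J_def)
  have "\<exists>B. finite B \<and> pairwise orthogonal B \<and> (\<forall>b\<in>B. norm b = 1) \<and> card B = dim W \<and> span B = W"
    if W: "subspace W" for W :: "'a set"
  proof -
    obtain B where "pairwise orthogonal B" "\<And>b. b \<in> B \<Longrightarrow> norm b = 1" "independent B" "card B = dim W" "span B = W"
      using orthonormal_basis_subspace[OF W] by blast
    then show ?thesis using independent_imp_finite by blast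
  qed
  then obtain B where B': "\<And>W :: 'a set. subspace W \<Longrightarrow> finite (B W) \<and> pairwise orthogonal (B W) \<and>
      (\<forall>b\<in>B W. norm b = 1) \<and> card (B W) = dim W \<and> span (B W) = W"
    by metis
  have B: "finite (B W)" "pairwise orthogonal (B W)" "\<And>b. b \<in> B W \<Longrightarrow> norm b = 1"
    "card (B W) = dim W" "span (B W) = W" if "subspace W" for W :: "'a set"
    using B'[OF that] by simp_all
  have "\<exists>r>0. S p \<subseteq> cball (a p) (r / 4)" if p: "p \<in> \<P>" for p
  proof -
    obtain e where "0 < e" "S p \<subseteq> ball (a p) e"
      using S[OF p] bounded_subset_ballD by blast
    then show ?thesis
      by (intro exI[of _ "4 * e"]) auto
  qed
  then obtain r where r: "\<And>p. p \<in> \<P> \<Longrightarrow> 0 < r p" "\<And>p. p \<in> \<P> \<Longrightarrow> S p \<subseteq> cball (a p) (r p / 4)"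
    by metis
  \<comment> \<open>One scale for all planes, so that parallel planes share the lattice
    \<open>\<Lambda> W\<close> and can be combined by \<open>parallel_frame\<close>. It is large
    enough for each \<open>S p\<close> to fit into the ball of radius \<open>s / 4\<close>.\<close>
  define s where "s = 1 + (\<Sum>p\<in>\<P>. r p)"
  have "0 \<le> (\<Sum>p\<in>\<P>. r p)"
    using r(1) by (intro sum_nonneg) (simp add: less_imp_le)
  then have s: "0 < s" by (simp add: s_def)
  have S_cball: "S p \<subseteq> cball (a p) (s / 4)" if p: "p \<in> \<P>" for p
  proof -
    have "r p \<le> (\<Sum>p\<in>\<P>. r p)"
      by (rule member_le_sum) (use p \<P> r(1) in \<open>auto simp: less_imp_le\<close>)
    then have "r p / 4 \<le> s / 4" by (simp add: s_def)
    then show ?thesis using r(2)[OF p] by (meson order_trans subset_cball)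
  qed
  define \<Lambda> where "\<Lambda> = (\<lambda>W. dual_lattice (B W) s)"
  have cell: "lattice_cell (B (D p)) s (a p) (?H p)" if p: "p \<in> \<P>" for p
  proof
    have W: "subspace (D p)" using plane[OF p] by simp
    show "finite (B (D p))" "pairwise orthogonal (B (D p))" "\<And>b. b \<in> B (D p) \<Longrightarrow> norm b = 1"
      using B W by blast+
    show "0 < s" by (rule s)
    show "sets (?H p) = sets borel" by simp
    show "distr (?H p) borel (\<lambda>x. x + w) = ?H p" for w
      by (rule distr_hausdorff_measure_translation)
    have sub: "cell (B (D p)) s (a p) \<subseteq> {x. x - a p \<in> span (B (D p))}"
      by (auto simp: cell_def)
    have "bounded (cell (B (D p)) s (a p))"
    proof -
      have "norm (x - a p) \<le> real (card (B (D p))) * s" if x: "x \<in> cell (B (D p)) s (a p)" for x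
      proof -
        have "norm (x - a p) \<le> (\<Sum>b\<in>B (D p). \<bar>(x - a p) \<bullet> b\<bar>)"
          by (rule orthonormal_norm_le) (use B W x in \<open>auto simp: cell_def\<close>)
        also have "\<dots> \<le> (\<Sum>b\<in>B (D p). s)"
        proof (rule sum_mono)
          fix b assume "b \<in> B (D p)"
          then have "- (s / 2) \<le> (x - a p) \<bullet> b" "(x - a p) \<bullet> b < s / 2"
            using x by (auto simp: cell_def)
          then show "\<bar>(x - a p) \<bullet> b\<bar> \<le> s" using s by linarith
        qed
        finally show ?thesis by simp
      qed
      then have "cell (B (D p)) s (a p) \<subseteq> cball (a p) (real (card (B (D p))) * s)"
        by (auto simp: dist_norm norm_minus_commute)
      then show ?thesis by (rule bounded_subset[OF bounded_cball])
    qed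
    then have "hausdorff_outer (card (B (D p))) (cell (B (D p)) s (a p)) < \<infinity>"
      by (intro hausdorff_outer_bounded_plane[where ?x0.0 = "a p"] sub) (use B W in auto)
    then show "emeasure (?H p) (cell (B (D p)) s (a p)) < \<infinity>"
      using B(1,4)[OF W] by (simp add: emeasure_hausdorff_measure cell_borel)
  qed
  have supp: "S p \<subseteq> {x. x - a p \<in> span (B (D p))} \<inter> cball (a p) (s / 4)" if p: "p \<in> \<P>" for p
    using S[OF p] plane[OF p] B(5)[of "D p"] S_cball[OF p] by auto
  define volume where "volume = (\<lambda>p. measure (?H p) (cell (B (D p)) s (a p)))"
  have frame: "finite_euclidean_measure (\<rho> p)" "lower_frame (\<rho> p) (\<Lambda> (D p)) (\<lambda>l. l) (volume p / 2)"
    "bessel (\<rho> p) (\<Lambda> (D p)) (\<lambda>l. l) ((volume p + 1) * N)" "0 < volume p" if p: "p \<in> \<P>" for p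
  proof -
    interpret lattice_cell "B (D p)" s "a p" "?H p" by (rule cell[OF p])
    have mK: "m p x = 0" if "x \<notin> K" for x
      using m(2)[OF p] supp[OF p] that by blast
    \<comment> \<open>The positive measure of \<open>S p\<close> is what makes the cell volume, and
      hence the lower frame bound, positive.\<close>
    have "emeasure (?H p) (S p) \<le> emeasure (?H p) Q"
      using supp[OF p] K_subset by (intro emeasure_mono) auto
    then have "0 < emeasure (?H p) Q"
      using S[OF p] by (auto intro: less_le_trans)
    then have "0 < measure (?H p) Q"
      using finite_cell by (simp add: measure_def enn2real_positive_iff)
    then show pos: "0 < volume p" by (simp add: volume_def)
    then have pos': "0 < vol" by (simp add: volume_def vol_def)
    have eq: "vol = volume p" by (simp add: volume_def vol_def)
    note df = density_frame[OF m(1)[OF p] mK m(3)[OF p] m(4)[OF p] pos']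
    show "finite_euclidean_measure (\<rho> p)" "lower_frame (\<rho> p) (\<Lambda> (D p)) (\<lambda>l. l) (volume p / 2)"
      "bessel (\<rho> p) (\<Lambda> (D p)) (\<lambda>l. l) ((volume p + 1) * N)"
      using df unfolding eq \<rho>_def \<Lambda>_def by blast+
  qed
  have AE_plane: "AE x in \<rho> p. x \<in> p" if p: "p \<in> \<P>" for p
  proof -
    have "x \<in> p" if "0 < m p x" for x
      using m(2)[OF p, of x] S[OF p] that by (metis less_irrefl subsetD)
    moreover have "m p \<in> borel_measurable (?H p)"
      using m(1)[OF p] by (simp add: measurable_cong_sets[of "?H p" borel])
    ultimately show ?thesis
      unfolding \<rho>_def by (subst AE_density) (auto intro!: AE_I2)
  qed
  have null: "emeasure (\<rho> p) {x. v \<bullet> x = c} = 0" if p: "p \<in> \<P>" and w: "w \<in> D p" "v \<bullet> w \<noteq> 0" for p v w c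
  proof -
    have W: "subspace (D p)" using plane[OF p] by simp
    have hyp: "{x. v \<bullet> x = c} \<in> sets borel"
      by (intro borel_closed closed_hyperplane)
    have "emeasure (\<rho> p) {x. v \<bullet> x = c} = (\<integral>\<^sup>+x. ennreal (m p x) * indicator {x. v \<bullet> x = c} x \<partial>?H p)"
      unfolding \<rho>_def using m(1)[OF p] hyp
      by (intro emeasure_density) (simp_all add: measurable_cong_sets[of "?H p" borel])
    also have "\<dots> \<le> (\<integral>\<^sup>+x. ennreal \<bar>N\<bar> * indicator (S p \<inter> {x. v \<bullet> x = c}) x \<partial>?H p)"
    proof (rule nn_integral_mono)
      fix x
      have "m p x \<le> \<bar>N\<bar>" using m(4)[OF p, of x] by linarith
      then show "ennreal (m p x) * indicator {x. v \<bullet> x = c} x \<le> ennreal \<bar>N\<bar> * indicator (S p \<inter> {x. v \<bullet> x = c}) x"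
        using m(2)[OF p, of x] by (auto simp: indicator_def intro: ennreal_leI)
    qed
    also have "\<dots> = ennreal \<bar>N\<bar> * emeasure (?H p) (S p \<inter> {x. v \<bullet> x = c})"
      using S[OF p] hyp by (intro nn_integral_cmult_indicator) auto
    also have "emeasure (?H p) (S p \<inter> {x. v \<bullet> x = c}) = 0"
      using hausdorff_measure_hyperplane_section[of "B (D p)" "S p" "a p" w v c] B[OF W] S[OF p] w supp[OF p]
      by auto
    finally show ?thesis by simp
  qed
  have group: "\<exists>C. \<forall>A'. \<exists>Y (l :: nat \<times> nat \<Rightarrow> 'a) E. lower_frame (borel_measure_sum \<rho> (J W)) Y l A' \<and>
      bessel (borel_measure_sum \<rho> (J W)) Y l E \<and> (\<forall>k\<in>D ` \<P> - {W}. bessel (borel_measure_sum \<rho> (J k)) Y l C)"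
    if W: "W \<in> D ` \<P>" for W
  proof -
    obtain p0 where p0: "p0 \<in> \<P>" "W = D p0" using W by auto
    have sub: "subspace W" using plane[OF p0(1)] p0(2) by simp
    have DJ: "D p = W" "p \<in> \<P>" if "p \<in> J W" for p using that by (auto simp: J_def)
    \<comment> \<open>Incomparability supplies in each other direction a vector outside
      \<open>W\<close>. If \<open>v\<close> is not orthogonal to it, hyperplanes orthogonal to
      \<open>v\<close> are null for the measures on that direction.\<close>
    have "\<exists>w. w \<in> W' - W" if "W' \<in> D ` \<P> - {W}" for W'
      using that incomparable p0 by blast
    then obtain wit where wit: "\<And>W'. W' \<in> D ` \<P> - {W} \<Longrightarrow> wit W' \<in> W' - W"
      by metis
    \<comment> \<open>Two demands on \<open>v\<close>: nonzero product with the witness of every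
      other direction, for decay of the transforms, and heights of distinct parallel planes that
      differ by a non-integer, for their separation.\<close>
    define U where "U = wit ` (D ` \<P> - {W}) \<union> (\<lambda>(p, q). a p - a q) ` {(p, q) \<in> J W \<times> J W. p \<noteq> q}"
    have fin_U: "finite U"
    proof -
      have "finite {(p, q) \<in> J W \<times> J W. p \<noteq> q}"
        by (rule finite_subset[of _ "J W \<times> J W"]) (use J in auto)
      then show ?thesis using \<P> by (simp add: U_def)
    qed
    \<comment> \<open>Two planes with direction \<open>W\<close> whose base points differ by a
      vector of \<open>W\<close> coincide.\<close>
    have base_diff: "a p - a q \<notin> W" if pq: "p \<in> J W" "q \<in> J W" "p \<noteq> q" for p q
    proof
      assume d: "a p - a q \<in> W"
      have "x - a p \<in> W \<longleftrightarrow> x - a q \<in> W" for x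
        using subspace_add[OF sub _ d, of "x - a p"] subspace_diff[OF sub _ d, of "x - a q"] by auto
      moreover have "p = {x. x - a p \<in> W}" "q = {x. x - a q \<in> W}"
        using plane[OF DJ(2)[OF pq(1)]] plane[OF DJ(2)[OF pq(2)]] DJ(1)[OF pq(1)] DJ(1)[OF pq(2)] by auto
      ultimately show False using pq(3) by blast
    qed
    have "U \<inter> W = {}"
      using wit base_diff by (auto simp: U_def)
    then obtain v where v: "\<And>w. w \<in> W \<Longrightarrow> v \<bullet> w = 0" "\<And>u. u \<in> U \<Longrightarrow> v \<bullet> u \<notin> \<int>"
      using exists_generic_vector_nonint[OF sub fin_U] by blast
    \<comment> \<open>Lattice points are numbered by naturals, as \<open>oversampled_frame\<close>
      expects. For a zero-dimensional \<open>W\<close> the lattice is a single point, so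
      \<open>X\<close> may be finite.\<close>
    define X where "X = to_nat_on (\<Lambda> W) ` \<Lambda> W"
    define \<xi> where "\<xi> = from_nat_into (\<Lambda> W)"
    have countable: "countable (\<Lambda> W)"
      unfolding \<Lambda>_def by (rule countable_dual_lattice) (rule B(1)[OF sub])
    have \<xi>: "\<xi> ` X = \<Lambda> W" "inj_on \<xi> X"
      using countable by (auto simp: X_def \<xi>_def image_image inj_on_def)
    define A where "A = Min (volume ` J W) / 2"
    define E where "E = Max ((\<lambda>p. (volume p + 1) * N) ` J W)"
    have neJ: "J W \<noteq> {}" using p0 by (auto simp: J_def)
    show ?thesis
    proof (rule oversampled_frame[where v = v and c = "\<lambda>p. v \<bullet> a p" and X = X and \<xi> = \<xi> and A = A and B = E])
      show "finite (J W)" by (rule J)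
      show "finite (D ` \<P> - {W})" using \<P> by simp
      fix p assume p: "p \<in> J W"
      show "finite_euclidean_measure (\<rho> p)" using frame(1) DJ(2)[OF p] .
      show "AE x in \<rho> p. v \<bullet> x = v \<bullet> a p"
        using AE_plane[OF DJ(2)[OF p]]
      proof eventually_elim
        case (elim x)
        then have "x - a p \<in> W" using plane[OF DJ(2)[OF p]] DJ(1)[OF p] by blast
        then show ?case using v(1)[of "x - a p"] by (simp add: inner_diff_right)
      qed
      show "lower_frame (\<rho> p) X \<xi> A"
      proof (rule lower_frame_mono)
        show "lower_frame (\<rho> p) X \<xi> (volume p / 2)"
          using lower_frame_reindex[of "\<rho> p" \<xi> X "\<lambda>l. l"] frame(2)[OF DJ(2)[OF p]] \<xi> DJ(1)[OF p] by simp
        show "A \<le> volume p / 2" using J p by (simp add: A_def)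
      qed
      show "bessel (\<rho> p) X \<xi> E"
      proof (rule bessel_mono)
        show "bessel (\<rho> p) X \<xi> ((volume p + 1) * N)"
          using bessel_reindex[of "\<rho> p" "\<Lambda> W" "\<lambda>l. l" _ \<xi> X] frame(3)[OF DJ(2)[OF p]] \<xi> DJ(1)[OF p] by simp
        show "(volume p + 1) * N \<le> E" unfolding E_def using J p by (intro Max_ge) auto
      qed
    next
      fix p q assume pq: "p \<in> J W" "q \<in> J W" "p \<noteq> q"
      then have "a p - a q \<in> U" by (auto simp: U_def)
      then show "v \<bullet> a p - v \<bullet> a q \<notin> \<int>" using v(2) by (simp flip: inner_diff_right)
    next
      show "0 < A"
        using J neJ frame(4) DJ(2) by (simp add: A_def)
    next
      fix W' assume W': "W' \<in> D ` \<P> - {W}"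
      show "finite_euclidean_measure (borel_measure_sum \<rho> (J W'))"
        using J by (intro finite_euclidean_measure_sum frame(1)) (auto simp: J_def)
      fix c
      have wU: "v \<bullet> wit W' \<noteq> 0"
        using v(2)[of "wit W'"] W' by (auto simp: U_def)
      have "emeasure (borel_measure_sum \<rho> (J W')) {x. v \<bullet> x = c} = (\<Sum>p\<in>J W'. emeasure (\<rho> p) {x. v \<bullet> x = c})"
        by (intro emeasure_borel_measure_sum) (auto simp: \<rho>_def intro: borel_closed closed_hyperplane)
      also have "\<dots> = (\<Sum>p\<in>J W'. 0)"
        using wit[OF W'] wU by (intro sum.cong refl null[where w = "wit W'"]) (auto simp: J_def)
      finally show "emeasure (borel_measure_sum \<rho> (J W')) {x. v \<bullet> x = c} = 0" by simp
    qed
  qed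
  have "admits_fourier_frame (borel_measure_sum (\<lambda>W. borel_measure_sum \<rho> (J W)) (D ` \<P>))"
  proof (rule admits_fourier_frame_sum)
    show "finite (D ` \<P>)" using \<P> by simp
    show "finite_euclidean_measure (borel_measure_sum \<rho> (J W))" for W
      using J by (intro finite_euclidean_measure_sum frame(1)) (auto simp: J_def)
  qed (rule group)
  then show ?thesis by (simp only: J_def)
qed

section \<open>From the given sets to planes and directions\<close>

theorem theorem4p1:
  fixes \<F> :: "(real ^ 'd) set set"
    and k :: "(real ^ 'd) set \<Rightarrow> nat"
    and V :: "(real ^ 'd) set \<Rightarrow> (real ^ 'd) set"
  assumes "finite \<F>"
    and "\<And>F. F \<in> \<F> \<Longrightarrow> bounded F \<and> F \<in> sets borel"
    and "\<And>F. F \<in> \<F> \<Longrightarrow> affine (V F) \<and> aff_dim (V F) = int (k F) \<and> F \<subseteq> V F"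
    and "\<And>F. F \<in> \<F> \<Longrightarrow> emeasure (hausdorff_measure (k F)) F > 0"
    and "\<And>F F' \<tau>. F \<in> \<F> \<Longrightarrow> F' \<in> \<F> \<Longrightarrow> k F > k F' \<Longrightarrow> \<not> (\<lambda>v. v + \<tau>) ` V F' \<subseteq> V F"
  shows "admits_fourier_frame
    (borel_measure_sum (\<lambda>F. density (hausdorff_measure (k F)) (indicator F)) \<F>)"
proof -
  \<comment> \<open>Planes rather than sets are the units of the argument: several sets may span the
    same plane, and \<open>a\<close> and \<open>D\<close> must then agree for them, so both are
    functions of the plane alone.\<close>
  define \<P> where "\<P> = V ` \<F>"
  define a where "a = (\<lambda>p :: (real ^ 'd) set. SOME x. x \<in> p)"
  define D where "D = (\<lambda>p. (\<lambda>x. x - a p) ` p)"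
  define G where "G = (\<lambda>p. {F \<in> \<F>. V F = p})"
  define S where "S = (\<lambda>p. \<Union>(G p))"
  define m where "m = (\<lambda>p x. \<Sum>F\<in>G p. indicator F x :: real)"
  have G: "finite (G p)" for p using assms(1) by (simp add: G_def)
  have plane: "a (V F) \<in> V F" "subspace (D (V F))" "V F = {x. x - a (V F) \<in> D (V F)}" "dim (D (V F)) = k F"
    if F: "F \<in> \<F>" for F
  proof -
    \<comment> \<open>The empty set has affine dimension -1, so the plane is nonempty and the chosen
      base point lies in it.\<close>
    have "aff_dim (V F) \<noteq> -1" using assms(3)[OF F] by simp
    then have "V F \<noteq> {}" by auto
    then show aV: "a (V F) \<in> V F" unfolding a_def by (simp add: some_in_eq)
    show "subspace (D (V F))"
      unfolding D_def using assms(3)[OF F] aV by (intro affine_diffs_subspace_subtract) auto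
    show "V F = {x. x - a (V F) \<in> D (V F)}"
      by (auto simp: D_def)
    show "dim (D (V F)) = k F"
      using aff_dim_dim_affine_diffs[OF _ aV] assms(3)[OF F] unfolding D_def by simp
  qed
  let ?\<rho> = "\<lambda>p. density (hausdorff_measure (dim (D p))) (\<lambda>x. ennreal (m p x)) :: (real ^ 'd) measure"
  let ?M = "\<lambda>F. density (hausdorff_measure (k F)) (indicator F) :: (real ^ 'd) measure"
  let ?N = "borel_measure_sum (\<lambda>W. borel_measure_sum ?\<rho> {p \<in> \<P>. D p = W}) (D ` \<P>)"
  have main: "admits_fourier_frame ?N"
  proof (rule admits_fourier_frame_planes[where a = a and S = S and N = "real (card \<F>)"])
    show "finite \<P>" using assms(1) by (simp add: \<P>_def)
    fix p assume "p \<in> \<P>"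
    then obtain F0 where F0: "F0 \<in> \<F>" "p = V F0" by (auto simp: \<P>_def)
    show "subspace (D p) \<and> p = {x. x - a p \<in> D p}"
      using plane[OF F0(1)] F0(2) by simp
    have "emeasure (hausdorff_measure (dim (D p))) F0 \<le> emeasure (hausdorff_measure (dim (D p))) (S p)"
      using F0 assms(1,2) by (intro emeasure_mono) (auto simp: S_def G_def intro!: sets.finite_Union)
    moreover have "0 < emeasure (hausdorff_measure (dim (D p))) F0"
      using assms(4)[OF F0(1)] plane(4)[OF F0(1)] F0(2) by simp
    ultimately have "0 < emeasure (hausdorff_measure (dim (D p))) (S p)"
      by (rule less_le_trans[rotated])
    moreover have "bounded (S p)" "S p \<in> sets borel" "S p \<subseteq> p"
      using assms(1-3) by (auto simp: S_def G_def intro!: bounded_Union sets.finite_Union)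
    ultimately show "bounded (S p) \<and> S p \<in> sets borel \<and> S p \<subseteq> p \<and>
        emeasure (hausdorff_measure (dim (D p))) (S p) > 0" by simp
    show "m p \<in> borel_measurable borel"
      unfolding m_def using assms(2)
      by (intro borel_measurable_sum borel_measurable_indicator) (auto simp: G_def)
    fix x
    show "m p x = 0" if "x \<notin> S p"
      unfolding m_def by (rule sum.neutral) (use that in \<open>auto simp: S_def indicator_def\<close>)
    show "m p x = 0 \<or> 1 \<le> m p x"
    proof (cases "x \<in> S p")
      case True
      then obtain F where F: "F \<in> G p" "x \<in> F" by (auto simp: S_def)
      have "indicator F x \<le> m p x"
        unfolding m_def using G F by (intro member_le_sum) auto
      then show ?thesis using F by simp
    next
      case False
      then have "m p x = 0"
        unfolding m_def by (intro sum.neutral) (auto simp: S_def indicator_def)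
      then show ?thesis by simp
    qed
    have "m p x \<le> (\<Sum>F\<in>G p. 1)"
      unfolding m_def by (intro sum_mono) (auto simp: indicator_def)
    also have "\<dots> \<le> real (card \<F>)"
      using assms(1) by (auto simp: G_def intro!: card_mono)
    finally show "m p x \<le> real (card \<F>)" .
  next
    fix p q assume "p \<in> \<P>" "q \<in> \<P>" and ne: "D p \<noteq> D q"
    then obtain F F' where F: "F \<in> \<F>" "p = V F" and F': "F' \<in> \<F>" "q = V F'" by (auto simp: \<P>_def)
    note P = plane[OF F(1), folded F(2)] and P' = plane[OF F'(1), folded F'(2)]
    show "\<not> D q \<subseteq> D p"
    proof
      assume sub: "D q \<subseteq> D p"
      show False
      \<comment> \<open>If \<open>k F'\<close> is smaller, a translate of \<open>V F'\<close> would
        lie in \<open>V F\<close>, contrary to the hypothesis. Otherwise the inclusion goes into a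
        subspace of no larger dimension and is an equality.\<close>
      proof (cases "k F' < k F")
        case True
        have "x + (a p - a q) \<in> p" if "x \<in> q" for x
        proof -
          have "x - a q \<in> D p" using that sub P'(3) by blast
          moreover have "x + (a p - a q) - a p = x - a q" by simp
          ultimately have "x + (a p - a q) - a p \<in> D p" by simp
          then show ?thesis using P(3) by blast
        qed
        then have "(\<lambda>v. v + (a p - a q)) ` V F' \<subseteq> V F"
          using F(2) F'(2) by auto
        then show False using assms(5)[OF F(1) F'(1) True] by blast
      next
        case False
        then have "dim (D p) \<le> dim (D q)" using P(4) P'(4) by simp
        then have "D q = D p"
          by (rule subspace_dim_equal[OF P'(2) P(2) sub])
        then show False using ne by simp
      qed
    qed
  qed
  \<comment> \<open>The nested sum over directions and their planes, with overlaps counted by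
    \<open>m\<close>, is the given sum regrouped along \<open>D\<close> and \<open>V\<close>. Since
    \<open>dim (D (V F)) = k F\<close>, the same Hausdorff measure occurs on both sides.\<close>
  have "borel_measure_sum ?M \<F> = ?N"
  proof (rule measure_eqI)
    fix A :: "(real ^ 'd) set"
    assume "A \<in> sets (borel_measure_sum ?M \<F>)"
    then have A: "A \<in> sets borel" by simp
    have fin: "finite \<P>" using assms(1) by (simp add: \<P>_def)
    have F_emeasure: "emeasure (?M F) A
        = (\<integral>\<^sup>+x. indicator F x * indicator A x \<partial>hausdorff_measure (k F))" if "F \<in> \<F>" for F
      using assms(2)[OF that] A by (intro emeasure_density) auto
    have \<rho>_emeasure: "emeasure (?\<rho> p) A = (\<Sum>F\<in>G p. emeasure (?M F) A)" for p
    proof -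
      have meas: "(\<lambda>x. indicator F x :: ennreal) \<in> borel_measurable (hausdorff_measure (dim (D p)))" if "F \<in> G p" for F
        using assms(2) that by (intro borel_measurable_indicator) (auto simp: G_def)
      have eq: "ennreal (m p x) = (\<Sum>F\<in>G p. indicator F x)" for x
        unfolding m_def by (subst sum_ennreal[symmetric]) (auto simp: ennreal_indicator)
      have "emeasure (?\<rho> p) A = (\<integral>\<^sup>+x. (\<Sum>F\<in>G p. indicator F x) * indicator A x \<partial>hausdorff_measure (dim (D p)))"
        unfolding eq using meas A by (intro emeasure_density borel_measurable_sum) auto
      also have "\<dots> = (\<integral>\<^sup>+x. (\<Sum>F\<in>G p. indicator F x * indicator A x) \<partial>hausdorff_measure (dim (D p)))"
        by (simp only: sum_distrib_right)
      also have "\<dots> = (\<Sum>F\<in>G p. \<integral>\<^sup>+x. indicator F x * indicator A x \<partial>hausdorff_measure (dim (D p)))"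
        using meas A by (intro nn_integral_sum borel_measurable_times) auto
      also have "\<dots> = (\<Sum>F\<in>G p. emeasure (?M F) A)"
        using plane(4) by (intro sum.cong refl) (auto simp: G_def F_emeasure)
      finally show ?thesis .
    qed
    have "emeasure ?N A = (\<Sum>W\<in>D ` \<P>. \<Sum>p\<in>{p \<in> \<P>. D p = W}. emeasure (?\<rho> p) A)"
    proof -
      have "emeasure ?N A = (\<Sum>W\<in>D ` \<P>. emeasure (borel_measure_sum ?\<rho> {p \<in> \<P>. D p = W}) A)"
        by (rule emeasure_borel_measure_sum) (use A in auto)
      also have "\<dots> = (\<Sum>W\<in>D ` \<P>. \<Sum>p\<in>{p \<in> \<P>. D p = W}. emeasure (?\<rho> p) A)"
        by (intro sum.cong refl emeasure_borel_measure_sum) (use A in auto)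
      finally show ?thesis .
    qed
    also have "\<dots> = (\<Sum>p\<in>\<P>. emeasure (?\<rho> p) A)"
      using sum.image_gen[OF fin, of "\<lambda>p. emeasure (?\<rho> p) A" D] by simp
    also have "\<dots> = (\<Sum>p\<in>\<P>. \<Sum>F\<in>{F \<in> \<F>. V F = p}. emeasure (?M F) A)"
      by (simp only: \<rho>_emeasure G_def)
    also have "\<dots> = (\<Sum>F\<in>\<F>. emeasure (?M F) A)"
      unfolding \<P>_def by (rule sum.image_gen[OF assms(1), symmetric])
    also have "\<dots> = emeasure (borel_measure_sum ?M \<F>) A"
      using A by (intro emeasure_borel_measure_sum[symmetric]) auto
    finally show "emeasure (borel_measure_sum ?M \<F>) A = emeasure ?N A" ..
  qed simp
  with main show ?thesis by simp
qed

end
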